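(* Let $k,m\ge1$ and $0\le d\le km$. We have the orthogonal decomposition $$\Lambda^d_{\mathbb C}(\mathbb C^k\otimes\mathbb C^m)=\bigoplus_\lambda V^{\mathbb C}_\lambda,$$ where the sum runs over all Young diagrams $\lambda\subseteq[k]\times[m]$ with $d$ boxes. This is the decomposition of $\Lambda^d_{\mathbb C}(\mathbb C^k\otimes\mathbb C^m)$ into simple $\mathrm{GL}(\mathbb C^k)\times\mathrm{GL}(\mathbb C^m)$-modules, which is multiplicity-free.
   Context: $\mathbb C^k\otimes\mathbb C^m$ carries the tensor action of $\mathrm{GL}(\mathbb C^k)\times\mathrm{GL}(\mathbb C^m)$, and $\Lambda_{\mathbb C}^d(\mathbb C^k\otimes\mathbb C^m)\simeq\Lambda^d(\mathbb R^k\otimes\mathbb R^m)\otimes_{\mathbb R}\mathbb C$ carries the induced action and the standard Hermitian inner product (induced from $\mathbb C^k\otimes\mathbb C^m$). A Young diagram $\lambda\subseteq[k]\times[m]$ is identified with its set of boxes $(i,j)$, $j\le\lambda_i$. Put $v_\lambda=\bigwedge_{(i,j)\in\lambda}e_i\otimes f_j\in\Lambda^d(\mathbb R^k\otimes\mathbb R^m)$, with $(e_i)$, $(f_j)$ the standard bases (defined up to sign). The Schubert span $V_\lambda$ is the linear span of the Schubert zonoid associated with the real Schubert variety $\Omega_\lambda\subseteq G(k,m)$; equivalently (and this may be taken as the definition), $V_\lambda$ is the real linear span of the $\mathrm O(k)\times\mathrm O(m)$-orbit of $v_\lambda$ in $\Lambda^d(\mathbb R^k\otimes\mathbb R^m)$.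 The complex Schubert span $V_\lambda^{\mathbb C}$ is the $\mathbb C$-linear span of $V_\lambda$ in $\Lambda_{\mathbb C}^d(\mathbb C^k\otimes\mathbb C^m)$. Multiplicity-free means that the simple summands are pairwise nonisomorphic. *)

theory Defs
  imports
    Complex_Main
    "HOL-Library.Function_Algebras"
    "HOL-Library.FuncSet"
    "HOL-Combinatorics.Combinatorics"
    "Jordan_Normal_Form.Determinant"
begin

text \<open>
  Vectors of $F^k \otimes F^m$ are functions on the index pairs $(i,j)$ with $i < k$, $j < m$
  (all indices are 0-based), and elements of $(F^k \otimes F^m)^{\otimes d}$ are functions on the
  lists of \<open>d\<close> such pairs; both are required to be 0 outside the index range, so that
  tensors are determined by their coordinates.
\<close>

type_synonym 'a tensor = "(nat \<times> nat) list \<Rightarrow> 'a"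

definition scaleT :: "'a::field \<Rightarrow> ('i \<Rightarrow> 'a) \<Rightarrow> 'i \<Rightarrow> 'a" where
  "scaleT c w = (\<lambda>I. c * w I)"

global_interpretation tens: vector_space "scaleT :: 'a::field \<Rightarrow> ('i \<Rightarrow> 'a) \<Rightarrow> 'i \<Rightarrow> 'a"
  by unfold_locales (auto simp: scaleT_def fun_eq_iff algebra_simps)

definition tuples :: "nat \<Rightarrow> nat \<Rightarrow> nat \<Rightarrow> (nat \<times> nat) list set" where
  "tuples k m d = {I. length I = d \<and> set I \<subseteq> {..<k} \<times> {..<m}}"

text \<open>
  The exterior power $\Lambda^d(F^k \otimes F^m)$, for \<open>F\<close> of characteristic 0, is realised as the
  space of antisymmetric tensors in $(F^k \otimes F^m)^{\otimes d}$, with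
  $x_1 \wedge \dots \wedge x_d =
     \sum_{\sigma} \mathrm{sgn}(\sigma)\, x_{\sigma(1)} \otimes \dots \otimes x_{\sigma(d)}$.
\<close>

definition ext_power :: "nat \<Rightarrow> nat \<Rightarrow> nat \<Rightarrow> 'a::field_char_0 tensor set" where
  "ext_power k m d =
     {w. (\<forall>I. I \<notin> tuples k m d \<longrightarrow> w I = 0) \<and>
         (\<forall>I \<in> tuples k m d. \<forall>p. p permutes {..<d} \<longrightarrow>
            w (permute_list p I) = of_int (sign p) * w I)}"

definition wedge :: "nat \<Rightarrow> nat \<Rightarrow> (nat \<times> nat \<Rightarrow> 'a) list \<Rightarrow> 'a::field_char_0 tensor" where
  "wedge k m xs = (\<lambda>I. if I \<in> tuples k m (length xs)
     then det (mat (length xs) (length xs) (\<lambda>(s, t). (xs ! s) (I ! t))) else 0)"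

definition tensor_vec :: "'a::semiring_1 vec \<Rightarrow> 'a vec \<Rightarrow> nat \<times> nat \<Rightarrow> 'a" where
  "tensor_vec x y = (\<lambda>(i, j). if i < dim_vec x \<and> j < dim_vec y then x $ i * y $ j else 0)"

text \<open>
  The action of a pair of matrices by $(g \otimes h)^{\otimes d}$. On antisymmetric tensors it is
  the induced action on the exterior power, see \<open>tensor_action_wedge\<close> below.
\<close>

definition tensor_action ::
    "nat \<Rightarrow> nat \<Rightarrow> nat \<Rightarrow> 'a::field mat \<Rightarrow> 'a mat \<Rightarrow> 'a tensor \<Rightarrow> 'a tensor" where
  "tensor_action k m d g h w = (\<lambda>I. if I \<in> tuples k m d then
     (\<Sum>J \<in> tuples k m d.
        (\<Prod>t<d. g $$ (fst (I ! t), fst (J ! t)) * h $$ (snd (I ! t), snd (J ! t))) * w J)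
     else 0)"

text \<open>
  The factor $1/d!$ makes $\langle x_1 \wedge \dots \wedge x_d, y_1 \wedge \dots \wedge y_d\rangle
  = \det (\langle x_i, y_j \rangle)$, i.e. the wedges of distinct basis vectors are orthonormal.
\<close>

definition herm_inner :: "nat \<Rightarrow> nat \<Rightarrow> nat \<Rightarrow> complex tensor \<Rightarrow> complex tensor \<Rightarrow> complex" where
  "herm_inner k m d v w = (\<Sum>I \<in> tuples k m d. v I * cnj (w I)) / fact d"


text \<open>
  A Young diagram in $[k] \times [m]$ is given by its weakly decreasing list of row lengths
  $\lambda_1 \ge \dots \ge \lambda_k \ge 0$, zero rows included.
\<close>

definition young_diagrams :: "nat \<Rightarrow> nat \<Rightarrow> nat \<Rightarrow> nat list set" where
  "young_diagrams k m d =
     {la. length la = k \<and> sorted_wrt (\<ge>) la \<and> (\<forall>r \<in> set la. r \<le> m) \<and> sum_list la = d}"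

definition boxes :: "nat list \<Rightarrow> (nat \<times> nat) list" where
  "boxes la = concat (map (\<lambda>i. map (\<lambda>j. (i, j)) [0..<la ! i]) [0..<length la])"

definition young_vector :: "nat \<Rightarrow> nat \<Rightarrow> nat list \<Rightarrow> real tensor" where
  "young_vector k m la =
     wedge k m (map (\<lambda>(i, j). tensor_vec (unit_vec k i) (unit_vec m j)) (boxes la))"

definition orthogonal_group :: "nat \<Rightarrow> real mat set" where
  "orthogonal_group n = {g \<in> carrier_mat n n. transpose_mat g * g = 1\<^sub>m n}"

definition schubert_span :: "nat \<Rightarrow> nat \<Rightarrow> nat list \<Rightarrow> real tensor set" where
  "schubert_span k m la = tens.span
     {tensor_action k m (sum_list la) g h (young_vector k m la) | g h.
        g \<in> orthogonal_group k \<and> h \<in> orthogonal_group m}"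

definition complex_schubert_span :: "nat \<Rightarrow> nat \<Rightarrow> nat list \<Rightarrow> complex tensor set" where
  "complex_schubert_span k m la =
     tens.span ((\<lambda>w I. complex_of_real (w I)) ` schubert_span k m la)"


definition general_linear :: "nat \<Rightarrow> complex mat set" where
  "general_linear n = {g \<in> carrier_mat n n. invertible_mat g}"

definition GL_submodule :: "nat \<Rightarrow> nat \<Rightarrow> nat \<Rightarrow> complex tensor set \<Rightarrow> bool" where
  "GL_submodule k m d W \<longleftrightarrow> tens.subspace W \<and> W \<subseteq> ext_power k m d \<and>
     (\<forall>g \<in> general_linear k. \<forall>h \<in> general_linear m. \<forall>w \<in> W. tensor_action k m d g h w \<in> W)"

definition simple_GL_submodule :: "nat \<Rightarrow> nat \<Rightarrow> nat \<Rightarrow> complex tensor set \<Rightarrow> bool" where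
  "simple_GL_submodule k m d W \<longleftrightarrow> GL_submodule k m d W \<and> W \<noteq> {0} \<and>
     (\<forall>U. GL_submodule k m d U \<longrightarrow> U \<subseteq> W \<longrightarrow> U = {0} \<or> U = W)"

definition GL_isomorphic ::
    "nat \<Rightarrow> nat \<Rightarrow> nat \<Rightarrow> complex tensor set \<Rightarrow> complex tensor set \<Rightarrow> bool" where
  "GL_isomorphic k m d W W' \<longleftrightarrow> (\<exists>f. bij_betw f W W' \<and>
     (\<forall>v \<in> W. \<forall>w \<in> W. f (v + w) = f v + f w) \<and>
     (\<forall>c. \<forall>w \<in> W. f (scaleT c w) = scaleT c (f w)) \<and>
     (\<forall>g \<in> general_linear k. \<forall>h \<in> general_linear m. \<forall>w \<in> W.
        f (tensor_action k m d g h w) = tensor_action k m d g h (f w)))"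

definition direct_sum_decomposition ::
    "('i \<Rightarrow> 'a::field) set \<Rightarrow> 'l set \<Rightarrow> ('l \<Rightarrow> ('i \<Rightarrow> 'a) set) \<Rightarrow> bool" where
  "direct_sum_decomposition W L V \<longleftrightarrow> finite L \<and> tens.subspace W \<and>
     (\<forall>l \<in> L. tens.subspace (V l) \<and> V l \<subseteq> W) \<and>
     (\<forall>w \<in> W. \<exists>!c. c \<in> (\<Pi>\<^sub>E l \<in> L. V l) \<and> w = (\<Sum>l \<in> L. c l))"

definition orthogonal_decomposition ::
    "nat \<Rightarrow> nat \<Rightarrow> nat \<Rightarrow> complex tensor set \<Rightarrow> 'l set \<Rightarrow> ('l \<Rightarrow> complex tensor set) \<Rightarrow> bool" where
  "orthogonal_decomposition k m d W L V \<longleftrightarrow> direct_sum_decomposition W L V \<and>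
     (\<forall>l \<in> L. \<forall>l' \<in> L. l \<noteq> l' \<longrightarrow> (\<forall>v \<in> V l. \<forall>w \<in> V l'. herm_inner k m d v w = 0))"


text \<open>Compatibility of the action with decomposable elements.\<close>

lemma sum_lists_prod:
  fixes f :: "nat \<Rightarrow> 'b \<Rightarrow> 'a::comm_semiring_1"
  assumes "finite A"
  shows "(\<Sum>J | length J = d \<and> set J \<subseteq> A. \<Prod>t<d. f t (J ! t)) = (\<Prod>t<d. \<Sum>a\<in>A. f t a)"
proof (induction d arbitrary: f)
  case 0
  have "{J. length J = 0 \<and> set J \<subseteq> A} = {[]}" by auto
  then show ?case by simp
next
  case (Suc d)
  have eq: "{J. length J = Suc d \<and> set J \<subseteq> A}
      = (\<lambda>(a, J). a # J) ` (A \<times> {J. length J = d \<and> set J \<subseteq> A})"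
    by (auto simp: length_Suc_conv image_iff)
  have inj: "inj_on (\<lambda>(a, J). a # J) (A \<times> {J. length J = d \<and> set J \<subseteq> A})"
    by (auto simp: inj_on_def)
  have "(\<Sum>J | length J = Suc d \<and> set J \<subseteq> A. \<Prod>t<Suc d. f t (J ! t))
     = (\<Sum>(a, J) \<in> A \<times> {J. length J = d \<and> set J \<subseteq> A}. f 0 a * (\<Prod>t<d. f (Suc t) (J ! t)))"
    unfolding eq by (subst sum.reindex[OF inj])
      (simp add: case_prod_unfold prod.lessThan_Suc_shift del: prod.lessThan_Suc)
  also have "\<dots> = (\<Sum>a\<in>A. f 0 a)
      * (\<Sum>J | length J = d \<and> set J \<subseteq> A. \<Prod>t<d. f (Suc t) (J ! t))"
    by (simp add: sum.cartesian_product[symmetric] sum_product)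
  also have "\<dots> = (\<Prod>t<Suc d. \<Sum>a\<in>A. f t a)"
    by (simp add: Suc[of "\<lambda>t. f (Suc t)"] prod.lessThan_Suc_shift del: prod.lessThan_Suc)
  finally show ?case .
qed

definition kron_apply ::
    "nat \<Rightarrow> nat \<Rightarrow> 'a::field mat \<Rightarrow> 'a mat \<Rightarrow> (nat \<times> nat \<Rightarrow> 'a) \<Rightarrow> nat \<times> nat \<Rightarrow> 'a" where
  "kron_apply k m g h x = (\<lambda>(i, j). if i < k \<and> j < m then
     (\<Sum>(a, b) \<in> {..<k} \<times> {..<m}. g $$ (i, a) * h $$ (j, b) * x (a, b)) else 0)"

lemma kron_apply_tensor_vec:
  assumes "g \<in> carrier_mat k k" "h \<in> carrier_mat m m" "x \<in> carrier_vec k" "y \<in> carrier_vec m"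
  shows "kron_apply k m g h (tensor_vec x y) = tensor_vec (g *\<^sub>v x) (h *\<^sub>v y)"
proof -
  have "(\<Sum>(a, b) \<in> {..<k} \<times> {..<m}. g $$ (i, a) * h $$ (j, b) * tensor_vec x y (a, b))
      = (g *\<^sub>v x) $ i * (h *\<^sub>v y) $ j" if "i < k" "j < m" for i j
    using assms that
    by (simp add: tensor_vec_def scalar_prod_def sum_product sum.cartesian_product
        case_prod_unfold lessThan_atLeast0[symmetric])
       (auto intro!: sum.cong simp: ac_simps)
  then show ?thesis
    using assms by (auto simp: kron_apply_def tensor_vec_def fun_eq_iff)
qed

lemma det_columns:
  "det (mat d d (\<lambda>(s, t). F s t))
     = (\<Sum>p | p permutes {..<d}. of_int (sign p) * (\<Prod>t<d. F (p t) t))"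
proof -
  have "det (mat d d (\<lambda>(s, t). F s t)) = det (transpose_mat (mat d d (\<lambda>(s, t). F s t)))"
    by (rule det_transpose[symmetric]) auto
  also have "transpose_mat (mat d d (\<lambda>(s, t). F s t)) = mat d d (\<lambda>(t, s). F s t)"
    by (rule eq_matI) auto
  also have "det \<dots> = (\<Sum>p | p permutes {..<d}. of_int (sign p) * (\<Prod>t<d. F (p t) t))"
    unfolding det_def lessThan_atLeast0
    by (simp add: permutes_in_image[of _ "{0..<d}", simplified])
  finally show ?thesis .
qed

lemma tensor_action_wedge:
  "tensor_action k m (length xs) g h (wedge k m xs) = wedge k m (map (kron_apply k m g h) xs)"
proof
  fix I
  let ?d = "length xs"
  let ?A = "{..<k} \<times> {..<m}"
  define G where "G t b = g $$ (fst (I ! t), fst b) * h $$ (snd (I ! t), snd b)" for t b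
  show "tensor_action k m ?d g h (wedge k m xs) I = wedge k m (map (kron_apply k m g h) xs) I"
  proof (cases "I \<in> tuples k m ?d")
    case False
    then show ?thesis by (simp add: tensor_action_def wedge_def)
  next
    case True
    have tup: "tuples k m ?d = {J. length J = ?d \<and> set J \<subseteq> ?A}"
      by (simp add: tuples_def)
    have K: "kron_apply k m g h x (I ! t) = (\<Sum>b\<in>?A. G t b * x b)" if "t < ?d" for x t
    proof -
      have "I ! t \<in> ?A" using True that by (auto simp: tuples_def)
      then show ?thesis by (auto simp: kron_apply_def G_def case_prod_unfold)
    qed
    have "tensor_action k m ?d g h (wedge k m xs) I
      = (\<Sum>J\<in>tuples k m ?d. (\<Prod>t<?d. G t (J ! t)) *
          (\<Sum>p | p permutes {..<?d}. of_int (sign p) * (\<Prod>t<?d. (xs ! p t) (J ! t))))"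
      using True by (simp add: tensor_action_def wedge_def det_columns G_def)
    also have "\<dots> = (\<Sum>p | p permutes {..<?d}. of_int (sign p) *
          (\<Sum>J\<in>tuples k m ?d. \<Prod>t<?d. G t (J ! t) * (xs ! p t) (J ! t)))"
      unfolding sum_distrib_left
      by (subst sum.swap) (simp add: prod.distrib ac_simps)
    also have "\<dots> = (\<Sum>p | p permutes {..<?d}. of_int (sign p) *
          (\<Prod>t<?d. \<Sum>b\<in>?A. G t b * (xs ! p t) b))"
      unfolding tup by (subst sum_lists_prod) auto
    also have "\<dots> = (\<Sum>p | p permutes {..<?d}. of_int (sign p) *
          (\<Prod>t<?d. (map (kron_apply k m g h) xs ! p t) (I ! t)))"
    proof (intro sum.cong refl arg_cong2[where f = "(*)"] prod.cong)
      fix p t assume "p \<in> {p. p permutes {..<?d}}" "t \<in> {..<?d}"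
      then have "t < ?d" "p t < ?d" using permutes_in_image[of p "{..<?d}" t] by auto
      then show "(\<Sum>b\<in>?A. G t b * (xs ! p t) b) = (map (kron_apply k m g h) xs ! p t) (I ! t)"
        by (simp add: K)
    qed
    also have "\<dots> = wedge k m (map (kron_apply k m g h) xs) I"
      using True by (simp add: wedge_def det_columns)
    finally show ?thesis .
  qed
qed

end

theory Submission
  imports Defs
begin

text \<open>
  Replace the groups by their Lie algebras, acting by derivations. The Young vector $v_\lambda$ is an
  eigenvector of all upper triangular matrices. Since every matrix is the sum of an upper triangular
  one and an antisymmetric or a strictly lower triangular one, the orthogonal orbit of $v_\lambda$, the
  strictly lower triangular matrices and the full Lie algebra all generate the same space; Newton's
  identities turn invariance under the Lie algebra into invariance under arbitrary matrices. As
  the adjoint of a lower triangular matrix is upper triangular, different $V_\lambda$ are orthogonal.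

  For completeness consider $T = \sum_{a<b} E_{ba} E_{ab} + \sum_{i<j} F_{ji} F_{ij}$, where $E$ and $F$
  are the matrix units of the two Lie algebras. The basis vector of a set $S$ of boxes is an eigenvector
  of $T$, and its eigenvalue is the number of pairs of a box of $S$ and a position missing from $S$ to
  the left of or above it. So the eigenvalue vanishes only for Young diagrams, and all other basis
  vectors are obtained by lowering vectors that are closer to the corner.

  For simplicity and non-isomorphism: the weight of $v_\lambda$ has multiplicity one in the whole
  exterior power, so an invariant subspace of $V_\lambda$ contains $v_\lambda$ or is orthogonal to its orbit.
\<close>

subsection \<open>Tensors and operators acting on the factors\<close>

text \<open>Completeness is the delicate part: orthogonality and simplicity need only weights and
  adjoints, but they do not show that the spans fill the exterior power, and neither a dimension
  count nor complete reducibility is used for this. The operator \<open>T\<close> is, up to diagonal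
  terms, half the sum of the quadratic Casimir operators of the two factors. Its row half and its
  column half are in general not diagonal on wedges of basis vectors; but exchanging the rows of two
  boxes and exchanging their columns differ by a transposition, so antisymmetry cancels the
  off-diagonal terms of one half against those of the other. The passages between group and Lie
  algebra stay algebraic, without exponentials or limits. The orthogonal group is entered through a
  rational parametrisation of plane rotations, and derivatives become coefficients of polynomials
  with values in a subspace. Rotations alone already yield the antisymmetric matrices; the rest of
  the orbit is covered because the module they generate is stable under all matrices.\<close>

type_synonym 'a kernel = "nat \<times> nat \<Rightarrow> nat \<times> nat \<Rightarrow> 'a"

definition id_kernel :: "'a::field kernel" where
  "id_kernel p q = of_bool (p = q)"

lemma subspaceI:
  assumes "0 \<in> U" "\<And>v w. v \<in> U \<Longrightarrow> w \<in> U \<Longrightarrow> v + w \<in> U"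
    "\<And>c w. w \<in> U \<Longrightarrow> scaleT c w \<in> U"
  shows "tens.subspace U"
  using assms by (simp add: tens.subspace_def)

lemma sum_fun_apply: "(\<Sum>x\<in>A. f x) i = (\<Sum>x\<in>A. f x i)"
  for f :: "'b \<Rightarrow> 'i \<Rightarrow> 'a::comm_monoid_add"
  by (induction A rule: infinite_finite_induct) auto

lemma scaleT_apply [simp]: "scaleT c w i = c * w i"
  by (simp add: scaleT_def)

lemma finite_tuples: "finite (tuples k m d)"
proof -
  have "tuples k m d = {I. set I \<subseteq> {..<k} \<times> {..<m} \<and> length I = d}"
    by (auto simp: tuples_def)
  then show ?thesis by (simp add: finite_lists_length_eq)
qed

lemma tuples_nth: "I \<in> tuples k m d \<Longrightarrow> t < d \<Longrightarrow> I ! t \<in> {..<k} \<times> {..<m}"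
  using nth_mem[of t I] by (auto simp: tuples_def simp del: nth_mem)

lemma tuples_length: "I \<in> tuples k m d \<Longrightarrow> length I = d"
  by (simp add: tuples_def)

lemma tuples_update:
  "I \<in> tuples k m d \<Longrightarrow> b \<in> {..<k} \<times> {..<m} \<Longrightarrow> I[t := b] \<in> tuples k m d"
  using set_update_subset_insert[of I t b] by (auto simp: tuples_def)

locale tensor_power =
  fixes k m d :: nat
begin

abbreviation idx :: "(nat \<times> nat) set" where
  "idx \<equiv> {..<k} \<times> {..<m}"

definition tensors :: "'a::field tensor set" where
  "tensors = {w. \<forall>I. I \<notin> tuples k m d \<longrightarrow> w I = 0}"

text \<open>A separate operator is allowed at every tensor position. Thus both g^{\<otimes>d} and
  the one-position summands of a derivation are instances, and products are formed position by
  position.\<close>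

definition site_action :: "(nat \<Rightarrow> 'a::field kernel) \<Rightarrow> 'a tensor \<Rightarrow> 'a tensor" where
  "site_action K w = (\<lambda>I. if I \<in> tuples k m d then
     (\<Sum>J \<in> tuples k m d. (\<Prod>t<d. K t (I ! t) (J ! t)) * w J) else 0)"

text \<open>This is the sum of the operators 1 \<otimes> ... \<otimes> X \<otimes> ... \<otimes> 1,
  written through lists that differ from \<open>I\<close> in one entry because the support arguments
  on wedges are about such replacements. \<open>derivation_eq_sum\<close> recovers the operator
  form.\<close>

definition derivation :: "'a::field kernel \<Rightarrow> 'a tensor \<Rightarrow> 'a tensor" where
  "derivation X w = (\<lambda>I. if I \<in> tuples k m d then
     (\<Sum>t<d. \<Sum>b\<in>idx. X (I ! t) b * w (I[t := b])) else 0)"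

definition kernel_mult :: "'a::field kernel \<Rightarrow> 'a kernel \<Rightarrow> 'a kernel" where
  "kernel_mult X Y p q = (\<Sum>r\<in>idx. X p r * Y r q)"

lemma tensor_action_eq_site_action:
  "tensor_action k m d g h =
     site_action (\<lambda>_ p q. g $$ (fst p, fst q) * h $$ (snd p, snd q))"
  by (rule ext) (simp add: tensor_action_def site_action_def)

lemma tensors_eqI:
  assumes "v \<in> tensors" "w \<in> tensors" "\<And>I. I \<in> tuples k m d \<Longrightarrow> v I = w I"
  shows "v = w"
proof
  fix I show "v I = w I"
    using assms by (cases "I \<in> tuples k m d") (auto simp: tensors_def)
qed

lemma site_action_in_tensors [simp]: "site_action K w \<in> tensors"
  by (simp add: tensors_def site_action_def)

lemma derivation_in_tensors [simp]: "derivation X w \<in> tensors"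
  by (simp add: tensors_def derivation_def)

lemma subspace_tensors: "tens.subspace tensors"
  by (rule subspaceI) (auto simp: tensors_def)

lemma site_action_cong:
  assumes "\<And>t p q. t < d \<Longrightarrow> p \<in> idx \<Longrightarrow> q \<in> idx \<Longrightarrow> K t p q = K' t p q"
  shows "site_action K w = site_action K' w"
  unfolding site_action_def
  by (intro ext if_cong refl sum.cong arg_cong2[where f = "(*)"] prod.cong assms)
     (auto dest: tuples_nth)

lemma derivation_cong:
  assumes "\<And>p q. p \<in> idx \<Longrightarrow> q \<in> idx \<Longrightarrow> X p q = Y p q"
  shows "derivation X w = derivation Y w"
  unfolding derivation_def
  by (intro ext if_cong refl sum.cong arg_cong2[where f = "(*)"] assms)
     (auto dest: tuples_nth)

lemma site_action_add: "site_action K (v + w) = site_action K v + site_action K w"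
  by (rule ext) (simp add: site_action_def distrib_left sum.distrib)

lemma site_action_scale: "site_action K (scaleT c w) = scaleT c (site_action K w)"
  by (rule ext) (simp add: site_action_def sum_distrib_left ac_simps)

lemma site_action_zero [simp]: "site_action K 0 = 0"
  by (rule ext) (simp add: site_action_def)

lemma site_action_sum: "site_action K (\<Sum>x\<in>A. f x) = (\<Sum>x\<in>A. site_action K (f x))"
proof (induction A rule: infinite_finite_induct)
  case (insert x F)
  then show ?case by (simp only: sum.insert site_action_add not_False_eq_True)
qed (simp_all only: sum.infinite sum.empty site_action_zero not_False_eq_True)

lemma derivation_add: "derivation X (v + w) = derivation X v + derivation X w"
  by (rule ext) (simp add: derivation_def distrib_left sum.distrib)

lemma derivation_scale: "derivation X (scaleT c w) = scaleT c (derivation X w)"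
  by (rule ext) (simp add: derivation_def sum_distrib_left ac_simps)

lemma derivation_zero [simp]: "derivation X 0 = 0"
  by (rule ext) (simp add: derivation_def)

lemma derivation_sum: "derivation X (\<Sum>x\<in>A. f x) = (\<Sum>x\<in>A. derivation X (f x))"
proof (induction A rule: infinite_finite_induct)
  case (insert x F)
  then show ?case by (simp only: sum.insert derivation_add not_False_eq_True)
qed (simp_all only: sum.infinite sum.empty derivation_zero not_False_eq_True)

lemma derivation_kernel_add:
  "derivation (\<lambda>p q. X p q + Y p q) w = derivation X w + derivation Y w"
  by (rule ext) (simp add: derivation_def distrib_right sum.distrib)

lemma derivation_kernel_scale:
  "derivation (\<lambda>p q. c * X p q) w = scaleT c (derivation X w)"
  by (rule ext) (simp add: derivation_def sum_distrib_left ac_simps)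

lemma derivation_kernel_sum:
  "derivation (\<lambda>p q. \<Sum>x\<in>F. X x p q) w = (\<Sum>x\<in>F. derivation (X x) w)"
proof (induction F rule: infinite_finite_induct)
  case (insert x F)
  then show ?case
    by (simp add: derivation_kernel_add)
qed (auto simp: derivation_def fun_eq_iff)

lemma site_action_comp:
  "site_action K (site_action K' w) = site_action (\<lambda>t. kernel_mult (K t) (K' t)) w"
proof
  fix I
  show "site_action K (site_action K' w) I = site_action (\<lambda>t. kernel_mult (K t) (K' t)) w I"
  proof (cases "I \<in> tuples k m d")
    case True
    have tup: "tuples k m d = {J. length J = d \<and> set J \<subseteq> idx}"
      by (simp add: tuples_def)
    have "site_action K (site_action K' w) I
       = (\<Sum>J\<in>tuples k m d. \<Sum>L\<in>tuples k m d.
            (\<Prod>t<d. K t (I ! t) (J ! t) * K' t (J ! t) (L ! t)) * w L)"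
      using True by (simp add: site_action_def sum_distrib_left prod.distrib ac_simps)
    also have "\<dots> = (\<Sum>L\<in>tuples k m d.
        (\<Sum>J\<in>tuples k m d. \<Prod>t<d. K t (I ! t) (J ! t) * K' t (J ! t) (L ! t)) * w L)"
      by (subst sum.swap) (simp add: sum_distrib_right)
    also have "\<dots> = (\<Sum>L\<in>tuples k m d.
        (\<Prod>t<d. \<Sum>b\<in>idx. K t (I ! t) b * K' t b (L ! t)) * w L)"
      unfolding tup by (subst sum_lists_prod) auto
    finally show ?thesis
      using True by (simp add: site_action_def kernel_mult_def)
  qed (simp add: site_action_def)
qed

lemma tuples_decompose:
  assumes I: "I \<in> tuples k m d" and t: "t < d" and J: "J \<in> tuples k m d"
    and same: "\<And>s. s < d \<Longrightarrow> s \<noteq> t \<Longrightarrow> J ! s = I ! s"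
  shows "J = I[t := J ! t]"
  using assms by (intro nth_equalityI) (auto simp: tuples_length nth_list_update)

lemma site_action_single:
  assumes I: "I \<in> tuples k m d" and t: "t < d"
  shows "site_action ((\<lambda>_. id_kernel)(t := X)) w I = (\<Sum>b\<in>idx. X (I ! t) b * w (I[t := b]))"
proof -
  let ?K = "(\<lambda>_. id_kernel)(t := X)"
  have inj: "inj_on (\<lambda>b. I[t := b]) idx"
    by (rule inj_onI) (metis I t nth_list_update_eq tuples_length)
  have "(\<Sum>J \<in> tuples k m d. (\<Prod>s<d. ?K s (I ! s) (J ! s)) * w J)
      = (\<Sum>J \<in> (\<lambda>b. I[t := b]) ` idx. (\<Prod>s<d. ?K s (I ! s) (J ! s)) * w J)"
  proof (rule sum.mono_neutral_right)
    show "\<forall>J\<in>tuples k m d - (\<lambda>b. I[t := b]) ` idx. (\<Prod>s<d. ?K s (I ! s) (J ! s)) * w J = 0"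
    proof
      fix J assume J: "J \<in> tuples k m d - (\<lambda>b. I[t := b]) ` idx"
      have "\<exists>s<d. s \<noteq> t \<and> J ! s \<noteq> I ! s"
      proof (rule ccontr)
        assume "\<not> ?thesis"
        then have "J = I[t := J ! t]" using tuples_decompose[OF I t, of J] J by blast
        moreover have "J ! t \<in> idx" using J t tuples_nth by blast
        ultimately have "J \<in> (\<lambda>b. I[t := b]) ` idx" by (rule image_eqI)
        then show False using J by blast
      qed
      then obtain s where "s < d" "s \<noteq> t" "J ! s \<noteq> I ! s" by blast
      then have "\<exists>s\<in>{..<d}. ?K s (I ! s) (J ! s) = 0"
        by (intro bexI[of _ s]) (auto simp: id_kernel_def)
      then have "(\<Prod>s<d. ?K s (I ! s) (J ! s)) = 0"
        by (intro prod_zero) auto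
      then show "(\<Prod>s<d. ?K s (I ! s) (J ! s)) * w J = 0" by simp
    qed
  qed (use finite_tuples I tuples_update in auto)
  also have "\<dots> = (\<Sum>b\<in>idx. (\<Prod>s<d. ?K s (I ! s) (I[t := b] ! s)) * w (I[t := b]))"
    by (simp add: sum.reindex[OF inj])
  also have "\<dots> = (\<Sum>b\<in>idx. X (I ! t) b * w (I[t := b]))"
  proof (intro sum.cong refl arg_cong2[where f = "(*)"])
    fix b
    have "(\<Prod>s<d. ?K s (I ! s) (I[t := b] ! s)) = (\<Prod>s<d. if s = t then X (I ! t) b else 1)"
      using I t by (intro prod.cong) (auto simp: tuples_length id_kernel_def)
    then show "(\<Prod>s<d. ?K s (I ! s) (I[t := b] ! s)) = X (I ! t) b"
      using t by (simp add: prod.delta)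
  qed
  finally show ?thesis using I by (simp add: site_action_def)
qed

lemma derivation_eq_sum:
  "derivation X w = (\<Sum>t<d. site_action ((\<lambda>_. id_kernel)(t := X)) w)"
proof
  fix I show "derivation X w I = (\<Sum>t<d. site_action ((\<lambda>_. id_kernel)(t := X)) w) I"
    unfolding sum_fun_apply
    by (cases "I \<in> tuples k m d")
       (auto simp: derivation_def site_action_single, simp add: site_action_def)
qed

lemma kernel_mult_id:
  "q \<in> idx \<Longrightarrow> kernel_mult X id_kernel p q = X p q"
  "p \<in> idx \<Longrightarrow> kernel_mult id_kernel X p q = X p q"
proof -
  assume "q \<in> idx"
  then have "(\<Sum>r\<in>idx. X p r * of_bool (r = q)) = (\<Sum>r\<in>{q}. X p r * of_bool (r = q))"
    by (intro sum.mono_neutral_right) auto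
  then show "kernel_mult X id_kernel p q = X p q"
    unfolding kernel_mult_def id_kernel_def by simp
next
  assume "p \<in> idx"
  then have "(\<Sum>r\<in>idx. of_bool (p = r) * X r q) = (\<Sum>r\<in>{p}. of_bool (p = r) * X r q)"
    by (intro sum.mono_neutral_right) auto
  then show "kernel_mult id_kernel X p q = X p q"
    unfolding kernel_mult_def id_kernel_def by simp
qed

lemma site_action_id: "w \<in> tensors \<Longrightarrow> site_action (\<lambda>_. id_kernel) w = w"
proof (rule tensors_eqI)
  fix I assume I: "I \<in> tuples k m d"
  have "(\<Sum>J\<in>tuples k m d. (\<Prod>t<d. id_kernel (I ! t) (J ! t)) * w J)
      = (\<Sum>J\<in>{I}. (\<Prod>t<d. id_kernel (I ! t) (J ! t)) * w J)"
  proof (rule sum.mono_neutral_right)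
    show "\<forall>J\<in>tuples k m d - {I}. (\<Prod>t<d. id_kernel (I ! t) (J ! t)) * w J = 0"
    proof
      fix J assume J: "J \<in> tuples k m d - {I}"
      then have "I \<noteq> J" "length I = d" "length J = d" using I by (auto simp: tuples_length)
      then obtain t where "t < d" "I ! t \<noteq> J ! t"
        by (metis nth_equalityI)
      then have "\<exists>t\<in>{..<d}. id_kernel (I ! t) (J ! t) = (0::'a)"
        by (intro bexI[of _ t]) (auto simp: id_kernel_def)
      then have "(\<Prod>t<d. id_kernel (I ! t) (J ! t)) = (0::'a)"
        by (intro prod_zero) auto
      then show "(\<Prod>t<d. id_kernel (I ! t) (J ! t)) * w J = 0" by simp
    qed
  qed (use I finite_tuples in auto)
  then show "site_action (\<lambda>_. id_kernel) w I = w I"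
    using I by (simp add: site_action_def id_kernel_def)
qed auto

lemma site_action_single_comp:
  "site_action ((\<lambda>_. id_kernel)(t := X)) (site_action K w)
     = site_action (K(t := kernel_mult X (K t))) w"
  unfolding site_action_comp
  by (rule site_action_cong) (auto simp: kernel_mult_id)

text \<open>Operators at different positions commute, so only the diagonal of the double sum over
  positions survives; there the two kernels are multiplied at one position. Hence
  \<open>derivation\<close> respects Lie brackets.\<close>

lemma derivation_commutator:
  "derivation X (derivation Y w) - derivation Y (derivation X w)
     = derivation (\<lambda>p q. kernel_mult X Y p q - kernel_mult Y X p q) w"
proof -
  define E where "E = (\<lambda>t X. (\<lambda>_::nat. id_kernel :: 'a kernel)(t := X))"
  have DD: "derivation X (derivation Y w) = (\<Sum>s<d. \<Sum>t<d. site_action (E s X) (site_action (E t Y) w))"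
    for X Y
    unfolding derivation_eq_sum E_def by (simp add: site_action_sum)
  have split: "(\<Sum>s<d. \<Sum>t<d. f s t) = (\<Sum>s<d. \<Sum>t<d. if s = t then 0 else f s t) + (\<Sum>t<d. f t t)"
    for f :: "nat \<Rightarrow> nat \<Rightarrow> 'a tensor"
  proof -
    have "(\<Sum>t<d. f s t) = (\<Sum>t<d. if s = t then 0 else f s t) + f s s" if "s < d" for s
    proof -
      have "(\<Sum>t<d. f s t) = (\<Sum>t<d. (if s = t then 0 else f s t) + (if s = t then f s s else 0))"
        by (intro sum.cong) auto
      then show ?thesis using that by (simp add: sum.distrib sum.delta')
    qed
    then show ?thesis by (simp add: sum.distrib)
  qed
  have comm: "site_action (E s X) (site_action (E t Y) w) = site_action (E t Y) (site_action (E s X) w)"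
    if "s \<noteq> t" for s t
    unfolding E_def site_action_comp using that
    by (intro site_action_cong) (auto simp: kernel_mult_id)
  have off: "(\<Sum>s<d. \<Sum>t<d. if s = t then 0 else site_action (E s X) (site_action (E t Y) w))
      = (\<Sum>s<d. \<Sum>t<d. if s = t then 0 else site_action (E s Y) (site_action (E t X) w))"
    by (subst sum.swap) (intro sum.cong refl, simp add: comm)
  have same: "(\<Sum>t<d. site_action (E t X) (site_action (E t Y) w)) = derivation (kernel_mult X Y) w" for X Y
    unfolding derivation_eq_sum E_def site_action_comp
    by (intro sum.cong refl site_action_cong) (auto simp: kernel_mult_id)
  have "derivation X (derivation Y w) - derivation Y (derivation X w)
      = derivation (kernel_mult X Y) w - derivation (kernel_mult Y X) w"
    unfolding DD split[of "\<lambda>s t. site_action (E s X) (site_action (E t Y) w)"]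
      split[of "\<lambda>s t. site_action (E s Y) (site_action (E t X) w)"] off same by simp
  also have "\<dots> = derivation (\<lambda>p q. kernel_mult X Y p q - kernel_mult Y X p q) w"
    by (rule ext) (simp add: derivation_def left_diff_distrib sum_subtractf)
  finally show ?thesis .
qed

end

subsection \<open>From the Lie algebra to the group\<close>

text \<open>The submodule generated by \<open>v\<close>. The induction rule peels off the operator
  applied last, which is the case where commutators enter.\<close>

inductive_set cyclic_span :: "(('i \<Rightarrow> 'a::field) \<Rightarrow> ('i \<Rightarrow> 'a)) set \<Rightarrow> ('i \<Rightarrow> 'a) \<Rightarrow> ('i \<Rightarrow> 'a) set"
  for Ops v where
  cyclic_base: "v \<in> cyclic_span Ops v"
| cyclic_zero: "0 \<in> cyclic_span Ops v"
| cyclic_add: "x \<in> cyclic_span Ops v \<Longrightarrow> y \<in> cyclic_span Ops v \<Longrightarrow> x + y \<in> cyclic_span Ops v"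
| cyclic_scale: "x \<in> cyclic_span Ops v \<Longrightarrow> scaleT c x \<in> cyclic_span Ops v"
| cyclic_step: "T \<in> Ops \<Longrightarrow> x \<in> cyclic_span Ops v \<Longrightarrow> T x \<in> cyclic_span Ops v"

lemma subspace_cyclic_span: "tens.subspace (cyclic_span Ops v)"
  by (rule subspaceI) (auto intro: cyclic_span.intros)

lemma cyclic_subset:
  assumes U: "tens.subspace U" and v: "v \<in> U" and T: "\<And>T x. T \<in> Ops \<Longrightarrow> x \<in> U \<Longrightarrow> T x \<in> U"
  shows "cyclic_span Ops v \<subseteq> U"
proof
  fix x assume "x \<in> cyclic_span Ops v"
  then show "x \<in> U"
    by induction (simp_all only: v T tens.subspace_0[OF U] tens.subspace_add[OF U] tens.subspace_scale[OF U])
qed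

definition row_kernel :: "(nat \<Rightarrow> nat \<Rightarrow> 'a::field) \<Rightarrow> 'a kernel" where
  "row_kernel g p q = (if snd p = snd q then g (fst p) (fst q) else 0)"

definition col_kernel :: "(nat \<Rightarrow> nat \<Rightarrow> 'a::field) \<Rightarrow> 'a kernel" where
  "col_kernel h p q = (if fst p = fst q then h (snd p) (snd q) else 0)"

text \<open>The element \<open>(g, h)\<close> of gl(k) \<oplus> gl(m), acting on one tensor position
  as g \<otimes> 1 + 1 \<otimes> h. Entries are plain functions, so that no dimension conditions
  arise.\<close>

definition gl_kernel :: "(nat \<Rightarrow> nat \<Rightarrow> 'a::field) \<Rightarrow> (nat \<Rightarrow> nat \<Rightarrow> 'a) \<Rightarrow> 'a kernel" where
  "gl_kernel g h p q = row_kernel g p q + col_kernel h p q"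

definition array_mult ::
    "nat \<Rightarrow> (nat \<Rightarrow> nat \<Rightarrow> 'a::field) \<Rightarrow> (nat \<Rightarrow> nat \<Rightarrow> 'a) \<Rightarrow> nat \<Rightarrow> nat \<Rightarrow> 'a" where
  "array_mult n g g' a b = (\<Sum>c<n. g a c * g' c b)"

context tensor_power
begin

primrec kernel_power :: "'a::field kernel \<Rightarrow> nat \<Rightarrow> 'a kernel" where
  "kernel_power X 0 = id_kernel"
| "kernel_power X (Suc r) = kernel_mult (kernel_power X r) X"

lemma derivation_site_action:
  "derivation Y (site_action K w) = (\<Sum>t<d. site_action (K(t := kernel_mult Y (K t))) w)"
  unfolding derivation_eq_sum site_action_single_comp ..

text \<open>Write X_t for \<open>X\<close> at position t. The X_t commute, the derivation of the
  r-th power of \<open>X\<close> is the power sum of the X_t^r, and \<open>X\<close> acting at all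
  positions is the elementary symmetric polynomial e_d. In characteristic 0, Newton's recursion
  expresses e_d through the power sums.\<close>

lemma site_action_closed:
  fixes X :: "'a::field_char_0 kernel"
  assumes U: "tens.subspace U" "U \<subseteq> tensors"
    and D: "\<And>r w. w \<in> U \<Longrightarrow> derivation (kernel_power X (Suc r)) w \<in> U"
    and w: "w \<in> U"
  shows "site_action (\<lambda>_. X) w \<in> U"
proof -
  define F where "F S = (\<lambda>s::nat. if s \<in> S then X else id_kernel)" for S
  define SS where "SS n = {S. S \<subseteq> {..<d} \<and> card S = n}" for n
  \<comment> \<open>\<open>E n\<close> is e_n applied to \<open>w\<close>. In \<open>G n r\<close>
    one position of an (n+1)-set carries the r-th power and the others carry \<open>X\<close>: these
    are the mixed terms of Newton's recursion.\<close>
  define E where "E n = (\<Sum>S\<in>SS n. site_action (F S) w)" for n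
  define G where "G n r = (\<Sum>S\<in>SS (Suc n). \<Sum>t\<in>S. site_action ((F S)(t := kernel_power X r)) w)" for n r
  have fin: "finite (SS n)" "S \<in> SS n \<Longrightarrow> finite S" for n S
    unfolding SS_def by (auto intro: finite_subset[of _ "Pow {..<d}"] finite_subset[of S "{..<d}"])
  have SS0: "SS 0 = {{}}"
    unfolding SS_def by (auto dest: finite_subset[of _ "{..<d}"])
  \<comment> \<open>The extra power falls either on a position of \<open>S\<close>, raising its
    exponent to r + 1, or on a free position, which enlarges \<open>S\<close>.\<close>
  have newton: "derivation (kernel_power X r) (E n)
      = (\<Sum>S\<in>SS n. \<Sum>t\<in>S. site_action ((F S)(t := kernel_power X (Suc r))) w) + G n r" for n r
  proof -
    have 1: "derivation (kernel_power X r) (site_action (F S) w)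
       = (\<Sum>t\<in>S. site_action ((F S)(t := kernel_power X (Suc r))) w)
         + (\<Sum>t\<in>{..<d} - S. site_action ((F S)(t := kernel_power X r)) w)"
      if S: "S \<in> SS n" for S
    proof -
      have sub: "S \<subseteq> {..<d}" using S by (simp add: SS_def)
      have "derivation (kernel_power X r) (site_action (F S) w)
        = (\<Sum>t\<in>S. site_action ((F S)(t := kernel_mult (kernel_power X r) (F S t))) w)
         + (\<Sum>t\<in>{..<d} - S. site_action ((F S)(t := kernel_mult (kernel_power X r) (F S t))) w)"
        unfolding derivation_site_action by (subst sum.subset_diff[OF sub]) (auto simp: add.commute)
      also have "(\<Sum>t\<in>S. site_action ((F S)(t := kernel_mult (kernel_power X r) (F S t))) w)
         = (\<Sum>t\<in>S. site_action ((F S)(t := kernel_power X (Suc r))) w)"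
        by (intro sum.cong refl) (simp add: F_def)
      also have "(\<Sum>t\<in>{..<d} - S. site_action ((F S)(t := kernel_mult (kernel_power X r) (F S t))) w)
         = (\<Sum>t\<in>{..<d} - S. site_action ((F S)(t := kernel_power X r)) w)"
        by (intro sum.cong refl site_action_cong) (auto simp: F_def kernel_mult_id)
      finally show ?thesis .
    qed
    have 2: "(\<Sum>S\<in>SS n. \<Sum>t\<in>{..<d} - S. site_action ((F S)(t := kernel_power X r)) w) = G n r"
    proof -
      have upd: "(F (insert t S))(t := Y) = (F S)(t := Y)" for t S Y
        by (auto simp: F_def)
      have A: "(SIGMA S:SS n. {..<d} - S) = {(S, t). S \<in> SS n \<and> t < d \<and> t \<notin> S}" by auto
      have B: "(SIGMA S:SS (Suc n). S) = {(S, t). S \<in> SS (Suc n) \<and> t \<in> S}" by auto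
      have "(\<Sum>S\<in>SS n. \<Sum>t\<in>{..<d} - S. site_action ((F S)(t := kernel_power X r)) w)
         = (\<Sum>(S, t) \<in> (SIGMA S:SS n. {..<d} - S). site_action ((F S)(t := kernel_power X r)) w)"
        by (rule sum.Sigma) (auto simp: fin)
      also have "\<dots> = (\<Sum>(S, t) \<in> (SIGMA S:SS (Suc n). S). site_action ((F S)(t := kernel_power X r)) w)"
        unfolding A B
      proof (rule sum.reindex_bij_witness
          [where i = "\<lambda>(S, t). (S - {t}, t)" and j = "\<lambda>(S, t). (insert t S, t)"])
        fix x assume "x \<in> {(S, t). S \<in> SS n \<and> t < d \<and> t \<notin> S}"
        then obtain S t where x: "x = (S, t)" "S \<subseteq> {..<d}" "card S = n" "t < d" "t \<notin> S"
          by (auto simp: SS_def)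
        moreover have "finite S" using x(2) finite_subset by blast
        ultimately show "(case case x of (S, t) \<Rightarrow> (insert t S, t) of (S, t) \<Rightarrow> (S - {t}, t)) = x"
          "(case x of (S, t) \<Rightarrow> (insert t S, t)) \<in> {(S, t). S \<in> SS (Suc n) \<and> t \<in> S}"
          "(case case x of (S, t) \<Rightarrow> (insert t S, t) of (S, t) \<Rightarrow> site_action ((F S)(t := kernel_power X r)) w)
             = (case x of (S, t) \<Rightarrow> site_action ((F S)(t := kernel_power X r)) w)"
          by (simp_all add: upd SS_def)
      next
        fix x assume "x \<in> {(S, t). S \<in> SS (Suc n) \<and> t \<in> S}"
        then obtain S t where x: "x = (S, t)" "S \<subseteq> {..<d}" "card S = Suc n" "t \<in> S"
          by (auto simp: SS_def)
        moreover have "finite S" using x(2) finite_subset by blast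
        ultimately show "(case case x of (S, t) \<Rightarrow> (S - {t}, t) of (S, t) \<Rightarrow> (insert t S, t)) = x"
          "(case x of (S, t) \<Rightarrow> (S - {t}, t)) \<in> {(S, t). S \<in> SS n \<and> t < d \<and> t \<notin> S}"
          by (auto simp: SS_def)
      qed
      also have "\<dots> = G n r"
        unfolding G_def by (rule sum.Sigma[symmetric]) (auto simp: fin)
      finally show ?thesis .
    qed
    have "derivation (kernel_power X r) (E n)
       = (\<Sum>S\<in>SS n. derivation (kernel_power X r) (site_action (F S) w))"
      unfolding E_def by (rule derivation_sum)
    also have "\<dots> = (\<Sum>S\<in>SS n. (\<Sum>t\<in>S. site_action ((F S)(t := kernel_power X (Suc r))) w)
         + (\<Sum>t\<in>{..<d} - S. site_action ((F S)(t := kernel_power X r)) w))"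
      by (intro sum.cong refl 1)
    finally show ?thesis by (simp only: sum.distrib 2)
  qed
  have G1: "G n (Suc 0) = scaleT (of_nat (Suc n)) (E (Suc n))" for n
  proof -
    have "(\<Sum>t\<in>S. site_action ((F S)(t := kernel_power X (Suc 0))) w)
       = scaleT (of_nat (Suc n)) (site_action (F S) w)" if S: "S \<in> SS (Suc n)" for S
    proof -
      have "(\<Sum>t\<in>S. site_action ((F S)(t := kernel_power X (Suc 0))) w) = (\<Sum>t\<in>S. site_action (F S) w)"
        by (intro sum.cong refl site_action_cong) (auto simp: F_def kernel_mult_id)
      also have "\<dots> = scaleT (of_nat (card S)) (site_action (F S) w)"
        by (rule ext) (simp add: sum_fun_apply)
      finally show ?thesis using S by (simp add: SS_def)
    qed
    then have "G n (Suc 0) = (\<Sum>S\<in>SS (Suc n). scaleT (of_nat (Suc n)) (site_action (F S) w))"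
      unfolding G_def by (intro sum.cong refl)
    then show ?thesis by (simp only: E_def tens.scale_sum_right)
  qed
  \<comment> \<open>All exponents are treated at once, because the case (n + 1, r) of
    \<open>G\<close> draws on the case (n, r + 1). Dividing \<open>G n 1\<close> by n + 1 gives
    \<open>E (n + 1)\<close>.\<close>
  have "E n \<in> U \<and> (\<forall>r. G n (Suc r) \<in> U)" for n
  proof (induction n)
    case 0
    have E0: "E 0 = w"
      using w U by (auto simp: E_def SS0 F_def site_action_id)
    have "G 0 (Suc r) = derivation (kernel_power X (Suc r)) w" for r
      using newton[of "Suc r" 0] by (simp add: E0 SS0 del: kernel_power.simps)
    then show ?case using D w E0 by metis
  next
    case (Suc n)
    have "scaleT (inverse (of_nat (Suc n))) (G n (Suc 0)) = E (Suc n)"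
      unfolding G1 tens.scale_scale by (simp del: of_nat_Suc)
    then have E: "E (Suc n) \<in> U"
      using Suc U by (metis tens.subspace_scale)
    have "G (Suc n) (Suc r) = derivation (kernel_power X (Suc r)) (E (Suc n)) - G n (Suc (Suc r))" for r
      unfolding newton G_def[of n] by (simp only: add_diff_cancel_left')
    then show ?case
      using E Suc D U by (metis tens.subspace_diff)
  qed
  moreover have "E d = site_action (\<lambda>_. X) w"
  proof -
    have "SS d = {{..<d}}"
      unfolding SS_def using card_subset_eq[of "{..<d}"] by auto
    then show ?thesis
      unfolding E_def by (auto simp: F_def intro: site_action_cong)
  qed
  ultimately show ?thesis by metis
qed

section \<open>Products and commutators of row and column operators\<close>

lemma sum_idx: "(\<Sum>r\<in>idx. f r) = (\<Sum>a<k. \<Sum>j<m. f (a, j))"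
  by (simp add: sum.cartesian_product case_prod_unfold)

lemma kernel_mult_row_row:
  assumes "p \<in> idx" "q \<in> idx"
  shows "kernel_mult (row_kernel g) (row_kernel g') p q = row_kernel (array_mult k g g') p q"
proof -
  have "kernel_mult (row_kernel g) (row_kernel g') p q
     = (\<Sum>a<k. \<Sum>j<m. if j = snd p then (if snd p = snd q then g (fst p) a * g' a (fst q) else 0) else 0)"
    unfolding kernel_mult_def sum_idx by (intro sum.cong refl) (auto simp: row_kernel_def)
  then show ?thesis
    using assms by (auto simp: row_kernel_def array_mult_def)
qed

lemma kernel_mult_col_col:
  assumes "p \<in> idx" "q \<in> idx"
  shows "kernel_mult (col_kernel h) (col_kernel h') p q = col_kernel (array_mult m h h') p q"
proof -
  have "kernel_mult (col_kernel h) (col_kernel h') p q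
     = (\<Sum>j<m. \<Sum>a<k. if a = fst p then (if fst p = fst q then h (snd p) j * h' j (snd q) else 0) else 0)"
    unfolding kernel_mult_def sum_idx
    by (subst sum.swap) (intro sum.cong refl, auto simp: col_kernel_def)
  then show ?thesis
    using assms by (auto simp: col_kernel_def array_mult_def)
qed

lemma kernel_mult_row_col:
  assumes "p \<in> idx" "q \<in> idx"
  shows "kernel_mult (row_kernel g) (col_kernel h) p q = g (fst p) (fst q) * h (snd p) (snd q)"
proof -
  have "kernel_mult (row_kernel g) (col_kernel h) p q
     = (\<Sum>a<k. \<Sum>j<m. if j = snd p then (if a = fst q then g (fst p) a * h (snd p) (snd q) else 0) else 0)"
    unfolding kernel_mult_def sum_idx by (intro sum.cong refl) (auto simp: row_kernel_def col_kernel_def)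
  then show ?thesis using assms by auto
qed

lemma kernel_mult_col_row:
  assumes "p \<in> idx" "q \<in> idx"
  shows "kernel_mult (col_kernel h) (row_kernel g) p q = g (fst p) (fst q) * h (snd p) (snd q)"
proof -
  have "kernel_mult (col_kernel h) (row_kernel g) p q
     = (\<Sum>a<k. \<Sum>j<m. if j = snd q then (if a = fst p then g a (fst q) * h (snd p) (snd q) else 0) else 0)"
    unfolding kernel_mult_def sum_idx by (intro sum.cong refl) (auto simp: row_kernel_def col_kernel_def)
  then show ?thesis using assms by auto
qed

text \<open>g \<otimes> 1 commutes with 1 \<otimes> h, so the mixed terms are symmetric in the two
  pairs and drop out of the commutator.\<close>

lemma gl_kernel_commutator:
  assumes "p \<in> idx" "q \<in> idx"
  shows "kernel_mult (gl_kernel g h) (gl_kernel g' h') p q - kernel_mult (gl_kernel g' h') (gl_kernel g h) p q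
    = gl_kernel (\<lambda>a b. array_mult k g g' a b - array_mult k g' g a b)
        (\<lambda>a b. array_mult m h h' a b - array_mult m h' h a b) p q"
proof -
  have expand: "kernel_mult (gl_kernel g h) (gl_kernel g' h') p q
     = row_kernel (array_mult k g g') p q + col_kernel (array_mult m h h') p q
       + (g (fst p) (fst q) * h' (snd p) (snd q) + g' (fst p) (fst q) * h (snd p) (snd q))"
    for g h g' h'
  proof -
    have "kernel_mult (gl_kernel g h) (gl_kernel g' h') p q
      = kernel_mult (row_kernel g) (row_kernel g') p q + kernel_mult (col_kernel h) (col_kernel h') p q
        + (kernel_mult (row_kernel g) (col_kernel h') p q + kernel_mult (col_kernel h) (row_kernel g') p q)"
      by (simp add: kernel_mult_def gl_kernel_def algebra_simps sum.distrib)
    then show ?thesis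
      using assms by (simp add: kernel_mult_row_row kernel_mult_col_col kernel_mult_row_col kernel_mult_col_row)
  qed
  show ?thesis
    unfolding expand by (simp add: gl_kernel_def row_kernel_def col_kernel_def)
qed

lemma derivation_gl_commute:
  "derivation (gl_kernel g h) (derivation (gl_kernel g' h') w)
    = derivation (gl_kernel g' h') (derivation (gl_kernel g h) w)
      + derivation (gl_kernel (\<lambda>a b. array_mult k g g' a b - array_mult k g' g a b)
          (\<lambda>a b. array_mult m h h' a b - array_mult m h' h a b)) w"
proof -
  have "derivation (\<lambda>p q. kernel_mult (gl_kernel g h) (gl_kernel g' h') p q
          - kernel_mult (gl_kernel g' h') (gl_kernel g h) p q) w
      = derivation (gl_kernel (\<lambda>a b. array_mult k g g' a b - array_mult k g' g a b)
          (\<lambda>a b. array_mult m h h' a b - array_mult m h' h a b)) w"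
    by (rule derivation_cong) (rule gl_kernel_commutator)
  then show ?thesis
    using derivation_commutator[of "gl_kernel g h" "gl_kernel g' h'" w] by (simp add: algebra_simps)
qed

text \<open>
  A weak form of the Poincare-Birkhoff-Witt theorem: if the Lie algebra is \<open>L + B\<close> and \<open>B\<close> acts on \<open>v\<close> by
  scalars, then commuting the elements of \<open>B\<close> to the right shows that \<open>v\<close> generates
  the same submodule under \<open>L\<close> as under the whole Lie algebra.
\<close>

lemma cyclic_gl_closed:
  assumes decomp: "\<And>g h. \<exists>g1 h1 g2 h2. (g1, h1) \<in> L \<and> (g2, h2) \<in> B \<and>
      (\<forall>p\<in>idx. \<forall>q\<in>idx. gl_kernel g h p q = gl_kernel g1 h1 p q + gl_kernel g2 h2 p q)"
    and B: "\<And>g h. (g, h) \<in> B \<Longrightarrow> \<exists>c. derivation (gl_kernel g h) v = scaleT c v"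
    and w: "w \<in> cyclic_span {derivation (gl_kernel g h) | g h. (g, h) \<in> L} v"
  shows "derivation (gl_kernel g h) w \<in> cyclic_span {derivation (gl_kernel g h) | g h. (g, h) \<in> L} v"
proof -
  let ?N = "cyclic_span {derivation (gl_kernel g h) | g h. (g, h) \<in> L} v"
  have L: "derivation (gl_kernel g h) x \<in> ?N" if "(g, h) \<in> L" "x \<in> ?N" for g h x
    using that by (auto intro: cyclic_step)
  have all: "derivation (gl_kernel g h) x \<in> ?N"
    if "x \<in> ?N" and Bx: "\<And>g h. (g, h) \<in> B \<Longrightarrow> derivation (gl_kernel g h) x \<in> ?N" for x g h
  proof -
    obtain g1 h1 g2 h2 where *: "(g1, h1) \<in> L" "(g2, h2) \<in> B"
      "\<forall>p\<in>idx. \<forall>q\<in>idx. gl_kernel g h p q = gl_kernel g1 h1 p q + gl_kernel g2 h2 p q"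
      using decomp by meson
    have "derivation (gl_kernel g h) x = derivation (\<lambda>p q. gl_kernel g1 h1 p q + gl_kernel g2 h2 p q) x"
      by (rule derivation_cong) (use *(3) in blast)
    also have "\<dots> = derivation (gl_kernel g1 h1) x + derivation (gl_kernel g2 h2) x"
      by (rule derivation_kernel_add)
    finally show ?thesis
      using L[OF *(1) that(1)] Bx[OF *(2)] by (simp only: cyclic_add)
  qed
  have Bx: "derivation (gl_kernel g h) x \<in> ?N" if "x \<in> ?N" "(g, h) \<in> B" for x g h
    using that
  proof (induction arbitrary: g h)
    case cyclic_base
    then obtain c where "derivation (gl_kernel g h) v = scaleT c v" using B by blast
    then show ?case by (simp only: cyclic_span.intros)
  next
    case cyclic_zero
    then show ?case by (simp only: derivation_zero cyclic_span.cyclic_zero)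
  next
    case (cyclic_add x y)
    then show ?case by (simp only: derivation_add cyclic_span.cyclic_add)
  next
    case (cyclic_scale x c)
    then show ?case by (simp only: derivation_scale cyclic_span.cyclic_scale)
  next
    case (cyclic_step T x)
    then obtain g' h' where T: "T = derivation (gl_kernel g' h')" "(g', h') \<in> L" by blast
    \<comment> \<open>Moving the element of \<open>B\<close> past \<open>T\<close> leaves a
      commutator that may lie outside \<open>B\<close>. It is an arbitrary Lie algebra element
      acting on \<open>x\<close>; \<open>all\<close> splits it into its \<open>L\<close> and
      \<open>B\<close> parts, the latter covered by the induction hypothesis.\<close>
    show ?case
      unfolding T(1) derivation_gl_commute[of g h g' h']
    proof (rule cyclic_span.cyclic_add)
      show "derivation (gl_kernel g' h') (derivation (gl_kernel g h) x) \<in> ?N"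
        by (rule L[OF T(2) cyclic_step.IH[OF cyclic_step.prems]])
    qed (rule all[OF cyclic_step.hyps(2) cyclic_step.IH])
  qed
  show ?thesis by (rule all[OF w Bx[OF w]])
qed

lemma row_kernel_power:
  "\<exists>g'. \<forall>p\<in>idx. \<forall>q\<in>idx. kernel_power (row_kernel g) (Suc r) p q = row_kernel g' p q"
proof (induction r)
  case 0
  show ?case by (rule exI[of _ g]) (auto simp: kernel_mult_id)
next
  case (Suc r)
  then obtain g' where g': "\<forall>p\<in>idx. \<forall>q\<in>idx. kernel_power (row_kernel g) (Suc r) p q = row_kernel g' p q" ..
  have "kernel_power (row_kernel g) (Suc (Suc r)) p q = row_kernel (array_mult k g' g) p q"
    if "p \<in> idx" "q \<in> idx" for p q
  proof -
    have "kernel_power (row_kernel g) (Suc (Suc r)) p q = kernel_mult (row_kernel g') (row_kernel g) p q"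
      unfolding kernel_power.simps(2)[of _ "Suc r"] kernel_mult_def using g' that
      by (intro sum.cong refl) auto
    then show ?thesis using kernel_mult_row_row[OF that] by simp
  qed
  then show ?case by blast
qed

lemma col_kernel_power:
  "\<exists>h'. \<forall>p\<in>idx. \<forall>q\<in>idx. kernel_power (col_kernel h) (Suc r) p q = col_kernel h' p q"
proof (induction r)
  case 0
  show ?case by (rule exI[of _ h]) (auto simp: kernel_mult_id)
next
  case (Suc r)
  then obtain h' where h': "\<forall>p\<in>idx. \<forall>q\<in>idx. kernel_power (col_kernel h) (Suc r) p q = col_kernel h' p q" ..
  have "kernel_power (col_kernel h) (Suc (Suc r)) p q = col_kernel (array_mult m h' h) p q"
    if "p \<in> idx" "q \<in> idx" for p q
  proof -
    have "kernel_power (col_kernel h) (Suc (Suc r)) p q = kernel_mult (col_kernel h') (col_kernel h) p q"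
      unfolding kernel_power.simps(2)[of _ "Suc r"] kernel_mult_def using h' that
      by (intro sum.cong refl) auto
    then show ?thesis using kernel_mult_col_col[OF that] by simp
  qed
  then show ?case by blast
qed

lemma gl_kernel_row: "gl_kernel g (\<lambda>_ _. 0) = row_kernel g"
  by (simp add: fun_eq_iff gl_kernel_def col_kernel_def)

lemma gl_kernel_col: "gl_kernel (\<lambda>_ _. 0) h = col_kernel h"
  by (simp add: fun_eq_iff gl_kernel_def row_kernel_def)

text \<open>The kernel g \<otimes> h is factored into g \<otimes> 1 and 1 \<otimes> h: powers of
  each factor remain row or column operators and so act through the Lie algebra, which powers of g
  \<otimes> h in general do not.\<close>

lemma tensor_action_closed:
  fixes g h :: "'a::field_char_0 mat"
  assumes U: "tens.subspace U" "U \<subseteq> tensors"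
    and D: "\<And>g h w. w \<in> U \<Longrightarrow> derivation (gl_kernel g h) w \<in> U"
    and w: "w \<in> U"
  shows "tensor_action k m d g h w \<in> U"
proof -
  have row: "site_action (\<lambda>_. row_kernel g) w \<in> U" if "w \<in> U" for g w
  proof (rule site_action_closed[OF U _ that])
    fix r w assume "w \<in> U"
    obtain g' where "\<forall>p\<in>idx. \<forall>q\<in>idx. kernel_power (row_kernel g) (Suc r) p q = row_kernel g' p q"
      using row_kernel_power by blast
    then have "derivation (kernel_power (row_kernel g) (Suc r)) w = derivation (row_kernel g') w"
      by (intro derivation_cong) blast
    then show "derivation (kernel_power (row_kernel g) (Suc r)) w \<in> U"
      using D[OF \<open>w \<in> U\<close>, of g' "\<lambda>_ _. 0"] by (simp only: gl_kernel_row)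
  qed
  have col: "site_action (\<lambda>_. col_kernel h) w \<in> U" if "w \<in> U" for h w
  proof (rule site_action_closed[OF U _ that])
    fix r w assume "w \<in> U"
    obtain h' where "\<forall>p\<in>idx. \<forall>q\<in>idx. kernel_power (col_kernel h) (Suc r) p q = col_kernel h' p q"
      using col_kernel_power by blast
    then have "derivation (kernel_power (col_kernel h) (Suc r)) w = derivation (col_kernel h') w"
      by (intro derivation_cong) blast
    then show "derivation (kernel_power (col_kernel h) (Suc r)) w \<in> U"
      using D[OF \<open>w \<in> U\<close>, of "\<lambda>_ _. 0" h'] by (simp only: gl_kernel_col)
  qed
  have "tensor_action k m d g h w
      = site_action (\<lambda>_. row_kernel (\<lambda>a b. g $$ (a, b))) (site_action (\<lambda>_. col_kernel (\<lambda>a b. h $$ (a, b))) w)"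
    unfolding tensor_action_eq_site_action site_action_comp
    by (rule site_action_cong) (simp add: kernel_mult_row_col)
  then show ?thesis using row col w by simp
qed

end

subsection \<open>Exterior powers and Young vectors\<close>

lemma permute_list_update:
  assumes p: "p permutes {..<length I}" and t: "t < length I"
  shows "(permute_list p I)[t := b] = permute_list p (I[p t := b])"
proof (rule nth_equalityI)
  fix s assume "s < length ((permute_list p I)[t := b])"
  then have s: "s < length I" by simp
  have "p t < length I" "p s < length I"
    using permutes_in_image[OF p] s t by auto
  moreover have "p s = p t \<longleftrightarrow> s = t"
    using permutes_inj[OF p] by (auto dest: injD)
  ultimately show "(permute_list p I)[t := b] ! s = permute_list p (I[p t := b]) ! s"
    using s p by (auto simp: permute_list_nth nth_list_update)
qed simp

lemma sum_lessThan_permutes: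
  "p permutes {..<n} \<Longrightarrow> (\<Sum>t<n. f (p t)) = (\<Sum>t<n. f t)" for n :: nat
  using sum.permute[of p "{..<n}" f] by (simp add: comp_def)

lemma permute_list_in_tuples:
  "p permutes {..<d} \<Longrightarrow> I \<in> tuples k m d \<Longrightarrow> permute_list p I \<in> tuples k m d"
  by (auto simp: tuples_def)

lemma ext_powerD:
  assumes "w \<in> ext_power k m d" "I \<in> tuples k m d" "p permutes {..<d}"
  shows "w (permute_list p I) = of_int (sign p) * w I"
  using assms by (auto simp: ext_power_def)

lemma ext_power_outside: "w \<in> ext_power k m d \<Longrightarrow> I \<notin> tuples k m d \<Longrightarrow> w I = 0"
  by (auto simp: ext_power_def)

lemma subspace_ext_power: "tens.subspace (ext_power k m d :: 'a::field_char_0 tensor set)"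
  by (rule subspaceI) (simp_all add: ext_power_def algebra_simps)

lemma ext_power_swap:
  fixes w :: "'a::field_char_0 tensor"
  assumes w: "w \<in> ext_power k m d" and I: "I \<in> tuples k m d" and st: "s < d" "t < d" "s \<noteq> t"
  shows "w (I[s := I ! t, t := I ! s]) = - w I"
proof -
  let ?p = "transpose s t"
  have p: "?p permutes {..<d}"
    using st by (intro permutes_swap_id) auto
  have "permute_list ?p I = I[s := I ! t, t := I ! s]"
    using st p I
    by (intro nth_equalityI) (auto simp: tuples_length permute_list_nth nth_list_update transpose_def)
  then show ?thesis
    using ext_powerD[OF w I p] st by (simp add: sign_swap_id)
qed

lemma ext_power_not_distinct:
  fixes w :: "'a::field_char_0 tensor"
  assumes w: "w \<in> ext_power k m d" and I: "\<not> distinct I"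
  shows "w I = 0"
proof (cases "I \<in> tuples k m d")
  case True
  obtain s t where st: "s < d" "t < d" "s \<noteq> t" "I ! s = I ! t"
    using I True by (auto simp: distinct_conv_nth tuples_length)
  have "I[s := I ! t, t := I ! s] = I"
    by (metis st(4) list_update_id)
  then have "w I = - w I"
    using ext_power_swap[OF w True st(1-3)] by simp
  then show ?thesis by simp
qed (use w ext_power_outside in blast)

text \<open>Reordering the list multiplies every antisymmetric tensor by the same sign, so two of
  them are proportional along each orbit of the symmetric group. The cross-multiplied form avoids
  dividing by a coordinate that may vanish.\<close>

lemma ext_power_proportional:
  fixes v w :: "'a::field_char_0 tensor"
  assumes v: "v \<in> ext_power k m d" and w: "w \<in> ext_power k m d" and IJ: "mset I = mset J"
  shows "v I * w J = v J * w I"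
proof (cases "J \<in> tuples k m d")
  case True
  obtain p where p: "p permutes {..<length J}" "permute_list p J = I"
    using mset_eq_permutation[OF IJ] by blast
  then show ?thesis
    using ext_powerD[OF v True, of p] ext_powerD[OF w True, of p] True
    by (simp add: tuples_length)
next
  case False
  moreover have "length I = length J" "set I = set J"
    using IJ by (auto dest: mset_eq_length mset_eq_setD)
  ultimately have "I \<notin> tuples k m d" by (simp add: tuples_def)
  then show ?thesis
    using False v w by (simp add: ext_power_outside)
qed

lemma wedge_in_ext_power: "wedge k m xs \<in> ext_power k m (length xs)"
proof -
  have "wedge k m xs (permute_list p I) = of_int (sign p) * wedge k m xs I"
    if I: "I \<in> tuples k m (length xs)" and p: "p permutes {..<length xs}" for I p
  proof -
    let ?d = "length xs"
    let ?P = "{q. q permutes {..<?d}}"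
    have "wedge k m xs (permute_list p I)
       = (\<Sum>q\<in>?P. of_int (sign q) * (\<Prod>t<?d. (xs ! q t) (I ! p t)))"
      using I p permute_list_in_tuples[OF p I]
      by (simp add: wedge_def det_columns tuples_length permute_list_nth)
    also have "\<dots> = (\<Sum>q\<in>?P. of_int (sign (q \<circ> p)) * (\<Prod>t<?d. (xs ! (q \<circ> p) t) (I ! p t)))"
      by (rule sum.reindex_bij_witness[where i = "\<lambda>q. q \<circ> p" and j = "\<lambda>q. q \<circ> inv_into UNIV p"])
        (use p in \<open>auto simp: permutes_compose permutes_inv o_assoc[symmetric] permutes_inv_o\<close>)
    also have "\<dots> = (\<Sum>q\<in>?P. of_int (sign p) * (of_int (sign q) * (\<Prod>t<?d. (xs ! q t) (I ! t))))"
    proof (intro sum.cong refl)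
      fix q assume q: "q \<in> ?P"
      have "(\<Prod>t<?d. (xs ! (q \<circ> p) t) (I ! p t)) = (\<Prod>t<?d. (xs ! q t) (I ! t))"
        using prod.permute[OF p, of "\<lambda>t. (xs ! q t) (I ! t)"] by (simp add: comp_def)
      moreover have "sign (q \<circ> p) = sign q * sign p"
        using q p by (intro sign_compose) (auto simp: permutation_permutes)
      ultimately show "of_int (sign (q \<circ> p)) * (\<Prod>t<?d. (xs ! (q \<circ> p) t) (I ! p t))
          = of_int (sign p) * (of_int (sign q) * (\<Prod>t<?d. (xs ! q t) (I ! t)))"
        by simp
    qed
    finally show ?thesis
      using I by (simp add: wedge_def det_columns sum_distrib_left)
  qed
  then show ?thesis by (auto simp: ext_power_def wedge_def)
qed

lemma set_boxes: "set (boxes la) = {(i, j). i < length la \<and> j < la ! i}"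
  by (auto simp: boxes_def)

lemma distinct_boxes: "distinct (boxes la)"
proof -
  have "distinct (concat (map (\<lambda>i. map (\<lambda>j. (i, j)) [0..<la ! i]) xs))" if "distinct xs" for xs
    using that by (induction xs) (auto simp: distinct_map inj_on_def)
  then show ?thesis by (simp add: boxes_def)
qed

lemma length_boxes: "length (boxes la) = sum_list la"
proof -
  have "length (boxes la) = sum_list (map ((!) la) [0..<length la])"
    by (simp add: boxes_def length_concat comp_def)
  then show ?thesis by (simp add: map_nth)
qed

lemma boxes_down_closed:
  assumes "sorted_wrt (\<ge>) la" "(i, j) \<in> set (boxes la)" "i' \<le> i" "j' \<le> j"
  shows "(i', j') \<in> set (boxes la)"
proof -
  have "la ! i \<le> la ! i'"
    using assms by (cases "i' = i") (auto simp: set_boxes sorted_wrt_iff_nth_less)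
  then show ?thesis using assms by (auto simp: set_boxes)
qed

lemma boxes_in_tuples: "la \<in> young_diagrams k m d \<Longrightarrow> boxes la \<in> tuples k m d"
  by (force simp: young_diagrams_def tuples_def length_boxes set_boxes dest: nth_mem)

lemma boxes_inject:
  assumes "length la = length mu" "set (boxes la) = set (boxes mu)"
  shows "la = mu"
proof (rule nth_equalityI[OF assms(1)])
  fix i assume i: "i < length la"
  have "j < la ! i \<longleftrightarrow> j < mu ! i" for j
    using assms i by (auto simp: set_boxes set_eq_iff)
  then show "la ! i = mu ! i" by (metis nat_neq_iff)
qed

section \<open>The Hermitian form and adjoints\<close>

lemma herm_inner_add_left: "herm_inner k m d (u + v) w = herm_inner k m d u w + herm_inner k m d v w"
  by (simp add: herm_inner_def distrib_right sum.distrib add_divide_distrib)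

lemma herm_inner_scale_left: "herm_inner k m d (scaleT c v) w = c * herm_inner k m d v w"
  by (simp add: herm_inner_def sum_distrib_left ac_simps)

lemma herm_inner_zero_left: "herm_inner k m d 0 w = 0"
  by (simp add: herm_inner_def)

lemma herm_inner_zero_right: "herm_inner k m d w 0 = 0"
  by (simp add: herm_inner_def)

lemma herm_inner_cnj: "cnj (herm_inner k m d v w) = herm_inner k m d w v"
  by (simp add: herm_inner_def mult.commute)

lemma herm_inner_eq_0_sym: "herm_inner k m d v w = 0 \<longleftrightarrow> herm_inner k m d w v = 0"
  by (metis herm_inner_cnj complex_cnj_zero_iff)

lemma herm_inner_sum_left:
  "herm_inner k m d (\<Sum>x\<in>A. f x) w = (\<Sum>x\<in>A. herm_inner k m d (f x) w)"
proof (induction A rule: infinite_finite_induct)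
  case (insert x F)
  then show ?case by (simp only: sum.insert herm_inner_add_left not_False_eq_True)
qed (simp_all only: sum.infinite sum.empty herm_inner_zero_left not_False_eq_True)

lemma herm_inner_eq_0_span:
  assumes "\<And>x. x \<in> S \<Longrightarrow> herm_inner k m d x w = 0" and "v \<in> tens.span S"
  shows "herm_inner k m d v w = 0"
proof -
  have "tens.subspace {v. herm_inner k m d v w = 0}"
    by (rule subspaceI)
      (simp_all add: herm_inner_add_left herm_inner_scale_left herm_inner_zero_left)
  then show ?thesis
    using tens.span_minimal[of S "{v. herm_inner k m d v w = 0}"] assms by blast
qed

context tensor_power
begin

lemma ext_power_subset_tensors: "ext_power k m d \<subseteq> tensors"
  by (auto simp: ext_power_def tensors_def)

lemma herm_inner_definite:
  assumes "w \<in> tensors" "herm_inner k m d w w = 0"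
  shows "w = 0"
proof -
  have "(\<Sum>I\<in>tuples k m d. w I * cnj (w I)) = complex_of_real (\<Sum>I\<in>tuples k m d. (cmod (w I))\<^sup>2)"
    by (simp add: complex_norm_square[symmetric])
  then have "(\<Sum>I\<in>tuples k m d. (cmod (w I))\<^sup>2) = 0"
    using assms(2) by (simp add: herm_inner_def del: of_real_sum of_real_power)
  then have "\<forall>I\<in>tuples k m d. w I = 0"
    by (subst (asm) sum_nonneg_eq_0_iff) (auto simp: finite_tuples)
  then show ?thesis
    using assms(1) tens.subspace_0[OF subspace_tensors] by (intro tensors_eqI) auto
qed

lemma herm_inner_site_action:
  "herm_inner k m d (site_action K v) w = herm_inner k m d v (site_action (\<lambda>t p q. cnj (K t q p)) w)"
proof -
  have "(\<Sum>I\<in>tuples k m d. site_action K v I * cnj (w I))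
     = (\<Sum>I\<in>tuples k m d. \<Sum>J\<in>tuples k m d. (\<Prod>t<d. K t (I ! t) (J ! t)) * v J * cnj (w I))"
    by (intro sum.cong refl) (simp add: site_action_def sum_distrib_right)
  also have "\<dots> = (\<Sum>J\<in>tuples k m d. \<Sum>I\<in>tuples k m d. (\<Prod>t<d. K t (I ! t) (J ! t)) * v J * cnj (w I))"
    by (rule sum.swap)
  also have "\<dots> = (\<Sum>J\<in>tuples k m d. v J * cnj (site_action (\<lambda>t p q. cnj (K t q p)) w J))"
    by (intro sum.cong refl) (simp add: site_action_def sum_distrib_left ac_simps)
  finally show ?thesis by (simp add: herm_inner_def)
qed

lemma herm_inner_derivation:
  "herm_inner k m d (derivation X v) w = herm_inner k m d v (derivation (\<lambda>p q. cnj (X q p)) w)"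
proof -
  have "herm_inner k m d (site_action ((\<lambda>_. id_kernel)(t := X)) v) w
     = herm_inner k m d v (site_action ((\<lambda>_. id_kernel)(t := \<lambda>p q. cnj (X q p))) w)" for t
    unfolding herm_inner_site_action
    by (intro arg_cong2[where f = "herm_inner k m d"] refl site_action_cong) (auto simp: id_kernel_def)
  then have "herm_inner k m d (derivation X v) w
     = (\<Sum>t<d. herm_inner k m d v (site_action ((\<lambda>_. id_kernel)(t := \<lambda>p q. cnj (X q p))) w))"
    by (simp add: derivation_eq_sum herm_inner_sum_left)
  also have "\<dots> = cnj (\<Sum>t<d. herm_inner k m d (site_action ((\<lambda>_. id_kernel)(t := \<lambda>p q. cnj (X q p))) w) v)"
    by (simp add: herm_inner_cnj)
  also have "\<dots> = herm_inner k m d v (derivation (\<lambda>p q. cnj (X q p)) w)"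
    by (simp only: derivation_eq_sum herm_inner_sum_left[symmetric] herm_inner_cnj)
  finally show ?thesis .
qed

lemma derivation_in_ext_power:
  fixes w :: "'a::field_char_0 tensor"
  assumes w: "w \<in> ext_power k m d"
  shows "derivation X w \<in> ext_power k m d"
proof -
  have "derivation X w (permute_list p I) = of_int (sign p) * derivation X w I"
    if I: "I \<in> tuples k m d" and p: "p permutes {..<d}" for I p
  proof -
    have len: "length I = d" using I by (rule tuples_length)
    have "derivation X w (permute_list p I)
       = (\<Sum>t<d. \<Sum>b\<in>idx. X (I ! p t) b * w (permute_list p (I[p t := b])))"
      using I p permute_list_in_tuples[OF p I]
      by (simp add: derivation_def permute_list_nth permute_list_update len)
    also have "\<dots> = (\<Sum>t<d. \<Sum>b\<in>idx. X (I ! p t) b * (of_int (sign p) * w (I[p t := b])))"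
      by (intro sum.cong refl arg_cong2[where f = "(*)"] ext_powerD[OF w _ p] tuples_update[OF I])
    also have "\<dots> = (\<Sum>t<d. \<Sum>b\<in>idx. X (I ! t) b * (of_int (sign p) * w (I[t := b])))"
      by (rule sum_lessThan_permutes[OF p])
    also have "\<dots> = of_int (sign p) * derivation X w I"
      using I by (simp add: derivation_def sum_distrib_left ac_simps)
    finally show ?thesis .
  qed
  then show ?thesis by (auto simp: ext_power_def derivation_def)
qed

section \<open>Young vectors as highest weight vectors\<close>

definition young_tensor :: "nat list \<Rightarrow> complex tensor" where
  "young_tensor la = (\<lambda>I. complex_of_real (young_vector k m la I))"

lemma young_vector_eq:
  assumes la: "la \<in> young_diagrams k m d" and I: "I \<in> tuples k m d"
  shows "young_vector k m la I = det (mat d d (\<lambda>(s, t). of_bool (I ! t = boxes la ! s)))"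
proof -
  have B: "boxes la \<in> tuples k m d" using la by (rule boxes_in_tuples)
  have len: "length (boxes la) = d" using B by (rule tuples_length)
  have "(map (\<lambda>(i, j). tensor_vec (unit_vec k i) (unit_vec m j)) (boxes la) ! s) (I ! t)
      = (of_bool (I ! t = boxes la ! s) :: real)" if "s < d" "t < d" for s t
    using tuples_nth[OF I that(2)] tuples_nth[OF B that(1)] that len
    by (auto simp: tensor_vec_def split: prod.splits)
  then show ?thesis
    using I by (auto simp: young_vector_def wedge_def len intro!: arg_cong[of _ _ det] eq_matI)
qed

lemma young_tensor_in_ext_power:
  assumes la: "la \<in> young_diagrams k m d"
  shows "young_tensor la \<in> ext_power k m d"
proof -
  have "length (boxes la) = d" using la boxes_in_tuples tuples_length by blast
  then have v: "young_vector k m la \<in> ext_power k m d"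
    using wedge_in_ext_power[of k m "map (\<lambda>(i, j). tensor_vec (unit_vec k i) (unit_vec m j)) (boxes la)"]
    by (simp add: young_vector_def)
  show ?thesis
    using ext_power_outside[OF v] ext_powerD[OF v]
    by (simp add: ext_power_def young_tensor_def)
qed

lemma young_tensor_boxes:
  assumes la: "la \<in> young_diagrams k m d"
  shows "young_tensor la (boxes la) = 1"
proof -
  have B: "boxes la \<in> tuples k m d" using la by (rule boxes_in_tuples)
  have "mat d d (\<lambda>(s, t). of_bool (boxes la ! t = boxes la ! s)) = (1\<^sub>m d :: real mat)"
    using distinct_boxes[of la] tuples_length[OF B]
    by (intro eq_matI) (auto simp: distinct_conv_nth)
  then show ?thesis
    by (simp add: young_tensor_def young_vector_eq[OF la B])
qed

lemma young_tensor_support: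
  assumes la: "la \<in> young_diagrams k m d" and nz: "young_tensor la I \<noteq> 0"
  shows "mset I = mset (boxes la)"
proof -
  have I: "I \<in> tuples k m d"
    using ext_power_outside[OF young_tensor_in_ext_power[OF la]] nz by blast
  have len: "length (boxes la) = d" "length I = d"
    using la boxes_in_tuples tuples_length I by blast+
  have "young_vector k m la I \<noteq> 0"
    using nz by (simp add: young_tensor_def)
  then have "(\<Sum>p | p permutes {..<d}. of_int (sign p) * (\<Prod>t<d. of_bool (I ! t = boxes la ! p t))) \<noteq> (0::real)"
    by (simp add: young_vector_eq[OF la I] det_columns)
  then obtain p where p: "p permutes {..<d}"
    "(\<Prod>t<d. of_bool (I ! t = boxes la ! p t)) \<noteq> (0::real)"
    by (metis (mono_tags, lifting) mem_Collect_eq mult_zero_right sum.neutral)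
  then have "\<forall>t<d. I ! t = boxes la ! p t" by auto
  then have "I = permute_list p (boxes la)"
    using p(1) len by (intro nth_equalityI) (auto simp: permute_list_nth)
  then show ?thesis using p(1) len by simp
qed

text \<open>An off-diagonal entry of an upper triangular matrix moves a box towards the corner, to a
  position that a Young diagram already contains, so the wedge acquires a repeated factor. Only the
  diagonal entries survive, and their sum over the boxes is the highest weight.\<close>

lemma derivation_upper_young_tensor:
  assumes la: "la \<in> young_diagrams k m d"
    and g: "\<And>a b. b < a \<Longrightarrow> a < k \<Longrightarrow> g a b = 0" and h: "\<And>a b. b < a \<Longrightarrow> a < m \<Longrightarrow> h a b = 0"
  shows "derivation (gl_kernel g h) (young_tensor la)
    = scaleT (\<Sum>p\<leftarrow>boxes la. gl_kernel g h p p) (young_tensor la)"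
proof (rule tensors_eqI)
  let ?v = "young_tensor la"
  note ext = young_tensor_in_ext_power[OF la]
  fix I assume I: "I \<in> tuples k m d"
  have len: "length I = d" using I by (rule tuples_length)
  show "derivation (gl_kernel g h) ?v I = scaleT (\<Sum>p\<leftarrow>boxes la. gl_kernel g h p p) ?v I"
  proof (cases "distinct I")
    case False
    then show ?thesis
      using ext_power_not_distinct[OF ext False] ext_power_not_distinct[OF derivation_in_ext_power[OF ext] False]
      by simp
  next
    case True
    have 0: "gl_kernel g h (I ! t) b * ?v (I[t := b]) = 0" if t: "t < d" and b: "b \<noteq> I ! t" "b \<in> idx" for t b
    proof (rule ccontr)
      assume nz: "gl_kernel g h (I ! t) b * ?v (I[t := b]) \<noteq> 0"
      then have "mset (I[t := b]) = mset (boxes la)" by (intro young_tensor_support[OF la]) simp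
      then have set: "set (I[t := b]) = set (boxes la)" by (rule mset_eq_setD)
      have It: "I ! t \<in> idx" using I t by (rule tuples_nth)
      have "fst (I ! t) \<le> fst b \<and> snd (I ! t) \<le> snd b"
        using nz It b g[of "fst b" "fst (I ! t)"] h[of "snd b" "snd (I ! t)"]
        by (cases "fst (I ! t) \<le> fst b"; cases "snd (I ! t) \<le> snd b")
          (auto simp: gl_kernel_def row_kernel_def col_kernel_def not_le mem_Times_iff split: if_splits)
      moreover have "b \<in> set (boxes la)" using set t len by (metis set_update_memI)
      ultimately have "I ! t \<in> set (I[t := b])"
        using boxes_down_closed[of la "fst b" "snd b" "fst (I ! t)" "snd (I ! t)"] la set
        by (simp add: young_diagrams_def)
      \<comment> \<open>\<open>I ! t\<close> was replaced by the different entry \<open>b\<close>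
        and still occurs, so \<open>I\<close> contains it twice.\<close>
      then obtain s where "s < d" "I[t := b] ! s = I ! t"
        by (metis in_set_conv_nth len length_list_update)
      then show False
        using True t b len by (cases "s = t") (auto simp: distinct_conv_nth)
    qed
    have "derivation (gl_kernel g h) ?v I = (\<Sum>t<d. gl_kernel g h (I ! t) (I ! t) * ?v I)"
    proof -
      have "(\<Sum>b\<in>idx. gl_kernel g h (I ! t) b * ?v (I[t := b])) = gl_kernel g h (I ! t) (I ! t) * ?v I"
        if t: "t < d" for t
      proof -
        have "(\<Sum>b\<in>idx. gl_kernel g h (I ! t) b * ?v (I[t := b]))
            = (\<Sum>b\<in>{I ! t}. gl_kernel g h (I ! t) b * ?v (I[t := b]))"
          using tuples_nth[OF I t] 0[OF t] by (intro sum.mono_neutral_right) auto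
        then show ?thesis by simp
      qed
      then show ?thesis using I by (simp add: derivation_def)
    qed
    also have "\<dots> = (\<Sum>p\<leftarrow>I. gl_kernel g h p p) * ?v I"
      by (simp add: sum_distrib_right sum_list_sum_nth len lessThan_atLeast0)
    also have "\<dots> = (\<Sum>p\<leftarrow>boxes la. gl_kernel g h p p) * ?v I"
    proof (cases "?v I = 0")
      case False
      then have "mset I = mset (boxes la)" by (rule young_tensor_support[OF la])
      then have "mset (map (\<lambda>p. gl_kernel g h p p) I) = mset (map (\<lambda>p. gl_kernel g h p p) (boxes la))"
        by simp
      from arg_cong[OF this, of sum_mset] show ?thesis by (simp only: sum_mset_sum_list)
    qed simp
    finally show ?thesis by simp
  qed
qed (use subspace_tensors young_tensor_in_ext_power[OF la] ext_power_subset_tensors in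
    \<open>auto intro: tens.subspace_scale\<close>)

end

subsection \<open>From the orthogonal group to its Lie algebra\<close>

text \<open>An algebraic substitute for differentiation at 0: it extracts the linear term of a
  polynomial curve in a subspace without limits. The top coefficient is eliminated first and
  recovered at the end from the value at t = 1.\<close>

lemma coefficients_in_subspace:
  fixes w :: "nat \<Rightarrow> 'i \<Rightarrow> 'a::field_char_0"
  assumes U: "tens.subspace U"
    and p: "\<And>t::nat. (\<Sum>r\<le>n. scaleT (of_nat t ^ r) (w r)) \<in> U" and r: "r \<le> n"
  shows "w r \<in> U"
  using p r
proof (induction n arbitrary: w r)
  case 0
  then show ?case using "0.prems"(1)[of 0] by simp
next
  case (Suc n)
  have low: "w r \<in> U" if "r \<le> n" for r
  proof -
    \<comment> \<open>p(2t) - 2^(n+1) p(t) has no term of degree n + 1; its other coefficients are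
      multiplied by 2^r - 2^(n+1), which is nonzero in characteristic 0.\<close>
    define c :: "nat \<Rightarrow> 'a" where "c r = of_nat 2 ^ r - of_nat 2 ^ Suc n" for r
    have "(\<Sum>r\<le>n. scaleT (of_nat t ^ r) (scaleT (c r) (w r)))
        = (\<Sum>r\<le>Suc n. scaleT (of_nat (2 * t) ^ r) (w r))
          - scaleT (of_nat 2 ^ Suc n) (\<Sum>r\<le>Suc n. scaleT (of_nat t ^ r) (w r))" for t
      by (rule ext)
        (simp add: sum_fun_apply c_def algebra_simps sum_distrib_left sum_subtractf power_mult_distrib)
    then have "(\<Sum>r\<le>n. scaleT (of_nat t ^ r) (scaleT (c r) (w r))) \<in> U" for t
      using Suc.prems(1) U by (simp only: tens.subspace_diff tens.subspace_scale)
    then have cU: "scaleT (c r) (w r) \<in> U"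
      using Suc.IH[of "\<lambda>r. scaleT (c r) (w r)" r] that by blast
    have "(2::nat) ^ r \<noteq> 2 ^ Suc n"
      using that by (metis Suc_n_not_le_n power_inject_exp le_trans one_less_numeral_iff semiring_norm(76))
    then have "(of_nat (2 ^ r) :: 'a) \<noteq> of_nat (2 ^ Suc n)"
      by (metis of_nat_eq_iff)
    then have "c r \<noteq> 0" by (simp add: c_def)
    then have "scaleT (inverse (c r)) (scaleT (c r) (w r)) = w r" by (simp add: fun_eq_iff)
    then show ?thesis using tens.subspace_scale[OF U cU, of "inverse (c r)"] by metis
  qed
  have "w (Suc n) = (\<Sum>r\<le>Suc n. scaleT (of_nat 1 ^ r) (w r)) - (\<Sum>r\<le>n. w r)"
    by (rule ext) (simp add: sum_fun_apply)
  also have "\<dots> \<in> U"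
    by (intro tens.subspace_diff[OF U] Suc.prems(1) tens.subspace_sum[OF U]) (use low in auto)
  finally show ?case using low Suc.prems(2) by (cases "r = Suc n") auto
qed

lemma coeff_0_prod: "coeff (\<Prod>s\<in>F. p s) 0 = (\<Prod>s\<in>F. coeff (p s) 0)"
  for p :: "'b \<Rightarrow> 'a::comm_semiring_1 poly"
  by (induction F rule: infinite_finite_induct) (auto simp: coeff_mult)

text \<open>The Leibniz rule at 0, in the shape of \<open>derivation_eq_sum\<close>: one factor
  contributes its linear coefficient, the others their constant ones.\<close>

lemma coeff_1_prod:
  fixes p :: "'b \<Rightarrow> 'a::comm_semiring_1 poly"
  assumes "finite F"
  shows "coeff (\<Prod>s\<in>F. p s) (Suc 0)
    = (\<Sum>s\<in>F. \<Prod>s'\<in>F. if s' = s then coeff (p s') (Suc 0) else coeff (p s') 0)"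
  using assms
proof induction
  case (insert x F)
  have "(\<Prod>s'\<in>F. if s' = x then coeff (p s') (Suc 0) else coeff (p s') 0) = (\<Prod>s'\<in>F. coeff (p s') 0)"
    using insert.hyps by (intro prod.cong) auto
  moreover have "(\<Sum>s\<in>F. (if x = s then coeff (p x) (Suc 0) else coeff (p x) 0) *
        (\<Prod>s'\<in>F. if s' = s then coeff (p s') (Suc 0) else coeff (p s') 0))
      = coeff (p x) 0 * coeff (\<Prod>s\<in>F. p s) (Suc 0)"
    unfolding insert.IH sum_distrib_left using insert.hyps by (intro sum.cong) auto
  ultimately show ?case
    using insert.hyps by (simp add: coeff_mult coeff_0_prod add.commute)
qed simp

text \<open>
  The rotation of the \<open>(a, b)\<close>-plane by the angle with tangent half \<open>t\<close>. Clearing the denominator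
  \<open>1 + t\<^sup>2\<close> makes its entries quadratic polynomials in \<open>t\<close>.
\<close>

definition plane_rotation :: "nat \<Rightarrow> nat \<Rightarrow> nat \<Rightarrow> real \<Rightarrow> real mat" where
  "plane_rotation n a b t = mat n n (\<lambda>(i, j).
     if i = j then (if i = a \<or> i = b then (1 - t\<^sup>2) / (1 + t\<^sup>2) else 1)
     else if i = a \<and> j = b then 2 * t / (1 + t\<^sup>2)
     else if i = b \<and> j = a then - 2 * t / (1 + t\<^sup>2) else 0)"

lemma dim_plane_rotation [simp]:
  "dim_row (plane_rotation n a b t) = n" "dim_col (plane_rotation n a b t) = n"
  by (simp_all add: plane_rotation_def)

lemma plane_rotation_orthogonal:
  assumes ab: "a < n" "b < n" "a \<noteq> b"
  shows "plane_rotation n a b t \<in> orthogonal_group n"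
proof -
  define R where "R i j = (if i = j then (if i = a \<or> i = b then (1 - t\<^sup>2) / (1 + t\<^sup>2) else 1)
     else if i = a \<and> j = b then 2 * t / (1 + t\<^sup>2)
     else if i = b \<and> j = a then - 2 * t / (1 + t\<^sup>2) else 0)" for i j :: nat
  have pos: "1 + t\<^sup>2 \<noteq> 0" using zero_le_power2[of t] by linarith
  have "((1 - t\<^sup>2) / (1 + t\<^sup>2))\<^sup>2 + (2 * t / (1 + t\<^sup>2))\<^sup>2 = ((1 - t\<^sup>2)\<^sup>2 + (2 * t)\<^sup>2) / (1 + t\<^sup>2)\<^sup>2"
    by (simp add: power_divide add_divide_distrib)
  also have "(1 - t\<^sup>2)\<^sup>2 + (2 * t)\<^sup>2 = (1 + t\<^sup>2)\<^sup>2"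
    by (simp add: power2_eq_square algebra_simps)
  finally have cs: "(1 - t\<^sup>2) / (1 + t\<^sup>2) * ((1 - t\<^sup>2) / (1 + t\<^sup>2))
      + 2 * t / (1 + t\<^sup>2) * (2 * t / (1 + t\<^sup>2)) = 1"
    using pos by (simp add: power2_eq_square)
  have "(\<Sum>l<n. R l i * R l j) = of_bool (i = j)" if "i < n" "j < n" for i j
  proof -
    have sub: "{a, b} \<subseteq> {..<n}" using ab by simp
    have "(\<Sum>l<n. R l i * R l j)
       = (\<Sum>l\<in>{..<n} - {a, b}. R l i * R l j) + (\<Sum>l\<in>{a, b}. R l i * R l j)"
      by (rule sum.subset_diff[OF sub]) simp
    also have "(\<Sum>l\<in>{..<n} - {a, b}. R l i * R l j)
       = (\<Sum>l\<in>{..<n} - {a, b}. if l = i then of_bool (i = j) else 0)"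
      by (intro sum.cong) (auto simp: R_def)
    also have "\<dots> = of_bool (i = j \<and> i \<noteq> a \<and> i \<noteq> b)"
      using that by (auto simp: sum.delta)
    also have "(\<Sum>l\<in>{a, b}. R l i * R l j) = R a i * R a j + R b i * R b j"
      using ab by simp
    also have "of_bool (i = j \<and> i \<noteq> a \<and> i \<noteq> b) + (R a i * R a j + R b i * R b j) = of_bool (i = j)"
      using ab cs by (cases "i = a"; cases "i = b"; cases "j = a"; cases "j = b") (auto simp: R_def)
    finally show ?thesis .
  qed
  then have "transpose_mat (plane_rotation n a b t) * plane_rotation n a b t = 1\<^sub>m n"
    by (intro eq_matI) (auto simp: plane_rotation_def scalar_prod_def R_def lessThan_atLeast0)
  then show ?thesis by (simp add: orthogonal_group_def plane_rotation_def)
qed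

lemma orthogonal_group_mult:
  assumes "g \<in> orthogonal_group n" "h \<in> orthogonal_group n"
  shows "g * h \<in> orthogonal_group n"
proof -
  have c: "g \<in> carrier_mat n n" "h \<in> carrier_mat n n" using assms by (auto simp: orthogonal_group_def)
  have "transpose_mat (g * h) * (g * h) = (transpose_mat h * transpose_mat g) * (g * h)"
    using c by (simp add: transpose_mult)
  also have "\<dots> = transpose_mat h * ((transpose_mat g * g) * h)"
    using c by (simp add: assoc_mult_mat[of _ n n _ n _ n])
  also have "\<dots> = 1\<^sub>m n"
    using assms c by (simp add: orthogonal_group_def)
  finally show ?thesis using c by (simp add: orthogonal_group_def)
qed

lemma one_in_orthogonal_group: "1\<^sub>m n \<in> orthogonal_group n"
  by (simp add: orthogonal_group_def)

context tensor_power
begin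

lemma site_action_kernel_scale:
  "site_action (\<lambda>s p q. c * K s p q) w = scaleT (c ^ d) (site_action K w)"
  by (rule ext) (simp add: site_action_def prod.distrib sum_distrib_left ac_simps)

text \<open>The curve 1 + t Y + t^2 Z acts with coordinates polynomial in t, and the coefficient of
  t is the derivation by the initial velocity \<open>Y\<close>.\<close>

lemma derivation_in_subspace_of_path:
  fixes w :: "'a::field_char_0 tensor"
  assumes U: "tens.subspace U"
    and path: "\<And>t::nat. site_action (\<lambda>_ p q. id_kernel p q + of_nat t * Y p q + of_nat t ^ 2 * Z p q) w \<in> U"
  shows "derivation Y w \<in> U"
proof -
  define P where "P I J = (\<Prod>s<d. [:id_kernel (I ! s) (J ! s), Y (I ! s) (J ! s), Z (I ! s) (J ! s):])" for I J
  define W where "W r = (\<lambda>I. if I \<in> tuples k m d then \<Sum>J\<in>tuples k m d. coeff (P I J) r * w J else 0)" for r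
  \<comment> \<open>The degree is at most 2d; the extra 1 keeps the linear coefficient in range when
    d = 0.\<close>
  define n where "n = Suc (2 * d)"
  have deg: "degree (P I J) \<le> n" for I J
  proof -
    have "degree (P I J) \<le> (\<Sum>s<d. degree [:id_kernel (I ! s) (J ! s), Y (I ! s) (J ! s), Z (I ! s) (J ! s):])"
      unfolding P_def by (rule degree_prod_sum_le[unfolded comp_def]) simp
    also have "\<dots> \<le> (\<Sum>s<d. 2)" by (intro sum_mono) (simp add: degree_pCons_eq_if)
    finally show ?thesis by (simp add: n_def)
  qed
  have "(\<Sum>r\<le>n. scaleT (of_nat t ^ r) (W r))
      = site_action (\<lambda>_ p q. id_kernel p q + of_nat t * Y p q + of_nat t ^ 2 * Z p q) w" for t
  proof (rule ext)
    fix I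
    have val: "(\<Prod>s<d. id_kernel (I ! s) (J ! s) + of_nat t * Y (I ! s) (J ! s) + of_nat t ^ 2 * Z (I ! s) (J ! s))
        = (\<Sum>r\<le>n. coeff (P I J) r * of_nat t ^ r)" for J
    proof -
      have "(\<Prod>s<d. id_kernel (I ! s) (J ! s) + of_nat t * Y (I ! s) (J ! s) + of_nat t ^ 2 * Z (I ! s) (J ! s))
          = poly (P I J) (of_nat t)"
        unfolding P_def poly_prod by (intro prod.cong) (auto simp: power2_eq_square algebra_simps)
      also have "\<dots> = (\<Sum>r\<le>n. coeff (P I J) r * of_nat t ^ r)"
        unfolding poly_altdef using deg[of I J]
        by (intro sum.mono_neutral_left) (auto simp: coeff_eq_0)
      finally show ?thesis .
    qed
    have "(\<Sum>J\<in>tuples k m d. (\<Sum>r\<le>n. coeff (P I J) r * of_nat t ^ r) * w J)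
        = (\<Sum>r\<le>n. of_nat t ^ r * (\<Sum>J\<in>tuples k m d. coeff (P I J) r * w J))"
      unfolding sum_distrib_right sum_distrib_left by (subst sum.swap) (simp add: ac_simps)
    then show "(\<Sum>r\<le>n. scaleT (of_nat t ^ r) (W r)) I
        = site_action (\<lambda>_ p q. id_kernel p q + of_nat t * Y p q + of_nat t ^ 2 * Z p q) w I"
      by (cases "I \<in> tuples k m d") (simp_all add: sum_fun_apply W_def site_action_def val)
  qed
  then have "W (Suc 0) \<in> U"
    using coefficients_in_subspace[OF U, of W n "Suc 0"] path by (simp add: n_def)
  moreover have "W (Suc 0) = derivation Y w"
  proof (rule ext)
    fix I
    have "coeff (P I J) (Suc 0)
       = (\<Sum>s<d. \<Prod>s'<d. ((\<lambda>_. id_kernel)(s := Y)) s' (I ! s') (J ! s'))" for J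
      unfolding P_def coeff_1_prod[OF finite_lessThan]
      by (intro sum.cong prod.cong refl) auto
    then show "W (Suc 0) I = derivation Y w I"
      unfolding derivation_eq_sum sum_fun_apply W_def site_action_def
      by (simp only: sum_distrib_right sum.swap[of _ "{..<d}"]) simp
  qed
  ultimately show ?thesis by simp
qed

section \<open>Complexified orthogonal orbits and their infinitesimal rotations\<close>

abbreviation complexify :: "real mat \<Rightarrow> complex mat" where
  "complexify \<equiv> map_mat complex_of_real"

lemma tensor_action_complexify:
  assumes "g \<in> carrier_mat k k" "h \<in> carrier_mat m m"
  shows "(\<lambda>I. complex_of_real (tensor_action k m d g h w I))
    = tensor_action k m d (complexify g) (complexify h) (\<lambda>I. complex_of_real (w I))"
proof (rule ext)
  fix I
  have "complex_of_real (\<Prod>t<d. g $$ (fst (I ! t), fst (J ! t)) * h $$ (snd (I ! t), snd (J ! t)))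
     = (\<Prod>t<d. complexify g $$ (fst (I ! t), fst (J ! t)) * complexify h $$ (snd (I ! t), snd (J ! t)))"
    if "I \<in> tuples k m d" "J \<in> tuples k m d" for J
    unfolding of_real_prod
  proof (intro prod.cong refl)
    fix t assume "t \<in> {..<d}"
    then have "I ! t \<in> idx" "J ! t \<in> idx" using that tuples_nth by auto
    then show "complex_of_real (g $$ (fst (I ! t), fst (J ! t)) * h $$ (snd (I ! t), snd (J ! t)))
      = complexify g $$ (fst (I ! t), fst (J ! t)) * complexify h $$ (snd (I ! t), snd (J ! t))"
      using assms by (auto simp: mem_Times_iff)
  qed
  then show "complex_of_real (tensor_action k m d g h w I)
     = tensor_action k m d (complexify g) (complexify h) (\<lambda>I. complex_of_real (w I)) I"
    by (simp add: tensor_action_def)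
qed

text \<open>Complexification is real linear, so it maps the real span of the orbit into the complex
  span of the complexified orbit; taking the real span first adds nothing.\<close>

lemma complex_schubert_span_eq:
  assumes la: "la \<in> young_diagrams k m d"
  shows "complex_schubert_span k m la = tens.span
    {tensor_action k m d (complexify g) (complexify h) (young_tensor la) | g h.
       g \<in> orthogonal_group k \<and> h \<in> orthogonal_group m}" (is "_ = tens.span ?S")
proof -
  define c :: "real tensor \<Rightarrow> complex tensor" where "c w = (\<lambda>I. complex_of_real (w I))" for w
  define S where "S = {tensor_action k m (sum_list la) g h (young_vector k m la) | g h.
        g \<in> orthogonal_group k \<and> h \<in> orthogonal_group m}"
  have d: "sum_list la = d" using la by (simp add: young_diagrams_def)
  have c_act: "c (tensor_action k m d g h (young_vector k m la))
      = tensor_action k m d (complexify g) (complexify h) (young_tensor la)"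
    if "g \<in> orthogonal_group k" "h \<in> orthogonal_group m" for g h
    using that tensor_action_complexify[of g h] by (simp add: c_def young_tensor_def orthogonal_group_def)
  have S: "S = (\<lambda>(g, h). tensor_action k m d g h (young_vector k m la)) `
      (orthogonal_group k \<times> orthogonal_group m)"
    unfolding S_def d by auto
  have "?S = (\<lambda>(g, h). tensor_action k m d (complexify g) (complexify h) (young_tensor la)) `
      (orthogonal_group k \<times> orthogonal_group m)"
    by auto
  then have cS: "c ` S = ?S"
    unfolding S image_image by (simp only:) (rule image_cong, auto simp: c_act)
  have "tens.subspace {w. c w \<in> tens.span (c ` S)}"
  proof (rule subspaceI)
    have "c 0 = 0" by (simp add: c_def fun_eq_iff)
    then show "0 \<in> {w. c w \<in> tens.span (c ` S)}" by (simp only: mem_Collect_eq tens.span_zero)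
  next
    fix v w assume "v \<in> {w. c w \<in> tens.span (c ` S)}" "w \<in> {w. c w \<in> tens.span (c ` S)}"
    moreover have "c (v + w) = c v + c w" by (simp add: c_def fun_eq_iff)
    ultimately show "v + w \<in> {w. c w \<in> tens.span (c ` S)}"
      by (simp only: mem_Collect_eq tens.span_add)
  next
    fix r w assume "w \<in> {w. c w \<in> tens.span (c ` S)}"
    moreover have "c (scaleT r w) = scaleT (complex_of_real r) (c w)" by (simp add: c_def fun_eq_iff)
    ultimately show "scaleT r w \<in> {w. c w \<in> tens.span (c ` S)}"
      by (simp only: mem_Collect_eq tens.span_scale)
  qed
  then have "tens.span S \<subseteq> {w. c w \<in> tens.span (c ` S)}"
    by (intro tens.span_minimal) (auto intro: tens.span_base)
  then have "c ` tens.span S \<subseteq> tens.span (c ` S)" by blast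
  then have "tens.span (c ` tens.span S) \<subseteq> tens.span (c ` S)"
    by (intro tens.span_minimal tens.subspace_span)
  moreover have "tens.span (c ` S) \<subseteq> tens.span (c ` tens.span S)"
    by (intro tens.span_mono image_mono tens.span_superset)
  moreover have "complex_schubert_span k m la = tens.span (c ` tens.span S)"
    unfolding complex_schubert_span_def schubert_span_def S_def c_def ..
  ultimately show ?thesis by (simp only: cS subset_antisym)
qed

lemma tensor_action_comp:
  assumes "g \<in> carrier_mat k k" "g' \<in> carrier_mat k k" "h \<in> carrier_mat m m" "h' \<in> carrier_mat m m"
  shows "tensor_action k m d g h (tensor_action k m d g' h' w) = tensor_action k m d (g * g') (h * h') w"
  unfolding tensor_action_eq_site_action site_action_comp
proof (rule site_action_cong)
  fix p q assume pq: "p \<in> idx" "q \<in> idx"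
  have "kernel_mult (\<lambda>p q. g $$ (fst p, fst q) * h $$ (snd p, snd q))
          (\<lambda>p q. g' $$ (fst p, fst q) * h' $$ (snd p, snd q)) p q
      = (\<Sum>a<k. g $$ (fst p, a) * g' $$ (a, fst q)) * (\<Sum>j<m. h $$ (snd p, j) * h' $$ (j, snd q))"
    unfolding kernel_mult_def sum_idx by (simp add: sum_product ac_simps)
  then show "kernel_mult (\<lambda>p q. g $$ (fst p, fst q) * h $$ (snd p, snd q))
          (\<lambda>p q. g' $$ (fst p, fst q) * h' $$ (snd p, snd q)) p q
      = (g * g') $$ (fst p, fst q) * (h * h') $$ (snd p, snd q)"
    using assms pq by (auto simp: scalar_prod_def lessThan_atLeast0)
qed

lemma tensor_action_one:
  assumes "w \<in> tensors"
  shows "tensor_action k m d (1\<^sub>m k) (1\<^sub>m m) w = w"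
proof -
  have "tensor_action k m d (1\<^sub>m k) (1\<^sub>m m) w = site_action (\<lambda>_. id_kernel) w"
    unfolding tensor_action_eq_site_action
    by (rule site_action_cong) (auto simp: id_kernel_def split: if_splits)
  then show ?thesis using site_action_id[OF assms] by simp
qed

lemma tensor_action_add:
  "tensor_action k m d g h (v + w) = tensor_action k m d g h v + tensor_action k m d g h w"
  unfolding tensor_action_eq_site_action by (rule site_action_add)

lemma tensor_action_scale: "tensor_action k m d g h (scaleT c w) = scaleT c (tensor_action k m d g h w)"
  unfolding tensor_action_eq_site_action by (rule site_action_scale)

lemma tensor_action_zero: "tensor_action k m d g h 0 = 0"
  unfolding tensor_action_eq_site_action by (rule site_action_zero)

lemma complex_schubert_span_orthogonal:
  assumes la: "la \<in> young_diagrams k m d"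
    and w: "w \<in> complex_schubert_span k m la" and g: "g \<in> orthogonal_group k" and h: "h \<in> orthogonal_group m"
  shows "tensor_action k m d (complexify g) (complexify h) w \<in> complex_schubert_span k m la"
proof -
  let ?T = "tensor_action k m d (complexify g) (complexify h)"
  let ?S = "{tensor_action k m d (complexify g) (complexify h) (young_tensor la) | g h.
       g \<in> orthogonal_group k \<and> h \<in> orthogonal_group m}"
  have sub: "tens.subspace {w. ?T w \<in> tens.span ?S}"
    by (rule subspaceI)
      (simp_all only: mem_Collect_eq tensor_action_add tensor_action_scale tensor_action_zero
        tens.span_zero tens.span_add tens.span_scale)
  have "?T x \<in> ?S" if "x \<in> ?S" for x
  proof -
    obtain g' h' where x: "x = tensor_action k m d (complexify g') (complexify h') (young_tensor la)"
      and gh': "g' \<in> orthogonal_group k" "h' \<in> orthogonal_group m"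
      using \<open>x \<in> ?S\<close> by blast
    have c: "g \<in> carrier_mat k k" "g' \<in> carrier_mat k k" "h \<in> carrier_mat m m" "h' \<in> carrier_mat m m"
      using g h gh' by (auto simp: orthogonal_group_def)
    then have "?T x = tensor_action k m d (complexify (g * g')) (complexify (h * h')) (young_tensor la)"
      unfolding x by (subst tensor_action_comp) (auto simp: of_real_hom.mat_hom_mult)
    then show ?thesis
      using orthogonal_group_mult[OF g gh'(1)] orthogonal_group_mult[OF h gh'(2)]
      by (intro CollectI exI conjI)
  qed
  then have "?S \<subseteq> {w. ?T w \<in> tens.span ?S}"
    by (blast intro: tens.span_base)
  then have "tens.span ?S \<subseteq> {w. ?T w \<in> tens.span ?S}"
    by (rule tens.span_minimal[OF _ sub])
  then show ?thesis using w unfolding complex_schubert_span_eq[OF la] by blast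
qed

lemma derivation_row_rotation:
  assumes U: "tens.subspace U"
    and T: "\<And>g h. g \<in> orthogonal_group k \<Longrightarrow> h \<in> orthogonal_group m \<Longrightarrow>
      tensor_action k m d (complexify g) (complexify h) w \<in> U"
    and ab: "a < k" "b < k" "a \<noteq> b"
  shows "derivation (row_kernel (\<lambda>i j. of_bool (i = a \<and> j = b) - of_bool (i = b \<and> j = a))) w \<in> U"
proof -
  \<comment> \<open>Multiplied by 1 + t^2, the rotation becomes 1 + 2 t \<open>Y\<close> + t^2
    \<open>Z\<close>: \<open>Y\<close> generates the rotations of the (a, b)-plane, and
    \<open>Z\<close> collects the quadratic terms left on the diagonal.\<close>
  define Y :: "nat \<Rightarrow> nat \<Rightarrow> complex" where
    "Y i j = of_bool (i = a \<and> j = b) - of_bool (i = b \<and> j = a)" for i j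
  define Z :: "nat \<Rightarrow> nat \<Rightarrow> complex" where
    "Z i j = of_bool (i = j) * (if i = a \<or> i = b then -1 else 1)" for i j
  have "derivation (\<lambda>p q. 2 * row_kernel Y p q) w \<in> U"
  proof (rule derivation_in_subspace_of_path[OF U, where Z = "row_kernel Z"])
    fix t :: nat
    define r where "r = real t"
    have pos: "1 + r\<^sup>2 \<noteq> 0" using zero_le_power2[of r] by linarith
    have "complex_of_real (1 + r\<^sup>2) \<noteq> 0" using pos by (simp only: of_real_eq_0_iff not_False_eq_True)
    then have posc: "1 + (complex_of_real r)\<^sup>2 \<noteq> 0" by simp
    \<comment> \<open>The denominator 1 + r^2 occurs once at each of the d positions; clearing it
      costs a scalar factor, under which \<open>U\<close> is stable.\<close>
    have path: "scaleT ((1 + (complex_of_real r)\<^sup>2) ^ d)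
        (tensor_action k m d (complexify (plane_rotation k a b r)) (complexify (1\<^sub>m m)) w)
      = site_action (\<lambda>_ p q. id_kernel p q + of_nat t * (2 * row_kernel Y p q) + of_nat t ^ 2 * row_kernel Z p q) w"
      unfolding tensor_action_eq_site_action site_action_kernel_scale[symmetric]
    proof (rule site_action_cong)
      fix p q assume pq: "p \<in> idx" "q \<in> idx"
      have "(1 + (complex_of_real r)\<^sup>2) * complexify (plane_rotation k a b r) $$ (i, j)
         = of_bool (i = j) + of_nat t * (2 * Y i j) + of_nat t ^ 2 * Z i j" if "i < k" "j < k" for i j
        using that ab posc by (auto simp: plane_rotation_def Y_def Z_def r_def)
      then show "(1 + (complex_of_real r)\<^sup>2) * (complexify (plane_rotation k a b r) $$ (fst p, fst q)
            * complexify (1\<^sub>m m) $$ (snd p, snd q))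
          = id_kernel p q + of_nat t * (2 * row_kernel Y p q) + of_nat t ^ 2 * row_kernel Z p q"
        using pq by (cases "snd p = snd q") (auto simp: id_kernel_def row_kernel_def prod_eq_iff mem_Times_iff)
    qed
    show "site_action (\<lambda>_ p q. id_kernel p q + of_nat t * (2 * row_kernel Y p q)
        + of_nat t ^ 2 * row_kernel Z p q) w \<in> U"
      unfolding path[symmetric]
      by (intro tens.subspace_scale[OF U] T plane_rotation_orthogonal[OF ab] one_in_orthogonal_group)
  qed
  then have "scaleT (1/2) (derivation (\<lambda>p q. 2 * row_kernel Y p q) w) \<in> U"
    by (rule tens.subspace_scale[OF U])
  then show ?thesis
    unfolding derivation_kernel_scale by (simp add: Y_def[abs_def])
qed

lemma derivation_col_rotation:
  assumes U: "tens.subspace U"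
    and T: "\<And>g h. g \<in> orthogonal_group k \<Longrightarrow> h \<in> orthogonal_group m \<Longrightarrow>
      tensor_action k m d (complexify g) (complexify h) w \<in> U"
    and ab: "a < m" "b < m" "a \<noteq> b"
  shows "derivation (col_kernel (\<lambda>i j. of_bool (i = a \<and> j = b) - of_bool (i = b \<and> j = a))) w \<in> U"
proof -
  define Y :: "nat \<Rightarrow> nat \<Rightarrow> complex" where
    "Y i j = of_bool (i = a \<and> j = b) - of_bool (i = b \<and> j = a)" for i j
  define Z :: "nat \<Rightarrow> nat \<Rightarrow> complex" where
    "Z i j = of_bool (i = j) * (if i = a \<or> i = b then -1 else 1)" for i j
  have "derivation (\<lambda>p q. 2 * col_kernel Y p q) w \<in> U"
  proof (rule derivation_in_subspace_of_path[OF U, where Z = "col_kernel Z"])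
    fix t :: nat
    define r where "r = real t"
    have pos: "1 + r\<^sup>2 \<noteq> 0" using zero_le_power2[of r] by linarith
    have "complex_of_real (1 + r\<^sup>2) \<noteq> 0" using pos by (simp only: of_real_eq_0_iff not_False_eq_True)
    then have posc: "1 + (complex_of_real r)\<^sup>2 \<noteq> 0" by simp
    have path: "scaleT ((1 + (complex_of_real r)\<^sup>2) ^ d)
        (tensor_action k m d (complexify (1\<^sub>m k)) (complexify (plane_rotation m a b r)) w)
      = site_action (\<lambda>_ p q. id_kernel p q + of_nat t * (2 * col_kernel Y p q) + of_nat t ^ 2 * col_kernel Z p q) w"
      unfolding tensor_action_eq_site_action site_action_kernel_scale[symmetric]
    proof (rule site_action_cong)
      fix p q assume pq: "p \<in> idx" "q \<in> idx"
      have "(1 + (complex_of_real r)\<^sup>2) * complexify (plane_rotation m a b r) $$ (i, j)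
         = of_bool (i = j) + of_nat t * (2 * Y i j) + of_nat t ^ 2 * Z i j" if "i < m" "j < m" for i j
        using that ab posc by (auto simp: plane_rotation_def Y_def Z_def r_def)
      then show "(1 + (complex_of_real r)\<^sup>2) * (complexify (1\<^sub>m k) $$ (fst p, fst q)
            * complexify (plane_rotation m a b r) $$ (snd p, snd q))
          = id_kernel p q + of_nat t * (2 * col_kernel Y p q) + of_nat t ^ 2 * col_kernel Z p q"
        using pq by (cases "fst p = fst q") (auto simp: id_kernel_def col_kernel_def prod_eq_iff mem_Times_iff)
    qed
    show "site_action (\<lambda>_ p q. id_kernel p q + of_nat t * (2 * col_kernel Y p q)
        + of_nat t ^ 2 * col_kernel Z p q) w \<in> U"
      unfolding path[symmetric]
      by (intro tens.subspace_scale[OF U] T one_in_orthogonal_group plane_rotation_orthogonal[OF ab])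
  qed
  then have "scaleT (1/2) (derivation (\<lambda>p q. 2 * col_kernel Y p q) w) \<in> U"
    by (rule tens.subspace_scale[OF U])
  then show ?thesis
    unfolding derivation_kernel_scale by (simp add: Y_def[abs_def])
qed

end

subsection \<open>Schubert spans as Lie algebra modules\<close>

text \<open>All ordered pairs are summed, so each plane rotation generator occurs twice, for (a, b)
  and, with both signs reversed, for (b, a); hence the factor 1/2.\<close>

lemma antisymmetric_expand:
  fixes g :: "nat \<Rightarrow> nat \<Rightarrow> complex"
  assumes anti: "\<And>a b. g b a = - g a b" and ij: "i < n" "j < n"
  shows "(\<Sum>(a, b)\<in>{..<n} \<times> {..<n}.
    g a b / 2 * (of_bool (i = a \<and> j = b) - of_bool (i = b \<and> j = a))) = g i j"
proof -
  have "(\<Sum>(a, b)\<in>{..<n} \<times> {..<n}. g a b / 2 * (of_bool (i = a \<and> j = b) - of_bool (i = b \<and> j = a)))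
      = (\<Sum>a<n. \<Sum>b<n. (if a = i then if b = j then g a b / 2 else 0 else 0)
          - (if b = i then if a = j then g a b / 2 else 0 else 0))"
    unfolding sum.cartesian_product[symmetric] by (intro sum.cong) auto
  also have "\<dots> = g i j / 2 - g j i / 2"
  proof -
    have "(\<Sum>a<n. \<Sum>b<n. if a = i then if b = j then g a b / 2 else 0 else 0) = g i j / 2"
    proof -
      have "(\<Sum>b<n. if a = i then if b = j then g a b / 2 else 0 else 0)
          = (if a = i then g a j / 2 else 0)" for a
        using ij by simp
      then show ?thesis using ij by simp
    qed
    moreover have "(\<Sum>a<n. \<Sum>b<n. if b = i then if a = j then g a b / 2 else 0 else 0) = g j i / 2"
      using ij by simp
    ultimately show ?thesis by (simp only: sum_subtractf)
  qed
  finally show ?thesis using anti[of i j] by simp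
qed

definition strictly_lower :: "((nat \<Rightarrow> nat \<Rightarrow> complex) \<times> (nat \<Rightarrow> nat \<Rightarrow> complex)) set" where
  "strictly_lower = {(g, h). (\<forall>a b. a \<le> b \<longrightarrow> g a b = 0) \<and> (\<forall>a b. a \<le> b \<longrightarrow> h a b = 0)}"

definition upper_triangular :: "((nat \<Rightarrow> nat \<Rightarrow> complex) \<times> (nat \<Rightarrow> nat \<Rightarrow> complex)) set" where
  "upper_triangular = {(g, h). (\<forall>a b. b < a \<longrightarrow> g a b = 0) \<and> (\<forall>a b. b < a \<longrightarrow> h a b = 0)}"

definition antisymmetric :: "((nat \<Rightarrow> nat \<Rightarrow> complex) \<times> (nat \<Rightarrow> nat \<Rightarrow> complex)) set" where
  "antisymmetric = {(g, h). (\<forall>a b. g b a = - g a b) \<and> (\<forall>a b. h b a = - h a b)}"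

context tensor_power
begin

lemma derivation_antisymmetric:
  assumes U: "tens.subspace U"
    and T: "\<And>g h. g \<in> orthogonal_group k \<Longrightarrow> h \<in> orthogonal_group m \<Longrightarrow>
      tensor_action k m d (complexify g) (complexify h) w \<in> U"
    and gh: "(g, h) \<in> antisymmetric"
  shows "derivation (gl_kernel g h) w \<in> U"
proof -
  let ?E = "\<lambda>a b i j. of_bool (i = a \<and> j = b) - of_bool (i = b \<and> j = a) :: complex"
  have zero: "derivation (\<lambda>p q. 0) w = 0"
    by (simp add: derivation_def fun_eq_iff)
  have row: "derivation (row_kernel (?E a b)) w \<in> U" if "a < k" "b < k" for a b
  proof (cases "a = b")
    case True
    then have "row_kernel (?E a b) = (\<lambda>p q. 0)" by (simp add: row_kernel_def fun_eq_iff)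
    then show ?thesis using zero tens.subspace_0[OF U] by simp
  next
    case False
    show ?thesis by (rule derivation_row_rotation[OF U _ that False]) (rule T)
  qed
  have col: "derivation (col_kernel (?E a b)) w \<in> U" if "a < m" "b < m" for a b
  proof (cases "a = b")
    case True
    then have "col_kernel (?E a b) = (\<lambda>p q. 0)" by (simp add: col_kernel_def fun_eq_iff)
    then show ?thesis using zero tens.subspace_0[OF U] by simp
  next
    case False
    show ?thesis by (rule derivation_col_rotation[OF U _ that False]) (rule T)
  qed
  have anti: "\<And>a b. g b a = - g a b" "\<And>a b. h b a = - h a b"
    using gh unfolding antisymmetric_def by blast+
  have "derivation (row_kernel g) w
      = derivation (\<lambda>p q. \<Sum>x\<in>{..<k} \<times> {..<k}. g (fst x) (snd x) / 2 * row_kernel (?E (fst x) (snd x)) p q) w"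
  proof (rule derivation_cong)
    fix p q assume pq: "p \<in> idx" "q \<in> idx"
    have "(\<Sum>(a, b)\<in>{..<k} \<times> {..<k}. g a b / 2 * ?E a b (fst p) (fst q)) = g (fst p) (fst q)"
      using pq by (intro antisymmetric_expand anti) auto
    then show "row_kernel g p q
        = (\<Sum>x\<in>{..<k} \<times> {..<k}. g (fst x) (snd x) / 2 * row_kernel (?E (fst x) (snd x)) p q)"
      by (simp add: row_kernel_def case_prod_unfold)
  qed
  also have "\<dots> \<in> U"
    unfolding derivation_kernel_sum derivation_kernel_scale
    using row by (intro tens.subspace_sum[OF U] tens.subspace_scale[OF U]) auto
  finally have 1: "derivation (row_kernel g) w \<in> U" .
  have "derivation (col_kernel h) w
      = derivation (\<lambda>p q. \<Sum>x\<in>{..<m} \<times> {..<m}. h (fst x) (snd x) / 2 * col_kernel (?E (fst x) (snd x)) p q) w"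
  proof (rule derivation_cong)
    fix p q assume pq: "p \<in> idx" "q \<in> idx"
    have "(\<Sum>(a, b)\<in>{..<m} \<times> {..<m}. h a b / 2 * ?E a b (snd p) (snd q)) = h (snd p) (snd q)"
      using pq by (intro antisymmetric_expand anti) auto
    then show "col_kernel h p q
        = (\<Sum>x\<in>{..<m} \<times> {..<m}. h (fst x) (snd x) / 2 * col_kernel (?E (fst x) (snd x)) p q)"
      by (simp add: col_kernel_def case_prod_unfold)
  qed
  also have "\<dots> \<in> U"
    unfolding derivation_kernel_sum derivation_kernel_scale
    using col by (intro tens.subspace_sum[OF U] tens.subspace_scale[OF U]) auto
  finally have 2: "derivation (col_kernel h) w \<in> U" .
  have "derivation (gl_kernel g h) w = derivation (row_kernel g) w + derivation (col_kernel h) w"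
    unfolding gl_kernel_def[abs_def] by (rule derivation_kernel_add)
  then show ?thesis using tens.subspace_add[OF U 1 2] by simp
qed

abbreviation lower_module :: "nat list \<Rightarrow> complex tensor set" where
  "lower_module la \<equiv> cyclic_span
     {derivation (gl_kernel g h) | g h. (g, h) \<in> strictly_lower} (young_tensor la)"

lemma derivation_upper_triangular:
  assumes "la \<in> young_diagrams k m d" "(g, h) \<in> upper_triangular"
  shows "\<exists>c. derivation (gl_kernel g h) (young_tensor la) = scaleT c (young_tensor la)"
  using derivation_upper_young_tensor[OF assms(1), of g h] assms(2)
  unfolding upper_triangular_def by blast

lemma lower_module_gl_closed:
  assumes la: "la \<in> young_diagrams k m d" and w: "w \<in> lower_module la"
  shows "derivation (gl_kernel g h) w \<in> lower_module la"
proof (rule cyclic_gl_closed[where B = upper_triangular])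
  fix g h :: "nat \<Rightarrow> nat \<Rightarrow> complex"
  let ?l = "\<lambda>g a b. if b < a then g a b else 0 :: complex"
  let ?u = "\<lambda>g a b. if b < a then 0 else g a b :: complex"
  have "(?l g, ?l h) \<in> strictly_lower" "(?u g, ?u h) \<in> upper_triangular"
    "\<forall>p\<in>idx. \<forall>q\<in>idx. gl_kernel g h p q = gl_kernel (?l g) (?l h) p q + gl_kernel (?u g) (?u h) p q"
    by (auto simp: strictly_lower_def upper_triangular_def gl_kernel_def row_kernel_def col_kernel_def)
  then show "\<exists>g1 h1 g2 h2. (g1, h1) \<in> strictly_lower \<and> (g2, h2) \<in> upper_triangular \<and>
      (\<forall>p\<in>idx. \<forall>q\<in>idx. gl_kernel g h p q = gl_kernel g1 h1 p q + gl_kernel g2 h2 p q)"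
    by blast
qed (use derivation_upper_triangular[OF la] w in auto)

lemma lower_module_subset_ext_power:
  assumes la: "la \<in> young_diagrams k m d"
  shows "lower_module la \<subseteq> ext_power k m d"
proof (rule cyclic_subset[OF subspace_ext_power])
  show "young_tensor la \<in> ext_power k m d" by (rule young_tensor_in_ext_power[OF la])
qed (auto intro: derivation_in_ext_power)

text \<open>A cycle of inclusions through the module \<open>?K\<close> generated by the
  antisymmetric pairs. The orbit lies in the lower module by stability under all matrices, the lower
  module lies in \<open>?K\<close> because \<open>?K\<close> is stable under the whole Lie algebra,
  and \<open>?K\<close> lies in the orbit span because the linear terms of rotations stay in a
  subspace stable under rotations.\<close>

lemma complex_schubert_span_eq_lower_module:
  assumes la: "la \<in> young_diagrams k m d"
  shows "complex_schubert_span k m la = lower_module la"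
proof (rule subset_antisym)
  have "tensor_action k m d g h (young_tensor la) \<in> lower_module la" for g h
    using lower_module_subset_ext_power[OF la] ext_power_subset_tensors
    by (intro tensor_action_closed subspace_cyclic_span lower_module_gl_closed[OF la] cyclic_base) auto
  then show "complex_schubert_span k m la \<subseteq> lower_module la"
    unfolding complex_schubert_span_eq[OF la]
    by (intro tens.span_minimal subspace_cyclic_span) auto
next
  let ?K = "cyclic_span {derivation (gl_kernel g h) | g h. (g, h) \<in> antisymmetric} (young_tensor la)"
  have K: "derivation (gl_kernel g h) w \<in> ?K" if "w \<in> ?K" for g h w
  proof (rule cyclic_gl_closed[where B = upper_triangular])
    fix g h :: "nat \<Rightarrow> nat \<Rightarrow> complex"
    \<comment> \<open>The infinitesimal Iwasawa decomposition: \<open>?a\<close> keeps the strictly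
      lower part and reflects it with opposite sign, so subtracting it leaves an upper triangular
      matrix.\<close>
    let ?a = "\<lambda>g a b. if b < a then g a b else if a < b then - g b a else 0 :: complex"
    let ?u = "\<lambda>g a b. g a b - ?a g a b"
    have "(?a g, ?a h) \<in> antisymmetric" "(?u g, ?u h) \<in> upper_triangular"
      "\<forall>p\<in>idx. \<forall>q\<in>idx. gl_kernel g h p q = gl_kernel (?a g) (?a h) p q + gl_kernel (?u g) (?u h) p q"
      by (auto simp: antisymmetric_def upper_triangular_def gl_kernel_def row_kernel_def col_kernel_def)
    then show "\<exists>g1 h1 g2 h2. (g1, h1) \<in> antisymmetric \<and> (g2, h2) \<in> upper_triangular \<and>
        (\<forall>p\<in>idx. \<forall>q\<in>idx. gl_kernel g h p q = gl_kernel g1 h1 p q + gl_kernel g2 h2 p q)"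
      by blast
  qed (use derivation_upper_triangular[OF la] that in auto)
  have "lower_module la \<subseteq> ?K"
    by (rule cyclic_subset[OF subspace_cyclic_span cyclic_base]) (auto intro: K)
  also have "?K \<subseteq> complex_schubert_span k m la"
  proof (rule cyclic_subset)
    show sub: "tens.subspace (complex_schubert_span k m la)"
      unfolding complex_schubert_span_def by (rule tens.subspace_span)
    have "young_tensor la \<in> tensors"
      using young_tensor_in_ext_power[OF la] ext_power_subset_tensors by blast
    then have one: "tensor_action k m d (complexify (1\<^sub>m k)) (complexify (1\<^sub>m m)) (young_tensor la) = young_tensor la"
      by (simp add: of_real_hom.mat_hom_one tensor_action_one)
    show "young_tensor la \<in> complex_schubert_span k m la"
      unfolding complex_schubert_span_eq[OF la]
      by (rule tens.span_base, rule CollectI, rule exI[of _ "1\<^sub>m k"], rule exI[of _ "1\<^sub>m m"],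
          rule conjI[OF one[symmetric]]) (simp add: one_in_orthogonal_group)
    fix T x
    assume T: "T \<in> {derivation (gl_kernel g h) | g h. (g, h) \<in> antisymmetric}"
      and x: "x \<in> complex_schubert_span k m la"
    then show "T x \<in> complex_schubert_span k m la"
      using derivation_antisymmetric[OF sub complex_schubert_span_orthogonal[OF la x]] by auto
  qed
  finally show "lower_module la \<subseteq> complex_schubert_span k m la" .
qed

lemma subspace_complex_schubert_span: "tens.subspace (complex_schubert_span k m la)"
  unfolding complex_schubert_span_def by (rule tens.subspace_span)

lemma complex_schubert_span_subset:
  "la \<in> young_diagrams k m d \<Longrightarrow> complex_schubert_span k m la \<subseteq> ext_power k m d"
  by (simp only: complex_schubert_span_eq_lower_module lower_module_subset_ext_power)

lemma young_tensor_in_schubert_span: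
  "la \<in> young_diagrams k m d \<Longrightarrow> young_tensor la \<in> complex_schubert_span k m la"
  by (simp only: complex_schubert_span_eq_lower_module cyclic_base)

lemma schubert_span_gl_closed:
  assumes "la \<in> young_diagrams k m d" "w \<in> complex_schubert_span k m la"
  shows "derivation (gl_kernel g h) w \<in> complex_schubert_span k m la"
  using assms lower_module_gl_closed by (simp only: complex_schubert_span_eq_lower_module)

lemma GL_submodule_schubert_span:
  assumes la: "la \<in> young_diagrams k m d"
  shows "GL_submodule k m d (complex_schubert_span k m la)"
  unfolding GL_submodule_def
proof (intro conjI ballI)
  fix g h :: "complex mat" and w :: "complex tensor"
  assume w: "w \<in> complex_schubert_span k m la"
  show "tensor_action k m d g h w \<in> complex_schubert_span k m la"
    by (rule tensor_action_closed[OF subspace_complex_schubert_span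
          subset_trans[OF complex_schubert_span_subset[OF la] ext_power_subset_tensors]])
      (rule schubert_span_gl_closed[OF la], assumption, rule w)
qed (rule subspace_complex_schubert_span complex_schubert_span_subset[OF la])+

lemma cnj_gl_kernel:
  "(\<lambda>p q. cnj (gl_kernel g h q p)) = gl_kernel (\<lambda>a b. cnj (g b a)) (\<lambda>a b. cnj (h b a))"
  by (auto simp: fun_eq_iff gl_kernel_def row_kernel_def col_kernel_def)

text \<open>Distinct diagrams have Young tensors with disjoint supports. A strictly lower operator
  moved to the other side becomes strictly upper and annihilates \<open>young_tensor mu\<close>, the
  eigenvalue being a sum of zero diagonal entries.\<close>

lemma herm_inner_young_tensor:
  assumes la: "la \<in> young_diagrams k m d" and mu: "mu \<in> young_diagrams k m d" and ne: "la \<noteq> mu"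
    and v: "v \<in> complex_schubert_span k m la"
  shows "herm_inner k m d v (young_tensor mu) = 0"
proof -
  have "lower_module la \<subseteq> {v. herm_inner k m d v (young_tensor mu) = 0}"
  proof (rule cyclic_subset)
    show "tens.subspace {v. herm_inner k m d v (young_tensor mu) = 0}"
      by (rule subspaceI)
        (simp_all add: herm_inner_add_left herm_inner_scale_left herm_inner_zero_left)
  next
    have "young_tensor la I = 0 \<or> young_tensor mu I = 0" for I
    proof (rule ccontr)
      assume "\<not> ?thesis"
      then have "mset I = mset (boxes la)" "mset I = mset (boxes mu)"
        using young_tensor_support[OF la, of I] young_tensor_support[OF mu, of I] by blast+
      then have "set (boxes la) = set (boxes mu)" by (metis set_mset_mset)
      then show False
        using boxes_inject[of la mu] ne la mu by (auto simp: young_diagrams_def)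
    qed
    then have "young_tensor la I * cnj (young_tensor mu I) = 0" for I
      by (metis complex_cnj_zero_iff mult_eq_0_iff)
    then have "(\<Sum>I\<in>tuples k m d. young_tensor la I * cnj (young_tensor mu I)) = 0"
      by (intro sum.neutral) blast
    then show "young_tensor la \<in> {v. herm_inner k m d v (young_tensor mu) = 0}"
      by (simp add: herm_inner_def)
  next
    fix T x assume "T \<in> {derivation (gl_kernel g h) | g h. (g, h) \<in> strictly_lower}"
    then obtain g h where T: "T = derivation (gl_kernel g h)" and gh: "(g, h) \<in> strictly_lower"
      by blast
    have "herm_inner k m d (T x) (young_tensor mu) = herm_inner k m d x
        (derivation (gl_kernel (\<lambda>a b. cnj (g b a)) (\<lambda>a b. cnj (h b a))) (young_tensor mu))"
      unfolding T herm_inner_derivation cnj_gl_kernel ..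
    also have "derivation (gl_kernel (\<lambda>a b. cnj (g b a)) (\<lambda>a b. cnj (h b a))) (young_tensor mu)
        = scaleT (\<Sum>p\<leftarrow>boxes mu. 0) (young_tensor mu)"
      using gh by (subst derivation_upper_young_tensor[OF mu])
        (auto simp: strictly_lower_def gl_kernel_def row_kernel_def col_kernel_def)
    also have "\<dots> = 0" by (simp add: fun_eq_iff)
    finally show "T x \<in> {v. herm_inner k m d v (young_tensor mu) = 0}"
      by (simp only: herm_inner_zero_right mem_Collect_eq)
  qed
  then show ?thesis
    using v complex_schubert_span_eq_lower_module[OF la] by blast
qed

text \<open>The Lie algebra is closed under adjoints and preserves the span of \<open>la\<close>,
  hence also its orthogonal complement; this contains \<open>young_tensor mu\<close> and therefore
  everything generated from it.\<close>

lemma schubert_span_orthogonal: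
  assumes la: "la \<in> young_diagrams k m d" and mu: "mu \<in> young_diagrams k m d" and ne: "la \<noteq> mu"
    and v: "v \<in> complex_schubert_span k m la" and w: "w \<in> complex_schubert_span k m mu"
  shows "herm_inner k m d v w = 0"
proof -
  let ?U = "{w. \<forall>v\<in>complex_schubert_span k m la. herm_inner k m d w v = 0}"
  have "lower_module mu \<subseteq> ?U"
  proof (rule cyclic_subset)
    show "tens.subspace ?U"
      by (rule subspaceI)
        (simp_all add: herm_inner_add_left herm_inner_scale_left herm_inner_zero_left)
    show "young_tensor mu \<in> ?U"
      using herm_inner_young_tensor[OF la mu ne] by (subst mem_Collect_eq, subst herm_inner_eq_0_sym) blast
  next
    fix T x assume "T \<in> {derivation (gl_kernel g h) | g h. (g, h) \<in> strictly_lower}" and x: "x \<in> ?U"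
    then obtain g h where T: "T = derivation (gl_kernel g h)" by blast
    have "herm_inner k m d (T x) v = 0" if v: "v \<in> complex_schubert_span k m la" for v
    proof -
      have "herm_inner k m d (T x) v = herm_inner k m d x
          (derivation (gl_kernel (\<lambda>a b. cnj (g b a)) (\<lambda>a b. cnj (h b a))) v)"
        unfolding T herm_inner_derivation cnj_gl_kernel ..
      then show ?thesis
        using x schubert_span_gl_closed[OF la v, of "\<lambda>a b. cnj (g b a)" "\<lambda>a b. cnj (h b a)"]
        by (simp only: mem_Collect_eq)
    qed
    then show "T x \<in> ?U" by (simp only: mem_Collect_eq) blast
  qed
  then have "herm_inner k m d w v = 0"
    using v w complex_schubert_span_eq_lower_module[OF mu] by blast
  then show ?thesis by (subst herm_inner_eq_0_sym)
qed

end

subsection \<open>Gaps of a set of boxes and the quadratic lowering operator\<close>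

lemma finite_down_closed_nat:
  fixes N :: "nat set"
  assumes "finite N" "\<And>i j. j \<in> N \<Longrightarrow> i < j \<Longrightarrow> i \<in> N"
  shows "N = {..<card N}"
proof (cases "N = {}")
  case False
  have "N = {..Max N}"
  proof (rule Set.set_eqI)
    fix i
    show "i \<in> N \<longleftrightarrow> i \<in> {..Max N}"
      using assms(1) assms(2)[OF Max_in[OF assms(1) False], of i] Max_in[OF assms(1) False]
      by (cases "i = Max N") auto
  qed
  then have "N = {..<Suc (Max N)}" by (simp only: lessThan_Suc_atMost)
  then show ?thesis by (metis card_lessThan)
qed simp

definition row_gaps :: "(nat \<times> nat) set \<Rightarrow> nat \<times> nat \<Rightarrow> nat" where
  "row_gaps S p = card {j. j < snd p \<and> (fst p, j) \<notin> S}"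

definition col_gaps :: "(nat \<times> nat) set \<Rightarrow> nat \<times> nat \<Rightarrow> nat" where
  "col_gaps S p = card {i. i < fst p \<and> (i, snd p) \<notin> S}"

definition gaps :: "(nat \<times> nat) set \<Rightarrow> nat" where
  "gaps S = (\<Sum>p\<in>S. row_gaps S p + col_gaps S p)"

lemma row_gaps_eq_0: "row_gaps S (i, j) = 0 \<longleftrightarrow> (\<forall>j'<j. (i, j') \<in> S)"
  by (auto simp: row_gaps_def)

lemma col_gaps_eq_0: "col_gaps S (i, j) = 0 \<longleftrightarrow> (\<forall>i'<i. (i', j) \<in> S)"
  by (auto simp: col_gaps_def)

lemma sum_set_distinct: "distinct I \<Longrightarrow> (\<Sum>p\<in>set I. f p) = (\<Sum>t<length I. f (I ! t))"
  for f :: "'b \<Rightarrow> 'c::comm_monoid_add"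
  using sum.reindex_bij_betw[OF bij_betw_nth[OF _ refl refl], of I f] by simp

text \<open>A position to the left of a box is either missing or occupied. The occupied ones are
  counted by list indices, as they appear in sums over tensor positions, and the additive form
  avoids truncated subtraction.\<close>

lemma row_gaps_nth:
  assumes "distinct I" "s < length I"
  shows "row_gaps (set I) (I ! s) + card {t. t < length I \<and> fst (I ! t) = fst (I ! s) \<and> snd (I ! t) < snd (I ! s)}
    = snd (I ! s)"
proof -
  let ?p = "I ! s"
  let ?A = "{t. t < length I \<and> fst (I ! t) = fst ?p \<and> snd (I ! t) < snd ?p}"
  have "bij_betw (\<lambda>t. snd (I ! t)) ?A {j. j < snd ?p \<and> (fst ?p, j) \<in> set I}"
    unfolding bij_betw_def
  proof
    show "inj_on (\<lambda>t. snd (I ! t)) ?A"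
      using assms(1) by (intro inj_onI) (auto simp: nth_eq_iff_index_eq[symmetric] prod_eq_iff)
    show "(\<lambda>t. snd (I ! t)) ` ?A = {j. j < snd ?p \<and> (fst ?p, j) \<in> set I}"
    proof (intro Set.equalityI subsetI)
      fix j assume "j \<in> {j. j < snd ?p \<and> (fst ?p, j) \<in> set I}"
      then obtain t where "t < length I" "I ! t = (fst ?p, j)" "j < snd ?p"
        by (auto simp: in_set_conv_nth)
      then show "j \<in> (\<lambda>t. snd (I ! t)) ` ?A" by (intro image_eqI[of _ _ t]) auto
    qed (auto, metis nth_mem prod.collapse)
  qed
  then have "card ?A = card {j. j < snd ?p \<and> (fst ?p, j) \<in> set I}" by (rule bij_betw_same_card)
  moreover have "row_gaps (set I) ?p + card {j. j < snd ?p \<and> (fst ?p, j) \<in> set I} = card {j. j < snd ?p}"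
  proof -
    have "{j. j < snd ?p \<and> (fst ?p, j) \<notin> set I} \<union> {j. j < snd ?p \<and> (fst ?p, j) \<in> set I} = {j. j < snd ?p}"
      by auto
    then show ?thesis
      unfolding row_gaps_def by (subst card_Un_disjoint[symmetric]) auto
  qed
  ultimately show ?thesis by simp
qed

lemma col_gaps_nth:
  assumes "distinct I" "s < length I"
  shows "col_gaps (set I) (I ! s) + card {t. t < length I \<and> snd (I ! t) = snd (I ! s) \<and> fst (I ! t) < fst (I ! s)}
    = fst (I ! s)"
proof -
  let ?p = "I ! s"
  let ?A = "{t. t < length I \<and> snd (I ! t) = snd ?p \<and> fst (I ! t) < fst ?p}"
  have "bij_betw (\<lambda>t. fst (I ! t)) ?A {i. i < fst ?p \<and> (i, snd ?p) \<in> set I}"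
    unfolding bij_betw_def
  proof
    show "inj_on (\<lambda>t. fst (I ! t)) ?A"
      using assms(1) by (intro inj_onI) (auto simp: nth_eq_iff_index_eq[symmetric] prod_eq_iff)
    show "(\<lambda>t. fst (I ! t)) ` ?A = {i. i < fst ?p \<and> (i, snd ?p) \<in> set I}"
    proof (intro Set.equalityI subsetI)
      fix i assume "i \<in> {i. i < fst ?p \<and> (i, snd ?p) \<in> set I}"
      then obtain t where "t < length I" "I ! t = (i, snd ?p)" "i < fst ?p"
        by (auto simp: in_set_conv_nth)
      then show "i \<in> (\<lambda>t. fst (I ! t)) ` ?A" by (intro image_eqI[of _ _ t]) auto
    qed (auto, metis nth_mem prod.collapse)
  qed
  then have "card ?A = card {i. i < fst ?p \<and> (i, snd ?p) \<in> set I}" by (rule bij_betw_same_card)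
  moreover have "col_gaps (set I) ?p + card {i. i < fst ?p \<and> (i, snd ?p) \<in> set I} = card {i. i < fst ?p}"
  proof -
    have "{i. i < fst ?p \<and> (i, snd ?p) \<notin> set I} \<union> {i. i < fst ?p \<and> (i, snd ?p) \<in> set I} = {i. i < fst ?p}"
      by auto
    then show ?thesis
      unfolding col_gaps_def by (subst card_Un_disjoint[symmetric]) auto
  qed
  ultimately show ?thesis by simp
qed

lemma row_eq_lessThan:
  assumes fin: "finite S" and rows: "\<And>p. p \<in> S \<Longrightarrow> row_gaps S p = 0"
  shows "{j. (i, j) \<in> S} = {..<card {j. (i, j) \<in> S}}"
proof (rule finite_down_closed_nat)
  have "{j. (i, j) \<in> S} \<subseteq> snd ` S" by force
  then show "finite {j. (i, j) \<in> S}" using fin finite_subset by blast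
  fix j' j assume "j \<in> {j. (i, j) \<in> S}" "j' < j"
  then show "j' \<in> {j. (i, j) \<in> S}"
    using rows[of "(i, j)"] by (simp add: row_gaps_eq_0)
qed

text \<open>Without gaps the set is closed to the left and upwards: its rows are initial segments
  and their lengths decrease weakly.\<close>

lemma gaps_eq_0_imp_young:
  assumes I: "I \<in> tuples k m d" "distinct I" and 0: "gaps (set I) = 0"
  shows "\<exists>la\<in>young_diagrams k m d. mset I = mset (boxes la)"
proof -
  define row where "row i = {j. (i, j) \<in> set I}" for i
  define la where "la = map (\<lambda>i. card (row i)) [0..<k]"
  have z: "row_gaps (set I) p = 0" "col_gaps (set I) p = 0" if "p \<in> set I" for p
    using 0 that by (auto simp: gaps_def)
  have row: "row i = {..<card (row i)}" for i
    unfolding row_def by (rule row_eq_lessThan) (auto simp: z)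
  have "row i' \<subseteq> row i" if "i < i'" for i i'
    using z(2) that unfolding row_def by (fastforce simp: col_gaps_eq_0)
  then have mono: "card (row i') \<le> card (row i)" if "i < i'" for i i'
    using that row by (metis card_mono finite_lessThan)
  have "row i \<subseteq> {..<m}" for i
    using I by (auto simp: row_def tuples_def)
  then have le: "card (row i) \<le> m" for i
    using card_mono[of "{..<m}" "row i"] by simp
  have set: "set (boxes la) = set I"
  proof (rule Set.set_eqI)
    fix p :: "nat \<times> nat"
    obtain i j where p: "p = (i, j)" by fastforce
    have "(i, j) \<in> set I \<longleftrightarrow> j < card (row i)"
      using row[of i] by (auto simp: row_def)
    moreover have "(i, j) \<in> set I \<Longrightarrow> i < k" using I by (auto simp: tuples_def)
    ultimately show "p \<in> set (boxes la) \<longleftrightarrow> p \<in> set I"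
      by (auto simp: p set_boxes la_def)
  qed
  then have m: "mset I = mset (boxes la)"
    using I(2) distinct_boxes set_eq_iff_mset_eq_distinct by metis
  then have "sum_list la = d"
    using mset_eq_length[OF m] tuples_length[OF I(1)] by (simp add: length_boxes)
  then have "la \<in> young_diagrams k m d"
    using mono le by (auto simp: young_diagrams_def la_def sorted_wrt_iff_nth_less)
  then show ?thesis using m by blast
qed

lemma row_gaps_boxes: "p \<in> set (boxes la) \<Longrightarrow> row_gaps (set (boxes la)) p = 0"
  by (cases p) (auto simp: row_gaps_eq_0 set_boxes)

lemma finite_young_diagrams: "finite (young_diagrams k m d)"
proof (rule finite_subset)
  show "young_diagrams k m d \<subseteq> {la. set la \<subseteq> {..m} \<and> length la = k}"
    by (auto simp: young_diagrams_def)
qed (simp add: finite_lists_length_eq)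

text \<open>The factor is invariant under reordering, so antisymmetry survives. This allows cutting
  a tensor by its number of gaps and dividing by that number.\<close>

lemma ext_power_mult_set:
  fixes w :: "'a::field_char_0 tensor"
  assumes w: "w \<in> ext_power k m d"
  shows "(\<lambda>I. c (set I) * w I) \<in> ext_power k m d"
proof -
  have "set (permute_list p I) = set I" if "I \<in> tuples k m d" "p permutes {..<d}" for I p
    using that by (simp add: tuples_length)
  then show ?thesis
    using ext_powerD[OF w] ext_power_outside[OF w] by (simp add: ext_power_def)
qed

text \<open>The total distance of the boxes from the corner, which is the induction measure for
  completeness.\<close>

definition height :: "(nat \<times> nat) list \<Rightarrow> nat" where
  "height I = (\<Sum>p\<leftarrow>I. fst p + snd p)"

lemma height_update:
  "t < length I \<Longrightarrow> height (I[t := p]) + (fst (I ! t) + snd (I ! t)) = height I + (fst p + snd p)"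
  using elem_le_sum_list[of t "map (\<lambda>p. fst p + snd p) I"]
  by (simp add: height_def map_update sum_list_update)

definition matrix_unit :: "nat \<Rightarrow> nat \<Rightarrow> nat \<Rightarrow> nat \<Rightarrow> complex" where
  "matrix_unit a b i j = of_bool (i = a \<and> j = b)"

context tensor_power
begin

section \<open>The quadratic operator in coordinates\<close>

definition row_unit :: "nat \<Rightarrow> nat \<Rightarrow> complex tensor \<Rightarrow> complex tensor" where
  "row_unit a b = derivation (gl_kernel (matrix_unit a b) (\<lambda>_ _. 0))"

definition col_unit :: "nat \<Rightarrow> nat \<Rightarrow> complex tensor \<Rightarrow> complex tensor" where
  "col_unit a b = derivation (gl_kernel (\<lambda>_ _. 0) (matrix_unit a b))"

lemma row_unit_apply:
  assumes I: "I \<in> tuples k m d" and b: "b < k"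
  shows "row_unit a b w I = (\<Sum>t<d. of_bool (fst (I ! t) = a) * w (I[t := (b, snd (I ! t))]))"
proof -
  have "(\<Sum>q\<in>idx. gl_kernel (matrix_unit a b) (\<lambda>_ _. 0) (I ! t) q * w (I[t := q]))
      = of_bool (fst (I ! t) = a) * w (I[t := (b, snd (I ! t))])" if t: "t < d" for t
  proof -
    have "(\<Sum>q\<in>idx. gl_kernel (matrix_unit a b) (\<lambda>_ _. 0) (I ! t) q * w (I[t := q]))
        = (\<Sum>q\<in>{(b, snd (I ! t))}. gl_kernel (matrix_unit a b) (\<lambda>_ _. 0) (I ! t) q * w (I[t := q]))"
      using b tuples_nth[OF I t] by (intro sum.mono_neutral_right)
        (auto simp: gl_kernel_row row_kernel_def matrix_unit_def mem_Times_iff)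
    then show ?thesis by (simp add: gl_kernel_row row_kernel_def matrix_unit_def)
  qed
  then show ?thesis using I by (simp add: row_unit_def derivation_def)
qed

lemma col_unit_apply:
  assumes I: "I \<in> tuples k m d" and b: "b < m"
  shows "col_unit a b w I = (\<Sum>t<d. of_bool (snd (I ! t) = a) * w (I[t := (fst (I ! t), b)]))"
proof -
  have "(\<Sum>q\<in>idx. gl_kernel (\<lambda>_ _. 0) (matrix_unit a b) (I ! t) q * w (I[t := q]))
      = of_bool (snd (I ! t) = a) * w (I[t := (fst (I ! t), b)])" if t: "t < d" for t
  proof -
    have "(\<Sum>q\<in>idx. gl_kernel (\<lambda>_ _. 0) (matrix_unit a b) (I ! t) q * w (I[t := q]))
        = (\<Sum>q\<in>{(fst (I ! t), b)}. gl_kernel (\<lambda>_ _. 0) (matrix_unit a b) (I ! t) q * w (I[t := q]))"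
      using b tuples_nth[OF I t] by (intro sum.mono_neutral_right)
        (auto simp: gl_kernel_col col_kernel_def matrix_unit_def mem_Times_iff)
    then show ?thesis by (simp add: gl_kernel_col col_kernel_def matrix_unit_def)
  qed
  then show ?thesis using I by (simp add: col_unit_def derivation_def)
qed

definition row_swap :: "nat \<Rightarrow> nat \<Rightarrow> (nat \<times> nat) list \<Rightarrow> (nat \<times> nat) list" where
  "row_swap s t I = I[s := (fst (I ! t), snd (I ! s)), t := (fst (I ! s), snd (I ! t))]"

definition col_swap :: "nat \<Rightarrow> nat \<Rightarrow> (nat \<times> nat) list \<Rightarrow> (nat \<times> nat) list" where
  "col_swap s t I = I[s := (fst (I ! s), snd (I ! t)), t := (fst (I ! t), snd (I ! s))]"

lemma row_swap_commute: "s \<noteq> t \<Longrightarrow> row_swap s t I = row_swap t s I"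
  by (simp add: row_swap_def list_update_swap)

lemma row_swap_trivial: "fst (I ! s) = fst (I ! t) \<Longrightarrow> row_swap s t I = I"
  unfolding row_swap_def by (metis list_update_id prod.collapse)

lemma col_swap_trivial: "snd (I ! s) = snd (I ! t) \<Longrightarrow> col_swap s t I = I"
  unfolding col_swap_def by (metis list_update_id prod.collapse)

text \<open>Exchanging the entries \<open>s\<close> and \<open>t\<close> after the row swap produces
  the column swap.\<close>

lemma ext_power_col_swap:
  fixes w :: "complex tensor"
  assumes w: "w \<in> ext_power k m d" and I: "I \<in> tuples k m d" and st: "s < d" "t < d" "s \<noteq> t"
  shows "w (col_swap s t I) = - w (row_swap s t I)"
proof -
  have len: "length I = d" using I by (rule tuples_length)
  have "I ! s \<in> idx" "I ! t \<in> idx" using tuples_nth[OF I] st by auto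
  then have R: "row_swap s t I \<in> tuples k m d"
    unfolding row_swap_def by (intro tuples_update I) auto
  have "col_swap s t I = (row_swap s t I)[s := row_swap s t I ! t, t := row_swap s t I ! s]"
    using st len unfolding row_swap_def col_swap_def
    by (intro nth_equalityI) (auto simp: nth_list_update)
  then show ?thesis using ext_power_swap[OF w R st] by simp
qed

text \<open>The two units act either at the same position, which restores \<open>I\<close> and gives
  the diagonal term, or at different positions, where together they exchange the row indices a and
  b.\<close>

lemma row_unit_twice:
  assumes I: "I \<in> tuples k m d" and ab: "a < b" "b < k"
  shows "row_unit b a (row_unit a b w) I
    = (\<Sum>s<d. of_bool (fst (I ! s) = b) * w I)
      + (\<Sum>s<d. \<Sum>t<d. of_bool (fst (I ! s) = b \<and> fst (I ! t) = a) * w (row_swap s t I))"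
proof -
  have len: "length I = d" using I by (rule tuples_length)
  have "row_unit a b w (I[s := (a, snd (I ! s))])
      = w I + (\<Sum>t<d. of_bool (fst (I ! t) = a) * w (row_swap s t I))"
    if s: "s < d" "fst (I ! s) = b" for s
  proof -
    let ?J = "I[s := (a, snd (I ! s))]"
    have "I ! s \<in> idx" using I s tuples_nth by blast
    then have J: "?J \<in> tuples k m d" using ab by (intro tuples_update I) auto
    \<comment> \<open>For t = s the swap term vanishes, since that entry of \<open>I\<close> has row
      index b and not a.\<close>
    have "of_bool (fst (?J ! t) = a) * w (?J[t := (b, snd (?J ! t))])
        = (if t = s then w I else 0) + of_bool (fst (I ! t) = a) * w (row_swap s t I)" if t: "t < d" for t
    proof (cases "t = s")
      case True
      have "I[s := (b, snd (I ! s))] = I" using s by (metis list_update_id prod.collapse)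
      then show ?thesis using True s ab len by simp
    next
      case False
      then show ?thesis using s t len by (auto simp: row_swap_def)
    qed
    then show ?thesis
      using s row_unit_apply[OF J ab(2), of a w] by (simp add: sum.distrib)
  qed
  then have "of_bool (fst (I ! s) = b) * row_unit a b w (I[s := (a, snd (I ! s))])
      = of_bool (fst (I ! s) = b) * w I
        + (\<Sum>t<d. of_bool (fst (I ! s) = b \<and> fst (I ! t) = a) * w (row_swap s t I))" if "s < d" for s
    using that by (cases "fst (I ! s) = b") auto
  then show ?thesis
    using row_unit_apply[OF I, of a b "row_unit a b w"] ab by (simp add: sum.distrib)
qed

lemma col_unit_twice:
  assumes I: "I \<in> tuples k m d" and ab: "a < b" "b < m"
  shows "col_unit b a (col_unit a b w) I
    = (\<Sum>s<d. of_bool (snd (I ! s) = b) * w I)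
      + (\<Sum>s<d. \<Sum>t<d. of_bool (snd (I ! s) = b \<and> snd (I ! t) = a) * w (col_swap s t I))"
proof -
  have len: "length I = d" using I by (rule tuples_length)
  have "col_unit a b w (I[s := (fst (I ! s), a)])
      = w I + (\<Sum>t<d. of_bool (snd (I ! t) = a) * w (col_swap s t I))"
    if s: "s < d" "snd (I ! s) = b" for s
  proof -
    let ?J = "I[s := (fst (I ! s), a)]"
    have "I ! s \<in> idx" using I s tuples_nth by blast
    then have J: "?J \<in> tuples k m d" using ab by (intro tuples_update I) auto
    have "of_bool (snd (?J ! t) = a) * w (?J[t := (fst (?J ! t), b)])
        = (if t = s then w I else 0) + of_bool (snd (I ! t) = a) * w (col_swap s t I)" if t: "t < d" for t
    proof (cases "t = s")
      case True
      have "I[s := (fst (I ! s), b)] = I" using s by (metis list_update_id prod.collapse)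
      then show ?thesis using True s ab len by simp
    next
      case False
      then show ?thesis using s t len by (auto simp: col_swap_def)
    qed
    then show ?thesis
      using s col_unit_apply[OF J ab(2), of a w] by (simp add: sum.distrib)
  qed
  then have "of_bool (snd (I ! s) = b) * col_unit a b w (I[s := (fst (I ! s), a)])
      = of_bool (snd (I ! s) = b) * w I
        + (\<Sum>t<d. of_bool (snd (I ! s) = b \<and> snd (I ! t) = a) * w (col_swap s t I))" if "s < d" for s
    using that by (cases "snd (I ! s) = b") auto
  then show ?thesis
    using col_unit_apply[OF I, of a b "col_unit a b w"] ab by (simp add: sum.distrib)
qed

lemma sum_triangle_swap:
  fixes n :: nat and F :: "nat \<Rightarrow> nat \<Rightarrow> 'b \<Rightarrow> 'c::comm_monoid_add"
  shows "(\<Sum>b<n. \<Sum>a<b. \<Sum>s\<in>S. F b a s) = (\<Sum>s\<in>S. \<Sum>b<n. \<Sum>a<b. F b a s)"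
proof -
  have "(\<Sum>a<b. \<Sum>s\<in>S. F b a s) = (\<Sum>s\<in>S. \<Sum>a<b. F b a s)" for b
    by (rule sum.swap)
  then show ?thesis by (simp only:) (rule sum.swap)
qed

text \<open>Over all pairs a < b, a box with index x is selected once for each of the x smaller
  indices, and a pair of boxes exactly when its indices are strictly ordered.\<close>

lemma sum_below:
  fixes f :: "nat \<Rightarrow> complex"
  assumes "x < n"
  shows "(\<Sum>b<n. \<Sum>a<b. of_bool (x = b)) = (of_nat x :: complex)"
    "(\<Sum>b<n. \<Sum>a<b. of_bool (x = b \<and> y = a)) = (of_bool (y < x) :: complex)"
proof -
  have "(\<Sum>b<n. \<Sum>a<b. of_bool (x = b)) = (\<Sum>b<n. if b = x then of_nat x else 0 :: complex)"
    by (intro sum.cong) auto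
  then show "(\<Sum>b<n. \<Sum>a<b. of_bool (x = b)) = (of_nat x :: complex)"
    using assms by simp
  have "(\<Sum>a<b. of_bool (x = b \<and> y = a)) = (if b = x then of_bool (y < x) else 0 :: complex)" for b
  proof (cases "b = x")
    case True
    then have "(\<Sum>a<b. of_bool (x = b \<and> y = a)) = (\<Sum>a<b. if a = y then 1 else 0 :: complex)"
      by (intro sum.cong) auto
    then show ?thesis using True by simp
  qed simp
  then show "(\<Sum>b<n. \<Sum>a<b. of_bool (x = b \<and> y = a)) = (of_bool (y < x) :: complex)"
    using assms by simp
qed

definition quadratic_lowering :: "complex tensor \<Rightarrow> complex tensor" where
  "quadratic_lowering w = (\<Sum>b<k. \<Sum>a<b. row_unit b a (row_unit a b w))
    + (\<Sum>b<m. \<Sum>a<b. col_unit b a (col_unit a b w))"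

lemma sum_row_unit_twice:
  assumes I: "I \<in> tuples k m d"
  shows "(\<Sum>b<k. \<Sum>a<b. row_unit b a (row_unit a b w) I)
    = (\<Sum>s<d. of_nat (fst (I ! s))) * w I
      + (\<Sum>s<d. \<Sum>t<d. of_bool (fst (I ! t) < fst (I ! s)) * w (row_swap s t I))"
proof -
  have lt: "fst (I ! s) < k" if "s < d" for s using tuples_nth[OF I that] by auto
  have "(\<Sum>b<k. \<Sum>a<b. row_unit b a (row_unit a b w) I)
      = (\<Sum>b<k. \<Sum>a<b. \<Sum>s<d. of_bool (fst (I ! s) = b) * w I)
        + (\<Sum>b<k. \<Sum>a<b. \<Sum>s<d. \<Sum>t<d. of_bool (fst (I ! s) = b \<and> fst (I ! t) = a) * w (row_swap s t I))"
    by (simp add: row_unit_twice[OF I] sum.distrib)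
  also have "(\<Sum>b<k. \<Sum>a<b. \<Sum>s<d. of_bool (fst (I ! s) = b) * w I)
      = (\<Sum>s<d. (\<Sum>b<k. \<Sum>a<b. of_bool (fst (I ! s) = b)) * w I)"
    unfolding sum_triangle_swap sum_distrib_right ..
  also have "\<dots> = (\<Sum>s<d. of_nat (fst (I ! s))) * w I"
    by (simp add: sum_below(1) lt sum_distrib_right)
  also have "(\<Sum>b<k. \<Sum>a<b. \<Sum>s<d. \<Sum>t<d. of_bool (fst (I ! s) = b \<and> fst (I ! t) = a) * w (row_swap s t I))
      = (\<Sum>s<d. \<Sum>t<d. (\<Sum>b<k. \<Sum>a<b. of_bool (fst (I ! s) = b \<and> fst (I ! t) = a)) * w (row_swap s t I))"
    unfolding sum_triangle_swap sum_distrib_right ..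
  also have "\<dots> = (\<Sum>s<d. \<Sum>t<d. of_bool (fst (I ! t) < fst (I ! s)) * w (row_swap s t I))"
    by (intro sum.cong refl arg_cong2[where f = "(*)"] sum_below(2) lt) auto
  finally show ?thesis .
qed

lemma sum_col_unit_twice:
  assumes I: "I \<in> tuples k m d"
  shows "(\<Sum>b<m. \<Sum>a<b. col_unit b a (col_unit a b w) I)
    = (\<Sum>s<d. of_nat (snd (I ! s))) * w I
      + (\<Sum>s<d. \<Sum>t<d. of_bool (snd (I ! t) < snd (I ! s)) * w (col_swap s t I))"
proof -
  have lt: "snd (I ! s) < m" if "s < d" for s using tuples_nth[OF I that] by auto
  have "(\<Sum>b<m. \<Sum>a<b. col_unit b a (col_unit a b w) I)
      = (\<Sum>b<m. \<Sum>a<b. \<Sum>s<d. of_bool (snd (I ! s) = b) * w I)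
        + (\<Sum>b<m. \<Sum>a<b. \<Sum>s<d. \<Sum>t<d. of_bool (snd (I ! s) = b \<and> snd (I ! t) = a) * w (col_swap s t I))"
    by (simp add: col_unit_twice[OF I] sum.distrib)
  also have "(\<Sum>b<m. \<Sum>a<b. \<Sum>s<d. of_bool (snd (I ! s) = b) * w I)
      = (\<Sum>s<d. (\<Sum>b<m. \<Sum>a<b. of_bool (snd (I ! s) = b)) * w I)"
    unfolding sum_triangle_swap sum_distrib_right ..
  also have "\<dots> = (\<Sum>s<d. of_nat (snd (I ! s))) * w I"
    by (simp add: sum_below(1) lt sum_distrib_right)
  also have "(\<Sum>b<m. \<Sum>a<b. \<Sum>s<d. \<Sum>t<d. of_bool (snd (I ! s) = b \<and> snd (I ! t) = a) * w (col_swap s t I))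
      = (\<Sum>s<d. \<Sum>t<d. (\<Sum>b<m. \<Sum>a<b. of_bool (snd (I ! s) = b \<and> snd (I ! t) = a)) * w (col_swap s t I))"
    unfolding sum_triangle_swap sum_distrib_right ..
  also have "\<dots> = (\<Sum>s<d. \<Sum>t<d. of_bool (snd (I ! t) < snd (I ! s)) * w (col_swap s t I))"
    by (intro sum.cong refl arg_cong2[where f = "(*)"] sum_below(2) lt) auto
  finally show ?thesis .
qed

text \<open>The diagonal terms count all positions above and to the left of each box. Two boxes in a
  common column or row contribute - \<open>w I\<close>, which removes the occupied positions from
  this count and leaves the gaps. Pairs differing in both coordinates cancel between the row part
  and the column part.\<close>

lemma quadratic_lowering_apply:
  assumes w: "w \<in> ext_power k m d" and I: "I \<in> tuples k m d" and dist: "distinct I"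
  shows "quadratic_lowering w I = of_nat (gaps (set I)) * w I"
proof -
  let ?r = "\<lambda>s. fst (I ! s)" and ?c = "\<lambda>s. snd (I ! s)"
  define f where "f s t = w (row_swap s t I)" for s t
  have len: "length I = d" using I by (rule tuples_length)
  have "(\<Sum>s<d. \<Sum>t<d. of_bool (?r t < ?r s) * f s t)
      = (\<Sum>s<d. \<Sum>t<d. of_bool (?r t < ?r s \<and> ?c t < ?c s) * f s t)
        + (\<Sum>s<d. \<Sum>t<d. of_bool (?r t < ?r s \<and> ?c s < ?c t) * f s t)
        + (\<Sum>s<d. \<Sum>t<d. of_bool (?r t < ?r s \<and> ?c t = ?c s) * f s t)"
    unfolding sum.distrib[symmetric] by (intro sum.cong refl) auto
  \<comment> \<open>In a common column the row swap merely transposes the two entries.\<close>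
  also have "(\<Sum>s<d. \<Sum>t<d. of_bool (?r t < ?r s \<and> ?c t = ?c s) * f s t)
      = (\<Sum>s<d. \<Sum>t<d. - of_bool (?c t = ?c s \<and> ?r t < ?r s) * w I)"
  proof (intro sum.cong refl)
    fix s t assume st: "s \<in> {..<d}" "t \<in> {..<d}"
    have "f s t = - w I" if "?r t < ?r s" "?c t = ?c s"
    proof -
      have "s \<noteq> t" using that by auto
      then show ?thesis
        using ext_power_col_swap[OF w I, of s t] st that col_swap_trivial[of I s t] by (simp add: f_def)
    qed
    then show "of_bool (?r t < ?r s \<and> ?c t = ?c s) * f s t = - of_bool (?c t = ?c s \<and> ?r t < ?r s) * w I"
      by auto
  qed
  finally have rows: "(\<Sum>s<d. \<Sum>t<d. of_bool (?r t < ?r s) * f s t)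
      = (\<Sum>s<d. \<Sum>t<d. of_bool (?r t < ?r s \<and> ?c t < ?c s) * f s t)
        + (\<Sum>s<d. \<Sum>t<d. of_bool (?r t < ?r s \<and> ?c s < ?c t) * f s t)
        - (\<Sum>s<d. \<Sum>t<d. of_bool (?c t = ?c s \<and> ?r t < ?r s)) * w I"
    by (simp add: sum_negf sum_distrib_right)
  have "(\<Sum>s<d. \<Sum>t<d. of_bool (?c t < ?c s) * w (col_swap s t I))
      = (\<Sum>s<d. \<Sum>t<d. - (of_bool (?r t < ?r s \<and> ?c t < ?c s) * f s t))
        + (\<Sum>s<d. \<Sum>t<d. - (of_bool (?r s < ?r t \<and> ?c t < ?c s) * f s t))
        + (\<Sum>s<d. \<Sum>t<d. - (of_bool (?r t = ?r s \<and> ?c t < ?c s) * w I))"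
    unfolding sum.distrib[symmetric]
  proof (intro sum.cong refl)
    fix s t assume st: "s \<in> {..<d}" "t \<in> {..<d}"
    have "w (col_swap s t I) = - f s t" if "?c t < ?c s"
    proof -
      have "s \<noteq> t" using that by auto
      then show ?thesis using ext_power_col_swap[OF w I, of s t] st by (simp add: f_def)
    qed
    moreover have "f s t = w I" if "?r t = ?r s"
      using row_swap_trivial[of I s t] that by (simp add: f_def)
    ultimately show "of_bool (?c t < ?c s) * w (col_swap s t I)
        = - (of_bool (?r t < ?r s \<and> ?c t < ?c s) * f s t)
          + - (of_bool (?r s < ?r t \<and> ?c t < ?c s) * f s t)
          + - (of_bool (?r t = ?r s \<and> ?c t < ?c s) * w I)"
      by (cases "?r t < ?r s"; cases "?r t = ?r s"; cases "?c t < ?c s") auto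
  qed
  \<comment> \<open>For pairs in antidiagonal position \<open>s\<close> and \<open>t\<close> trade
    roles to match the row sum; the row swap is symmetric in them.\<close>
  also have "(\<Sum>s<d. \<Sum>t<d. - (of_bool (?r s < ?r t \<and> ?c t < ?c s) * f s t))
      = (\<Sum>s<d. \<Sum>t<d. - (of_bool (?r t < ?r s \<and> ?c s < ?c t) * f s t))"
  proof (subst sum.swap, intro sum.cong refl)
    fix s t
    show "- (of_bool (?r t < ?r s \<and> ?c s < ?c t) * f t s)
        = - (of_bool (?r t < ?r s \<and> ?c s < ?c t) * f s t)"
      by (cases "s = t") (simp_all add: f_def row_swap_commute[of s t])
  qed
  finally have cols: "(\<Sum>s<d. \<Sum>t<d. of_bool (?c t < ?c s) * w (col_swap s t I))
      = - (\<Sum>s<d. \<Sum>t<d. of_bool (?r t < ?r s \<and> ?c t < ?c s) * f s t)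
        - (\<Sum>s<d. \<Sum>t<d. of_bool (?r t < ?r s \<and> ?c s < ?c t) * f s t)
        - (\<Sum>s<d. \<Sum>t<d. of_bool (?r t = ?r s \<and> ?c t < ?c s)) * w I"
    by (simp add: sum_negf sum_distrib_right)
  have count: "(\<Sum>t<d. of_bool (P t)) = (of_nat (card {t. t < d \<and> P t}) :: complex)" for P
    by (simp add: Int_def)
  have "quadratic_lowering w I = (\<Sum>b<k. \<Sum>a<b. row_unit b a (row_unit a b w) I)
      + (\<Sum>b<m. \<Sum>a<b. col_unit b a (col_unit a b w) I)"
    by (simp add: quadratic_lowering_def sum_fun_apply)
  also have "\<dots> = (\<Sum>s<d. (of_nat (?r s) - (\<Sum>t<d. of_bool (?c t = ?c s \<and> ?r t < ?r s)))
        + (of_nat (?c s) - (\<Sum>t<d. of_bool (?r t = ?r s \<and> ?c t < ?c s)))) * w I"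
    unfolding sum_row_unit_twice[OF I] sum_col_unit_twice[OF I] f_def[symmetric] rows cols
    by (simp add: sum.distrib sum_subtractf algebra_simps)
  also have "(\<Sum>s<d. (of_nat (?r s) - (\<Sum>t<d. of_bool (?c t = ?c s \<and> ?r t < ?r s)))
        + (of_nat (?c s) - (\<Sum>t<d. of_bool (?r t = ?r s \<and> ?c t < ?c s))))
      = (\<Sum>s<d. of_nat (row_gaps (set I) (I ! s) + col_gaps (set I) (I ! s)) :: complex)"
  proof (intro sum.cong refl)
    fix s assume "s \<in> {..<d}"
    then have s: "s < length I" using len by simp
    have "(of_nat (?r s) :: complex) = of_nat (col_gaps (set I) (I ! s))
        + of_nat (card {t. t < d \<and> ?c t = ?c s \<and> ?r t < ?r s})"
      unfolding of_nat_add[symmetric] using col_gaps_nth[OF dist s] len by simp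
    moreover have "(of_nat (?c s) :: complex) = of_nat (row_gaps (set I) (I ! s))
        + of_nat (card {t. t < d \<and> ?r t = ?r s \<and> ?c t < ?c s})"
      unfolding of_nat_add[symmetric] using row_gaps_nth[OF dist s] len by simp
    ultimately show "(of_nat (?r s) - (\<Sum>t<d. of_bool (?c t = ?c s \<and> ?r t < ?r s)))
        + (of_nat (?c s) - (\<Sum>t<d. of_bool (?r t = ?r s \<and> ?c t < ?c s)))
      = (of_nat (row_gaps (set I) (I ! s) + col_gaps (set I) (I ! s)) :: complex)"
      unfolding count by simp
  qed
  also have "\<dots> = of_nat (gaps (set I))"
    unfolding gaps_def by (simp add: sum_set_distinct[OF dist] len)
  finally show ?thesis .
qed

end

subsection \<open>Weights, simplicity and the decomposition\<close>

text \<open>The torus weight: the multiplicities of the row and column indices are the exponents of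
  the diagonal entries in the character by which diagonal matrices act.\<close>

definition weight :: "(nat \<times> nat) list \<Rightarrow> nat multiset \<times> nat multiset" where
  "weight I = (mset (map fst I), mset (map snd I))"

lemma weight_cong: "mset I = mset J \<Longrightarrow> weight I = weight J"
  by (simp add: weight_def)

lemma count_map_nth: "count (mset (map f I)) a = card {t. t < length I \<and> f (I ! t) = a}"
proof -
  have "count (mset (map f I)) a = length (filter (\<lambda>p. f p = a) I)"
    by (induction I) auto
  then show ?thesis by (simp only: length_filter_conv_card)
qed

text \<open>Summed over the boxes, the column index counts the gaps and the occupied positions to
  the left, and the latter total the unordered pairs of boxes in a common row. The row lengths
  determine these pairs, the sum of their squares being twice the number of pairs plus the number of
  boxes. So the total of the row gaps depends only on the weight.\<close>

lemma sum_row_gaps_weight: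
  assumes "distinct I"
  shows "2 * (\<Sum>p\<in>set I. row_gaps (set I) p) + (\<Sum>a\<in>#mset (map fst I). count (mset (map fst I)) a)
    = 2 * (\<Sum>j\<in>#mset (map snd I). j) + length I"
proof -
  let ?n = "length I"
  let ?r = "\<lambda>s. fst (I ! s)" and ?c = "\<lambda>s. snd (I ! s)"
  define P where "P = (\<Sum>s<?n. card {t. t < ?n \<and> ?r t = ?r s \<and> ?c t < ?c s})"
  have "(\<Sum>p\<in>set I. row_gaps (set I) p) + P = (\<Sum>s<?n. ?c s)"
    unfolding sum_set_distinct[OF assms] P_def sum.distrib[symmetric]
    by (intro sum.cong refl row_gaps_nth[OF assms]) simp
  moreover have "(\<Sum>j\<in>#mset (map snd I). j) = (\<Sum>s<?n. ?c s)"
  proof -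
    have "(\<Sum>j\<in>#mset (map snd I). j) = (\<Sum>j\<leftarrow>map snd I. j)"
      by (simp only: mset_map[symmetric] sum_mset_sum_list)
    then show ?thesis by (simp add: sum_list_sum_nth lessThan_atLeast0 del: mset_map)
  qed
  moreover have "(\<Sum>a\<in>#mset (map fst I). count (mset (map fst I)) a)
      = (\<Sum>s<?n. card {t. t < ?n \<and> ?r t = ?r s})"
  proof -
    have "(\<Sum>a\<in>#mset (map fst I). count (mset (map fst I)) a)
        = (\<Sum>a\<leftarrow>map fst I. count (mset (map fst I)) a)"
      by (simp only: mset_map[symmetric] sum_mset_sum_list)
    also have "\<dots> = (\<Sum>s<?n. count (mset (map fst I)) (?r s))"
      by (simp add: sum_list_sum_nth lessThan_atLeast0 del: mset_map)
    finally show ?thesis by (simp only: count_map_nth)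
  qed
  moreover have "(\<Sum>s<?n. card {t. t < ?n \<and> ?r t = ?r s}) = 2 * P + ?n"
  proof -
    let ?Q = "\<lambda>s t. ?r t = ?r s \<and> ?c t < ?c s"
    have card_of_bool: "card {t. t < ?n \<and> Q t} = (\<Sum>t<?n. of_bool (Q t))" for Q :: "nat \<Rightarrow> bool"
      by (simp add: Int_def)
    have P: "P = (\<Sum>s<?n. \<Sum>t<?n. of_bool (?Q s t))"
      unfolding P_def card_of_bool ..
    then have P': "P = (\<Sum>s<?n. \<Sum>t<?n. of_bool (?Q t s))"
      by (subst sum.swap)
    have "(\<Sum>s<?n. card {t. t < ?n \<and> ?r t = ?r s})
        = (\<Sum>s<?n. \<Sum>t<?n. of_bool (?Q s t) + of_bool (?Q t s) + of_bool (t = s))"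
      unfolding card_of_bool
    proof (intro sum.cong refl)
      fix s t assume "s \<in> {..<?n}" "t \<in> {..<?n}"
      then have "?r t = ?r s \<and> ?c t = ?c s \<longleftrightarrow> t = s"
        using nth_eq_iff_index_eq[OF assms, of t s] by (auto simp: prod_eq_iff)
      then show "of_bool (?r t = ?r s) = (of_bool (?Q s t) + of_bool (?Q t s) + of_bool (t = s) :: nat)"
        by (cases "?c t" "?c s" rule: linorder_cases) auto
    qed
    also have "\<dots> = P + P + (\<Sum>s<?n. \<Sum>t<?n. of_bool (t = s))"
      unfolding sum.distrib P[symmetric] P'[symmetric] ..
    also have "(\<Sum>s<?n. \<Sum>t<?n. of_bool (t = s)) = (\<Sum>s<?n. 1 :: nat)"
    proof (intro sum.cong refl)
      fix s assume s: "s \<in> {..<?n}"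
      have "(\<Sum>t<?n. of_bool (t = s)) = (\<Sum>t<?n. if t = s then 1 else 0 :: nat)"
        by (intro sum.cong) auto
      then show "(\<Sum>t<?n. of_bool (t = s)) = (1 :: nat)" using s by simp
    qed
    finally show ?thesis by simp
  qed
  ultimately show ?thesis by simp
qed

text \<open>
  The weight of a Young diagram has multiplicity one: among the sets of boxes with given numbers of
  boxes in the rows and columns, the sum of the column indices forces all rows to be left-justified.
\<close>

lemma weight_boxes:
  assumes la: "la \<in> young_diagrams k m d" and I: "I \<in> tuples k m d" "distinct I"
    and wt: "weight I = weight (boxes la)"
  shows "mset I = mset (boxes la)"
proof -
  have B: "boxes la \<in> tuples k m d" using la by (rule boxes_in_tuples)
  have "2 * (\<Sum>p\<in>set I. row_gaps (set I) p) = 2 * (\<Sum>p\<in>set (boxes la). row_gaps (set (boxes la)) p)"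
    using sum_row_gaps_weight[OF I(2)] sum_row_gaps_weight[OF distinct_boxes, of la] wt
      tuples_length[OF I(1)] tuples_length[OF B]
    unfolding weight_def by (simp only: prod.inject)
  also have "\<dots> = 0" by (simp add: row_gaps_boxes)
  finally have 0: "row_gaps (set I) p = 0" if "p \<in> set I" for p using that by simp
  have row_card: "card {j. (i, j) \<in> set J} = count (mset (map fst J)) i" if "distinct J" for i J
  proof -
    have "bij_betw (\<lambda>t. snd (J ! t)) {t. t < length J \<and> fst (J ! t) = i} {j. (i, j) \<in> set J}"
      unfolding bij_betw_def
    proof
      show "inj_on (\<lambda>t. snd (J ! t)) {t. t < length J \<and> fst (J ! t) = i}"
        using that by (intro inj_onI) (auto simp: nth_eq_iff_index_eq[symmetric] prod_eq_iff)
      show "(\<lambda>t. snd (J ! t)) ` {t. t < length J \<and> fst (J ! t) = i} = {j. (i, j) \<in> set J}"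
      proof (intro Set.equalityI subsetI)
        fix j assume "j \<in> {j. (i, j) \<in> set J}"
        then obtain t where "t < length J" "J ! t = (i, j)"
          by (auto simp: in_set_conv_nth)
        then show "j \<in> (\<lambda>t. snd (J ! t)) ` {t. t < length J \<and> fst (J ! t) = i}"
          by (intro image_eqI[of _ _ t]) auto
      next
        fix j assume "j \<in> (\<lambda>t. snd (J ! t)) ` {t. t < length J \<and> fst (J ! t) = i}"
        then obtain t where "t < length J" "J ! t = (i, j)" by (auto simp: prod_eq_iff)
        then have "(i, j) \<in> set J" by (metis nth_mem)
        then show "j \<in> {j. (i, j) \<in> set J}" by simp
      qed
    qed
    then show ?thesis unfolding count_map_nth by (rule bij_betw_same_card[symmetric])
  qed
  have "{j. (i, j) \<in> set I} = {j. (i, j) \<in> set (boxes la)}" for i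
  proof -
    have "{j. (i, j) \<in> set I} = {..<card {j. (i, j) \<in> set I}}"
      by (rule row_eq_lessThan) (simp_all add: 0)
    also have "card {j. (i, j) \<in> set I} = card {j. (i, j) \<in> set (boxes la)}"
      using wt unfolding row_card[OF I(2)] row_card[OF distinct_boxes] weight_def by (simp only: prod.inject)
    also have "{..<card {j. (i, j) \<in> set (boxes la)}} = {j. (i, j) \<in> set (boxes la)}"
      by (rule row_eq_lessThan[symmetric]) (simp_all add: row_gaps_boxes)
    finally show ?thesis .
  qed
  then have "set I = set (boxes la)" by (auto simp: set_eq_iff)
  then show ?thesis using I(2) distinct_boxes set_eq_iff_mset_eq_distinct by metis
qed

lemma mat_diag_general_linear:
  assumes "\<And>i. x i \<noteq> 0"
  shows "mat_diag n x \<in> general_linear n"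
proof -
  have "mat_diag n x * mat_diag n (\<lambda>i. inverse (x i)) = 1\<^sub>m n"
    "mat_diag n (\<lambda>i. inverse (x i)) * mat_diag n x = 1\<^sub>m n"
    using assms by (simp_all add: mat_diag_diag)
  then have "inverts_mat (mat_diag n x) (mat_diag n (\<lambda>i. inverse (x i)))"
    "inverts_mat (mat_diag n (\<lambda>i. inverse (x i))) (mat_diag n x)"
    by (simp_all add: inverts_mat_def mat_diag_def)
  then show ?thesis
    unfolding general_linear_def invertible_mat_def by (auto simp: mat_diag_def)
qed

text \<open>The transposes enter as adjoints in the proof of simplicity.\<close>

lemma complexify_general_linear:
  assumes g: "g \<in> orthogonal_group n"
  shows "map_mat complex_of_real g \<in> general_linear n"
    "transpose_mat (map_mat complex_of_real g) \<in> general_linear n"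
proof -
  let ?G = "map_mat complex_of_real g"
  have c: "g \<in> carrier_mat n n" "transpose_mat g * g = 1\<^sub>m n" using g by (auto simp: orthogonal_group_def)
  have G: "?G \<in> carrier_mat n n" "transpose_mat ?G \<in> carrier_mat n n" using c by auto
  have "map_mat complex_of_real (transpose_mat g * g) = transpose_mat ?G * ?G"
    using c(1) by (subst of_real_hom.mat_hom_mult) (auto simp: map_mat_transpose)
  then have 1: "transpose_mat ?G * ?G = 1\<^sub>m n"
    unfolding c(2) by (simp add: of_real_hom.mat_hom_one)
  then have 2: "?G * transpose_mat ?G = 1\<^sub>m n"
    by (rule mat_mult_left_right_inverse[OF G(2,1)])
  have "inverts_mat ?G (transpose_mat ?G)" "inverts_mat (transpose_mat ?G) ?G"
    using 1 2 c(1) by (auto simp: inverts_mat_def)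
  then have "invertible_mat ?G" "invertible_mat (transpose_mat ?G)"
    using G c(1) unfolding invertible_mat_def by auto
  then show "?G \<in> general_linear n" "transpose_mat ?G \<in> general_linear n"
    using G by (auto simp: general_linear_def)
qed

context tensor_power
begin

lemma row_unit_closed:
  "(\<And>g h w. w \<in> Z \<Longrightarrow> derivation (gl_kernel g h) w \<in> Z) \<Longrightarrow> w \<in> Z \<Longrightarrow> row_unit a b w \<in> Z"
  by (simp add: row_unit_def)

lemma col_unit_closed:
  "(\<And>g h w. w \<in> Z \<Longrightarrow> derivation (gl_kernel g h) w \<in> Z) \<Longrightarrow> w \<in> Z \<Longrightarrow> col_unit a b w \<in> Z"
  by (simp add: col_unit_def)

lemma row_unit_in_ext_power: "w \<in> ext_power k m d \<Longrightarrow> row_unit a b w \<in> ext_power k m d"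
  unfolding row_unit_def by (rule derivation_in_ext_power)

lemma col_unit_in_ext_power: "w \<in> ext_power k m d \<Longrightarrow> col_unit a b w \<in> ext_power k m d"
  unfolding col_unit_def by (rule derivation_in_ext_power)

text \<open>The coordinate at \<open>I\<close> is fed by lists in which one row index a is replaced
  by b > a; these have larger height than \<open>I\<close>, so the bound on the support
  improves.\<close>

lemma row_unit_height:
  assumes ab: "a < b" "b < k" and ht: "\<And>I. w I \<noteq> 0 \<Longrightarrow> height I < Suc n"
    and nz: "row_unit a b w I \<noteq> 0"
  shows "height I < n"
proof -
  have I: "I \<in> tuples k m d"
    by (rule ccontr) (use nz in \<open>simp add: row_unit_def derivation_def\<close>)
  have "(\<Sum>t<d. of_bool (fst (I ! t) = a) * w (I[t := (b, snd (I ! t))])) \<noteq> 0"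
    using nz row_unit_apply[OF I ab(2)] by simp
  then obtain t where "t \<in> {..<d}" "of_bool (fst (I ! t) = a) * w (I[t := (b, snd (I ! t))]) \<noteq> 0"
    by (rule sum.not_neutral_contains_not_neutral)
  then have t: "t < d" "fst (I ! t) = a" "w (I[t := (b, snd (I ! t))]) \<noteq> 0" by auto
  then have "height (I[t := (b, snd (I ! t))]) < Suc n" by (intro ht)
  then show ?thesis
    using height_update[of t I "(b, snd (I ! t))"] t ab tuples_length[OF I] by simp
qed

lemma col_unit_height:
  assumes ab: "a < b" "b < m" and ht: "\<And>I. w I \<noteq> 0 \<Longrightarrow> height I < Suc n"
    and nz: "col_unit a b w I \<noteq> 0"
  shows "height I < n"
proof -
  have I: "I \<in> tuples k m d"
    by (rule ccontr) (use nz in \<open>simp add: col_unit_def derivation_def\<close>)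
  have "(\<Sum>t<d. of_bool (snd (I ! t) = a) * w (I[t := (fst (I ! t), b)])) \<noteq> 0"
    using nz col_unit_apply[OF I ab(2)] by simp
  then obtain t where "t \<in> {..<d}" "of_bool (snd (I ! t) = a) * w (I[t := (fst (I ! t), b)]) \<noteq> 0"
    by (rule sum.not_neutral_contains_not_neutral)
  then have t: "t < d" "snd (I ! t) = a" "w (I[t := (fst (I ! t), b)]) \<noteq> 0" by auto
  then have "height (I[t := (fst (I ! t), b)]) < Suc n" by (intro ht)
  then show ?thesis
    using height_update[of t I "(fst (I ! t), b)"] t ab tuples_length[OF I] by simp
qed

lemma ext_power_at_young_diagram:
  assumes la: "la \<in> young_diagrams k m d" and w: "w \<in> ext_power k m d" and I: "mset I = mset (boxes la)"
  shows "w I = w (boxes la) * young_tensor la I"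
  using ext_power_proportional[OF young_tensor_in_ext_power[OF la] w I] young_tensor_boxes[OF la]
  by (simp add: mult.commute)

text \<open>The support consists of reorderings of Young diagrams; there all antisymmetric tensors
  are proportional, and \<open>young_tensor la\<close> is 1 at \<open>boxes la\<close>.\<close>

lemma ext_power_no_gaps:
  assumes w: "w \<in> ext_power k m d" and 0: "\<And>I. w I \<noteq> 0 \<Longrightarrow> gaps (set I) = 0"
  shows "w = (\<Sum>la\<in>young_diagrams k m d. scaleT (w (boxes la)) (young_tensor la))"
proof (rule ext)
  fix I
  show "w I = (\<Sum>la\<in>young_diagrams k m d. scaleT (w (boxes la)) (young_tensor la)) I"
  proof (cases "\<exists>la\<in>young_diagrams k m d. mset I = mset (boxes la)")
    case True
    then obtain la where la: "la \<in> young_diagrams k m d" "mset I = mset (boxes la)" ..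
    have "young_tensor mu I = 0" if mu: "mu \<in> young_diagrams k m d" "mu \<noteq> la" for mu
    proof (rule ccontr)
      assume "young_tensor mu I \<noteq> 0"
      then have "mset (boxes mu) = mset (boxes la)" using young_tensor_support[OF mu(1)] la(2) by simp
      then have "set (boxes mu) = set (boxes la)" by (metis set_mset_mset)
      then show False using boxes_inject[of mu la] mu la(1) by (auto simp: young_diagrams_def)
    qed
    then have "(\<Sum>mu\<in>young_diagrams k m d. w (boxes mu) * young_tensor mu I)
        = (\<Sum>mu\<in>{la}. w (boxes mu) * young_tensor mu I)"
      using la(1) by (intro sum.mono_neutral_right) (auto simp: finite_young_diagrams)
    then show ?thesis
      using ext_power_at_young_diagram[OF la(1) w la(2)] by (simp add: sum_fun_apply)
  next
    case False
    have "w I = 0"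
    proof (rule ccontr)
      assume nz: "w I \<noteq> 0"
      then have "I \<in> tuples k m d" "distinct I"
        using ext_power_outside[OF w] ext_power_not_distinct[OF w] by blast+
      then show False using gaps_eq_0_imp_young 0[OF nz] False by blast
    qed
    moreover have "young_tensor la I = 0" if "la \<in> young_diagrams k m d" for la
      using young_tensor_support[OF that] False that by blast
    ultimately show ?thesis by (simp add: sum_fun_apply)
  qed
qed

text \<open>
  On basis vectors that are not Young diagrams the operator \<open>quadratic_lowering\<close> has a nonzero eigenvalue, and
  it factors through vectors of smaller height. Inverting it expresses every such vector by lowering
  operators applied to vectors of smaller height.
\<close>

lemma ext_power_subset_generated:
  assumes Z: "tens.subspace Z" and young: "\<And>la. la \<in> young_diagrams k m d \<Longrightarrow> young_tensor la \<in> Z"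
    and gl: "\<And>g h w. w \<in> Z \<Longrightarrow> derivation (gl_kernel g h) w \<in> Z"
  shows "ext_power k m d \<subseteq> Z"
proof -
  have "w \<in> Z" if "w \<in> ext_power k m d" "\<And>I. w I \<noteq> 0 \<Longrightarrow> height I < n" for n w
    using that
  proof (induction n arbitrary: w)
    case 0
    then have "w = 0" by (auto simp: fun_eq_iff)
    then show ?case using tens.subspace_0[OF Z] by (simp only:)
  next
    case (Suc n)
    note w = Suc.prems(1)
    define w1 where "w1 = (\<lambda>I. of_bool (gaps (set I) = 0) * w I)"
    \<comment> \<open>Where there are no gaps, \<open>inverse 0 = 0\<close> makes \<open>w2\<close>
      vanish; these coordinates are left to \<open>w1\<close>.\<close>
    define w2 where "w2 = (\<lambda>I. inverse (of_nat (gaps (set I))) * w I)"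
    have w1: "w1 \<in> ext_power k m d" and w2: "w2 \<in> ext_power k m d"
      unfolding w1_def w2_def
      using ext_power_mult_set[OF w, of "\<lambda>S. of_bool (gaps S = 0)"]
        ext_power_mult_set[OF w, of "\<lambda>S. inverse (of_nat (gaps S))"] by simp_all
    have ht: "height I < Suc n" if "w2 I \<noteq> 0" for I
      using that Suc.prems(2)[of I] by (auto simp: w2_def)
    have "w1 = (\<Sum>la\<in>young_diagrams k m d. scaleT (w1 (boxes la)) (young_tensor la))"
      by (rule ext_power_no_gaps[OF w1]) (auto simp: w1_def)
    also have "\<dots> \<in> Z"
      by (intro tens.subspace_sum[OF Z] tens.subspace_scale[OF Z] young)
    finally have 1: "w1 \<in> Z" .
    have "row_unit a b w2 \<in> Z" if "a < b" "b < k" for a b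
      by (rule Suc.IH[OF row_unit_in_ext_power[OF w2] row_unit_height[OF that ht]])
    moreover have "col_unit a b w2 \<in> Z" if "a < b" "b < m" for a b
      by (rule Suc.IH[OF col_unit_in_ext_power[OF w2] col_unit_height[OF that ht]])
    ultimately have 2: "quadratic_lowering w2 \<in> Z"
      unfolding quadratic_lowering_def
      by (intro tens.subspace_add[OF Z] tens.subspace_sum[OF Z])
        (auto intro!: row_unit_closed[OF gl, of "row_unit a b w2" for a b]
          col_unit_closed[OF gl, of "col_unit a b w2" for a b])
    have w_eq: "w = w1 + quadratic_lowering w2"
    proof (rule ext)
      fix I
      have lw: "quadratic_lowering w2 \<in> ext_power k m d"
        unfolding quadratic_lowering_def
        by (intro tens.subspace_add[OF subspace_ext_power] tens.subspace_sum[OF subspace_ext_power]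
            row_unit_in_ext_power col_unit_in_ext_power w2)
      show "w I = (w1 + quadratic_lowering w2) I"
      proof (cases "I \<in> tuples k m d \<and> distinct I")
        case True
        then show ?thesis
          using quadratic_lowering_apply[OF w2] by (cases "gaps (set I) = 0") (simp_all add: w1_def w2_def)
      next
        case False
        then have 0: "v I = 0" if "v \<in> ext_power k m d" for v :: "complex tensor"
          using that ext_power_outside ext_power_not_distinct by blast
        show ?thesis using 0[OF w] 0[OF w1] 0[OF lw] by simp
      qed
    qed
    show ?case unfolding w_eq by (rule tens.subspace_add[OF Z 1 2])
  qed
  moreover have "height I < Suc (Max (height ` tuples k m d))"
    if "w \<in> ext_power k m d" "w I \<noteq> 0" for w :: "complex tensor" and I
  proof -
    have "I \<in> tuples k m d" using that ext_power_outside by blast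
    then have "height I \<le> Max (height ` tuples k m d)"
      using finite_tuples by (intro Max_ge) auto
    then show ?thesis by simp
  qed
  ultimately show ?thesis by blast
qed

text \<open>Existence: the sums of components form a subspace that is stable under the Lie algebra
  and contains the Young tensors. Uniqueness: orthogonality and definiteness of the form.\<close>

lemma orthogonal_decomposition_schubert:
  "orthogonal_decomposition k m d (ext_power k m d) (young_diagrams k m d) (complex_schubert_span k m)"
proof -
  let ?L = "young_diagrams k m d" and ?V = "complex_schubert_span k m"
  define Z where "Z = {w. \<exists>c\<in>Pi\<^sub>E ?L ?V. w = (\<Sum>l\<in>?L. c l)}"
  have ZI: "(\<Sum>l\<in>?L. c l) \<in> Z" if "\<And>l. l \<in> ?L \<Longrightarrow> c l \<in> ?V l" for c
    unfolding Z_def using that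
    by (intro CollectI bexI[of _ "restrict c ?L"]) (auto intro: sum.cong)
  note V = subspace_complex_schubert_span
  have "ext_power k m d \<subseteq> Z"
  proof (rule ext_power_subset_generated)
    show "tens.subspace Z"
    proof (rule subspaceI)
      have "(\<Sum>l\<in>?L. (0 :: complex tensor)) \<in> Z" by (rule ZI) (rule tens.subspace_0[OF V])
      then show "0 \<in> Z" by (simp only: sum.neutral_const)
    next
      fix v w assume "v \<in> Z" "w \<in> Z"
      then obtain c c' where c: "c \<in> Pi\<^sub>E ?L ?V" "v = (\<Sum>l\<in>?L. c l)" "c' \<in> Pi\<^sub>E ?L ?V" "w = (\<Sum>l\<in>?L. c' l)"
        unfolding Z_def by blast
      have "(\<Sum>l\<in>?L. c l + c' l) \<in> Z"
        by (rule ZI, rule tens.subspace_add[OF V]) (use c in auto)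
      then show "v + w \<in> Z" by (simp only: c sum.distrib)
    next
      fix r w assume "w \<in> Z"
      then obtain c where c: "c \<in> Pi\<^sub>E ?L ?V" "w = (\<Sum>l\<in>?L. c l)"
        unfolding Z_def by blast
      have "(\<Sum>l\<in>?L. scaleT r (c l)) \<in> Z"
        by (rule ZI, rule tens.subspace_scale[OF V]) (use c in auto)
      then show "scaleT r w \<in> Z" by (simp only: c tens.scale_sum_right)
    qed
  next
    fix la assume la: "la \<in> ?L"
    have "(\<Sum>l\<in>?L. if l = la then young_tensor la else 0) \<in> Z"
    proof (rule ZI)
      fix l assume "l \<in> ?L"
      then show "(if l = la then young_tensor la else 0) \<in> ?V l"
        using young_tensor_in_schubert_span tens.subspace_0[OF V] by (cases "l = la") (simp_all only: if_True if_False refl)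
    qed
    then show "young_tensor la \<in> Z"
      using la finite_young_diagrams by (simp only: sum.delta if_True)
  next
    fix g h and w :: "complex tensor" assume "w \<in> Z"
    then obtain c where c: "c \<in> Pi\<^sub>E ?L ?V" "w = (\<Sum>l\<in>?L. c l)"
      unfolding Z_def by blast
    have "(\<Sum>l\<in>?L. derivation (gl_kernel g h) (c l)) \<in> Z"
      by (rule ZI, rule schubert_span_gl_closed) (use c in auto)
    then show "derivation (gl_kernel g h) w \<in> Z" by (simp only: c derivation_sum)
  qed
  moreover have "c = c'"
    if c: "c \<in> Pi\<^sub>E ?L ?V" "c' \<in> Pi\<^sub>E ?L ?V" and eq: "(\<Sum>l\<in>?L. c l) = (\<Sum>l\<in>?L. c' l)" for c c'
  proof (rule PiE_ext[OF c])
    fix l assume l: "l \<in> ?L"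
    \<comment> \<open>Pairing the vanishing sum of the differences with \<open>e l\<close> isolates
      the squared norm of \<open>e l\<close>.\<close>
    define e where "e l = c l - c' l" for l
    have e: "e l \<in> ?V l" if "l \<in> ?L" for l
      unfolding e_def by (rule tens.subspace_diff[OF V]) (use c that in auto)
    have "(\<Sum>l\<in>?L. e l) = 0" unfolding e_def sum_subtractf eq by simp
    then have "0 = (\<Sum>l'\<in>?L. herm_inner k m d (e l') (e l))"
      by (metis herm_inner_sum_left herm_inner_zero_left)
    also have "\<dots> = (\<Sum>l'\<in>{l}. herm_inner k m d (e l') (e l))"
    proof (rule sum.mono_neutral_right)
      show "\<forall>l'\<in>?L - {l}. herm_inner k m d (e l') (e l) = 0"
        using schubert_span_orthogonal[OF _ l _ e e[OF l]] by blast
    qed (use l finite_young_diagrams in auto)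
    finally have "herm_inner k m d (e l) (e l) = 0" by simp
    moreover have "e l \<in> tensors"
      using e[OF l] complex_schubert_span_subset[OF l] ext_power_subset_tensors by blast
    ultimately have "e l = 0" by (intro herm_inner_definite)
    then show "c l = c' l" by (simp add: e_def)
  qed
  ultimately have "\<exists>!c. c \<in> Pi\<^sub>E ?L ?V \<and> w = (\<Sum>l\<in>?L. c l)" if "w \<in> ext_power k m d" for w
    using that unfolding Z_def by blast
  then show ?thesis
    unfolding orthogonal_decomposition_def direct_sum_decomposition_def
    using finite_young_diagrams subspace_ext_power V complex_schubert_span_subset schubert_span_orthogonal
    by blast
qed

section \<open>Torus weights, simplicity and non-isomorphism\<close>

lemma tensor_action_diag:
  assumes I: "I \<in> tuples k m d"
  shows "tensor_action k m d (mat_diag k x) (mat_diag m y) w I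
    = (\<Prod>t<d. x (fst (I ! t)) * y (snd (I ! t))) * w I"
proof -
  \<comment> \<open>\<open>site_action_id\<close> needs a tensor vanishing off
    \<open>tuples k m d\<close>, and the action sees only that part of \<open>w\<close>.\<close>
  define w' where "w' = (\<lambda>I. if I \<in> tuples k m d then w I else 0)"
  have "w' \<in> tensors" by (simp add: w'_def tensors_def)
  have cut: "site_action K w = site_action K w'" for K
    by (simp add: site_action_def w'_def fun_eq_iff)
  have "tensor_action k m d (mat_diag k x) (mat_diag m y) w
      = site_action (\<lambda>_ p q. (x (fst p) * y (snd p)) * id_kernel p q) w'"
    unfolding tensor_action_eq_site_action cut
    by (rule site_action_cong) (auto simp: mat_diag_def id_kernel_def split: if_splits)
  then have "tensor_action k m d (mat_diag k x) (mat_diag m y) w I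
      = site_action (\<lambda>_ p q. (x (fst p) * y (snd p)) * id_kernel p q) w' I"
    by (simp only:)
  also have "\<dots> = (\<Prod>t<d. x (fst (I ! t)) * y (snd (I ! t))) * site_action (\<lambda>_. id_kernel) w' I"
    using I by (simp only: site_action_def prod.distrib if_True sum_distrib_left mult.assoc)
  finally show ?thesis
    using I site_action_id[OF \<open>w' \<in> tensors\<close>] by (simp add: w'_def)
qed

text \<open>If an index occurs with different multiplicities, the diagonal matrix with entry 2 there
  and 1 elsewhere acts by different powers of 2. As \<open>\<eta>\<close> does not depend on the
  tensor, one group element serves for a vector and its image under a module map.\<close>

lemma torus_separates_weights:
  assumes I: "I \<in> tuples k m d" and J: "J \<in> tuples k m d" and ne: "weight I \<noteq> weight J"
  shows "\<exists>g\<in>general_linear k. \<exists>h\<in>general_linear m. \<exists>\<eta>. \<eta> I \<noteq> \<eta> J \<and>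
    (\<forall>w. \<forall>I\<in>tuples k m d. tensor_action k m d g h w I = \<eta> I * w I)"
proof -
  have len: "length I = d" "length J = d" using I J tuples_length by auto
  have pow: "(\<Prod>t<d. if P t then 2 else 1 :: complex) = 2 ^ card {t. t < d \<and> P t}" for P
    by (simp add: prod.If_cases Int_def)
  have inj: "(2 :: complex) ^ i = 2 ^ j \<longleftrightarrow> i = j" for i j
  proof -
    have "(2 :: complex) ^ i = 2 ^ j \<longleftrightarrow> (of_nat (2 ^ i) :: complex) = of_nat (2 ^ j)" by simp
    also have "\<dots> \<longleftrightarrow> i = j" unfolding of_nat_eq_iff by simp
    finally show ?thesis .
  qed
  consider a where "count (mset (map fst I)) a \<noteq> count (mset (map fst J)) a"
    | a where "count (mset (map snd I)) a \<noteq> count (mset (map snd J)) a"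
    using ne unfolding weight_def by (metis multiset_eqI)
  then show ?thesis
  proof cases
    case 1
    define \<eta> where "\<eta> I = (\<Prod>t<d. (if fst (I ! t) = a then 2 else 1) * (1 :: complex))" for I :: "(nat \<times> nat) list"
    have "\<eta> I \<noteq> \<eta> J"
      using 1 unfolding \<eta>_def mult_1_right pow inj count_map_nth len .
    then show ?thesis
      using tensor_action_diag[of _ "\<lambda>i. if i = a then 2 else 1" "\<lambda>_. 1"]
      by (intro bexI[of _ "mat_diag k (\<lambda>i. if i = a then 2 else 1)"] bexI[of _ "mat_diag m (\<lambda>_. 1)"]
          exI[of _ \<eta>] mat_diag_general_linear) (auto simp: \<eta>_def)
  next
    case 2
    define \<eta> where "\<eta> I = (\<Prod>t<d. (1 :: complex) * (if snd (I ! t) = a then 2 else 1))" for I :: "(nat \<times> nat) list"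
    have "\<eta> I \<noteq> \<eta> J"
      using 2 unfolding \<eta>_def mult_1_left pow inj count_map_nth len .
    then show ?thesis
      using tensor_action_diag[of _ "\<lambda>_. 1" "\<lambda>i. if i = a then 2 else 1"]
      by (intro bexI[of _ "mat_diag m (\<lambda>i. if i = a then 2 else 1)"] bexI[of _ "mat_diag k (\<lambda>_. 1)"]
          exI[of _ \<eta>] mat_diag_general_linear) (auto simp: \<eta>_def)
  qed
qed

text \<open>A weight projection made of group elements: g - \<eta>(I0) annihilates the coordinate at
  \<open>I0\<close>, keeps zero coordinates zero and multiplies the coordinate at \<open>J\<close>
  by a nonzero number. Finitely many such factors remove all other weights.\<close>

lemma weight_vector_in_submodule:
  assumes U: "GL_submodule k m d U" and u: "u \<in> U" "u J \<noteq> 0"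
  shows "\<exists>v\<in>U. v J \<noteq> 0 \<and> (\<forall>I. v I \<noteq> 0 \<longrightarrow> weight I = weight J)"
proof -
  have sub: "tens.subspace U" and ext: "U \<subseteq> ext_power k m d"
    and act: "\<And>g h w. g \<in> general_linear k \<Longrightarrow> h \<in> general_linear m \<Longrightarrow> w \<in> U \<Longrightarrow>
      tensor_action k m d g h w \<in> U"
    using U by (auto simp: GL_submodule_def)
  have J: "J \<in> tuples k m d" using u ext ext_power_outside by blast
  have "\<exists>v\<in>U. v J \<noteq> 0 \<and> (\<forall>I\<in>F. v I = 0)"
    if "finite F" "F \<subseteq> {I \<in> tuples k m d. weight I \<noteq> weight J}" for F
    using that
  proof (induction F)
    case empty
    then show ?case using u by auto
  next
    case (insert I0 F)
    then obtain v where v: "v \<in> U" "v J \<noteq> 0" "\<forall>I\<in>F. v I = 0" by blast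
    have "I0 \<in> tuples k m d" "weight I0 \<noteq> weight J" using insert.prems by auto
    then obtain g h \<eta> where gh: "g \<in> general_linear k" "h \<in> general_linear m" "\<eta> I0 \<noteq> \<eta> J"
      and \<eta>: "\<And>w I. I \<in> tuples k m d \<Longrightarrow> tensor_action k m d g h w I = \<eta> I * w I"
      using torus_separates_weights[OF _ J] by metis
    define v' where "v' = tensor_action k m d g h v - scaleT (\<eta> I0) v"
    have "v' \<in> U"
      unfolding v'_def by (intro tens.subspace_diff[OF sub] tens.subspace_scale[OF sub] act gh v)
    moreover have val: "v' I = (\<eta> I - \<eta> I0) * v I" if "I \<in> tuples k m d" for I
      using that by (simp add: v'_def \<eta> left_diff_distrib)
    moreover have "v' J \<noteq> 0" using val[OF J] gh(3) v(2) by simp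
    moreover have "v' I = 0" if "I \<in> insert I0 F" for I
      using val[of I] that v(3) insert.prems by auto
    ultimately show ?case by blast
  qed
  then obtain v where v: "v \<in> U" "v J \<noteq> 0" "\<forall>I\<in>{I \<in> tuples k m d. weight I \<noteq> weight J}. v I = 0"
    using finite_tuples[of k m d] by (metis (no_types, lifting) finite_Collect_conjI finite_subset mem_Collect_eq subsetI)
  moreover have "weight I = weight J" if "v I \<noteq> 0" for I
    using that v ext ext_power_outside by blast
  ultimately show ?thesis by blast
qed

text \<open>Multiplicity one: by \<open>weight_boxes\<close> the weight confines the support to
  reorderings of \<open>boxes la\<close>, where antisymmetric tensors are proportional.\<close>

lemma weight_vector_eq_young:
  assumes la: "la \<in> young_diagrams k m d" and v: "v \<in> ext_power k m d"
    and wt: "\<And>I. v I \<noteq> 0 \<Longrightarrow> weight I = weight (boxes la)"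
  shows "v = scaleT (v (boxes la)) (young_tensor la)"
proof (rule ext)
  fix I
  show "v I = scaleT (v (boxes la)) (young_tensor la) I"
  proof (cases "mset I = mset (boxes la)")
    case True
    then show ?thesis using ext_power_at_young_diagram[OF la v True] by simp
  next
    case False
    then have "young_tensor la I = 0" using young_tensor_support[OF la] by blast
    moreover have "v I = 0"
    proof (rule ccontr)
      assume nz: "v I \<noteq> 0"
      then have "I \<in> tuples k m d" "distinct I"
        using ext_power_outside[OF v] ext_power_not_distinct[OF v] by blast+
      then show False using weight_boxes[OF la _ _ wt[OF nz]] False by blast
    qed
    ultimately show ?thesis by simp
  qed
qed

lemma schubert_span_subset_submodule:
  assumes la: "la \<in> young_diagrams k m d" and U: "GL_submodule k m d U" and v: "young_tensor la \<in> U"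
  shows "complex_schubert_span k m la \<subseteq> U"
  unfolding complex_schubert_span_eq[OF la]
  by (rule tens.span_minimal)
    (use U v complexify_general_linear(1) in \<open>auto simp: GL_submodule_def\<close>)

text \<open>If some element of \<open>U\<close> is nonzero at \<open>boxes la\<close>, weight
  projection yields a nonzero multiple of the Young tensor in \<open>U\<close>. Otherwise
  \<open>U\<close> is orthogonal to the Young tensor, and by passing to adjoints also to its orbit;
  lying inside the span of that orbit, \<open>U\<close> is orthogonal to itself.\<close>

lemma simple_GL_submodule_schubert_span:
  assumes la: "la \<in> young_diagrams k m d"
  shows "simple_GL_submodule k m d (complex_schubert_span k m la)"
  unfolding simple_GL_submodule_def
proof (intro conjI allI impI)
  let ?V = "complex_schubert_span k m la"
  show "GL_submodule k m d ?V" by (rule GL_submodule_schubert_span[OF la])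
  show "?V \<noteq> {0}"
    using young_tensor_in_schubert_span[OF la] young_tensor_boxes[OF la] by auto
  fix U assume U: "GL_submodule k m d U" and UV: "U \<subseteq> ?V"
  have sub: "tens.subspace U" and ext: "U \<subseteq> ext_power k m d"
    and act: "\<And>g h w. g \<in> general_linear k \<Longrightarrow> h \<in> general_linear m \<Longrightarrow> w \<in> U \<Longrightarrow>
      tensor_action k m d g h w \<in> U"
    using U by (auto simp: GL_submodule_def)
  show "U = {0} \<or> U = ?V"
  proof (cases "\<exists>u\<in>U. u (boxes la) \<noteq> 0")
    case True
    then obtain v where v: "v \<in> U" "v (boxes la) \<noteq> 0" "\<And>I. v I \<noteq> 0 \<Longrightarrow> weight I = weight (boxes la)"
      using weight_vector_in_submodule[OF U] by metis
    define c where "c = v (boxes la)"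
    have v_eq: "v = scaleT c (young_tensor la)"
      unfolding c_def by (rule weight_vector_eq_young[OF la _ v(3)]) (use v(1) ext in blast)
    have "scaleT (inverse c) v = young_tensor la"
      unfolding v_eq using v(2) by (simp add: c_def fun_eq_iff)
    then have "young_tensor la \<in> U"
      using tens.subspace_scale[OF sub v(1), of "inverse c"] by (simp only:)
    then show ?thesis using schubert_span_subset_submodule[OF la U] UV by blast
  next
    case False
    have perp: "herm_inner k m d (young_tensor la) u = 0" if "u \<in> U" for u
    proof -
      have "young_tensor la I * cnj (u I) = 0" for I
      proof (cases "young_tensor la I = 0")
        case nz: False
        have "u \<in> ext_power k m d" "u (boxes la) = 0" using that ext False by auto
        then show ?thesis
          using ext_power_at_young_diagram[OF la _ young_tensor_support[OF la nz], of u] by simp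
      qed simp
      then have "(\<Sum>I\<in>tuples k m d. young_tensor la I * cnj (u I)) = 0" by (intro sum.neutral) blast
      then show ?thesis by (simp add: herm_inner_def)
    qed
    have "herm_inner k m d v u = 0" if u: "u \<in> U" and v: "v \<in> ?V" for u v
    proof (rule herm_inner_eq_0_span[OF _ v[unfolded complex_schubert_span_eq[OF la]]])
      fix x
      assume "x \<in> {tensor_action k m d (complexify g) (complexify h) (young_tensor la) | g h.
          g \<in> orthogonal_group k \<and> h \<in> orthogonal_group m}"
      then obtain g h where x: "x = tensor_action k m d (complexify g) (complexify h) (young_tensor la)"
        and gh: "g \<in> orthogonal_group k" "h \<in> orthogonal_group m" by blast
      have c: "g \<in> carrier_mat k k" "h \<in> carrier_mat m m" using gh by (auto simp: orthogonal_group_def)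
      \<comment> \<open>The adjoint of a real matrix is its transpose, which is again invertible and
        so keeps \<open>u\<close> in \<open>U\<close>.\<close>
      have "herm_inner k m d x u = herm_inner k m d (young_tensor la)
          (tensor_action k m d (transpose_mat (complexify g)) (transpose_mat (complexify h)) u)"
        unfolding x tensor_action_eq_site_action herm_inner_site_action
        by (intro arg_cong2[where f = "herm_inner k m d"] refl site_action_cong) (use c in auto)
      then show "herm_inner k m d x u = 0"
        using perp act[OF complexify_general_linear(2)[OF gh(1)] complexify_general_linear(2)[OF gh(2)] u]
        by simp
    qed
    then have "u = 0" if "u \<in> U" for u
      using that UV ext ext_power_subset_tensors by (intro herm_inner_definite) auto
    then have "U = {0}" using tens.subspace_0[OF sub] by blast
    then show ?thesis ..
  qed
qed

text \<open>An isomorphism preserves weights, so by multiplicity one in the common exterior power it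
  maps \<open>young_tensor la\<close> to a multiple of itself. But the span of \<open>mu\<close> is
  orthogonal to this vector, so the image would vanish.\<close>

lemma not_GL_isomorphic_schubert_span:
  assumes la: "la \<in> young_diagrams k m d" and mu: "mu \<in> young_diagrams k m d" and ne: "la \<noteq> mu"
  shows "\<not> GL_isomorphic k m d (complex_schubert_span k m la) (complex_schubert_span k m mu)"
proof
  let ?V = "complex_schubert_span k m"
  assume "GL_isomorphic k m d (?V la) (?V mu)"
  then obtain f where f: "bij_betw f (?V la) (?V mu)"
    and scale: "\<And>c w. w \<in> ?V la \<Longrightarrow> f (scaleT c w) = scaleT c (f w)"
    and act: "\<And>g h w. g \<in> general_linear k \<Longrightarrow> h \<in> general_linear m \<Longrightarrow> w \<in> ?V la \<Longrightarrow>
      f (tensor_action k m d g h w) = tensor_action k m d g h (f w)"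
    unfolding GL_isomorphic_def by blast
  let ?v = "young_tensor la"
  have v: "?v \<in> ?V la" by (rule young_tensor_in_schubert_span[OF la])
  have B: "boxes la \<in> tuples k m d" using la by (rule boxes_in_tuples)
  define u where "u = f ?v"
  have uV: "u \<in> ?V mu" using f v by (auto simp: u_def bij_betw_def)
  then have u: "u \<in> ext_power k m d" using complex_schubert_span_subset[OF mu] by blast
  have "weight I = weight (boxes la)" if nz: "u I \<noteq> 0" for I
  proof (rule ccontr)
    assume "weight I \<noteq> weight (boxes la)"
    moreover have I: "I \<in> tuples k m d" using nz ext_power_outside[OF u] by blast
    ultimately obtain g h \<eta> where gh: "g \<in> general_linear k" "h \<in> general_linear m" "\<eta> I \<noteq> \<eta> (boxes la)"
      and \<eta>: "\<And>w I. I \<in> tuples k m d \<Longrightarrow> tensor_action k m d g h w I = \<eta> I * w I"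
      using torus_separates_weights[OF _ B] by metis
    \<comment> \<open>The Young tensor is an eigenvector of the torus element; transported through
      \<open>f\<close>, this forces the coordinate \<open>u I\<close> of another weight to
      vanish.\<close>
    have "tensor_action k m d g h ?v = scaleT (\<eta> (boxes la)) ?v"
    proof (rule tensors_eqI)
      fix J assume J: "J \<in> tuples k m d"
      have "tensor_action k m d g h ?v \<in> ext_power k m d"
        using GL_submodule_schubert_span[OF la] gh v by (auto simp: GL_submodule_def)
      moreover have "tensor_action k m d g h ?v L = 0" if "?v L = 0" for L
        using \<eta>[of L ?v] that by (cases "L \<in> tuples k m d") (simp_all add: tensor_action_def)
      ultimately have "tensor_action k m d g h ?v
          = scaleT (tensor_action k m d g h ?v (boxes la)) ?v"
        using young_tensor_support[OF la] weight_cong by (intro weight_vector_eq_young[OF la]) metis+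
      then show "tensor_action k m d g h ?v J = scaleT (\<eta> (boxes la)) ?v J"
        using \<eta>[OF B, of ?v] young_tensor_boxes[OF la] by simp
    next
      show "tensor_action k m d g h ?v \<in> tensors" by (simp add: tensor_action_eq_site_action)
      show "scaleT (\<eta> (boxes la)) ?v \<in> tensors"
        using v complex_schubert_span_subset[OF la] ext_power_subset_tensors
        by (intro tens.subspace_scale[OF subspace_tensors]) blast
    qed
    then have "tensor_action k m d g h u = scaleT (\<eta> (boxes la)) u"
      using act[OF gh(1,2) v] scale[OF v] by (simp only: u_def)
    then have "\<eta> I * u I = \<eta> (boxes la) * u I"
      using \<eta>[OF I, of u] by (simp only: scaleT_apply)
    then show False
      using gh(3) mult_right_cancel[OF nz, of "\<eta> I" "\<eta> (boxes la)"] by blast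
  qed
  then have u_eq: "u = scaleT (u (boxes la)) ?v" by (intro weight_vector_eq_young[OF la u])
  have "herm_inner k m d u ?v = 0"
    using herm_inner_young_tensor[OF mu la _ uV] ne by blast
  then have "herm_inner k m d u u = 0"
  proof -
    have "herm_inner k m d u u = u (boxes la) * herm_inner k m d ?v u"
      by (subst u_eq) (rule herm_inner_scale_left)
    also have "herm_inner k m d ?v u = 0"
      using \<open>herm_inner k m d u ?v = 0\<close> by (subst herm_inner_eq_0_sym)
    finally show ?thesis by simp
  qed
  then have "u = 0"
    using u ext_power_subset_tensors by (intro herm_inner_definite) auto
  moreover have "f 0 = 0"
    using scale[OF v, of 0] by (simp only: tens.scale_zero_left)
  ultimately have "?v = 0"
    using f v tens.subspace_0[OF subspace_complex_schubert_span] unfolding u_def bij_betw_def inj_on_def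
    by metis
  then show False using young_tensor_boxes[OF la] by simp
qed

end

theorem proposition8p21:
  fixes k m d :: nat
  assumes "k \<ge> 1" and "m \<ge> 1" and "d \<le> k * m"
  shows "orthogonal_decomposition k m d (ext_power k m d)
           (young_diagrams k m d) (complex_schubert_span k m)
       \<and> (\<forall>la \<in> young_diagrams k m d. simple_GL_submodule k m d (complex_schubert_span k m la))
       \<and> (\<forall>la \<in> young_diagrams k m d. \<forall>mu \<in> young_diagrams k m d. la \<noteq> mu \<longrightarrow>
            \<not> GL_isomorphic k m d (complex_schubert_span k m la) (complex_schubert_span k m mu))"
  using tensor_power.orthogonal_decomposition_schubert
    tensor_power.simple_GL_submodule_schubert_span
    tensor_power.not_GL_isomorphic_schubert_span
  by blast

end
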